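(* Let $f$ be a polynomial diffeomorphism of $\mathbb C^2$ of dynamical degree $d>1$, and let $\psi_S=\{\psi_x:x\in S\}$ be a normalized invariant family of injective holomorphic immersions as described in the context, with associated functions $m_x$, $M$ and multipliers $\lambda_x$. The following are equivalent: (1) $\psi_S$ is a normal family. (2) $M(r_0)<\infty$ for some $1<r_0<\infty$. (3) For all $0<r_1<r_2<\infty$ there is a constant $k<\infty$ such that $m_x(r_2)/m_x(r_1)\le k$ for all $x\in S$. (4) There exists $\kappa>1$ such that $|\lambda_x|\ge\kappa$ for all $x\in S$. (5) There exist $C,\beta<\infty$ such that $m_x(r)\le Cr^\beta$ for all $x\in S$ and all $r\ge1$.
   Context: $f:\mathbb C^2\to\mathbb C^2$ is a polynomial diffeomorphism of dynamical degree $d>1$ (up to polynomial conjugacy, a finite composition of generalized Hénon maps, of degree $d$). $K^\pm$ is the set of points with bounded forward/backward orbit, $J^\pm=\partial K^\pm$, and $G^+(x)=\lim_{n\to\infty}d^{-n}\log^+\|f^n(x)\|$, so $G^+\circ f=d\,G^+$ and $K^+=\{G^+=0\}$. A saddle point is a periodic point with one multiplier of modulus $>1$ and the other of modulus $<1$; $J^*$ is the closure of the set of saddle points. Normalized invariant family: $S\subset J^*$ is a dense set with $f(S)=S$, and for each $x\in S$, $\psi_x:\mathbb C\to\mathbb C^2$ is an injective holomorphic immersion such that: (i) $x\in\psi_x(\mathbb C)\subset J^-$; (ii) $f(\psi_x(\mathbb C))=\psi_{fx}(\mathbb C)$, and for $x_1,x_2\in S$ the sets $\psi_{x_1}(\mathbb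 C),\psi_{x_2}(\mathbb C)$ are either disjoint or equal; (iii) $\psi_x(0)=x$ and $\max_{|\zeta|\le1}G^+(\psi_x(\zeta))=1$. (Condition (iii) determines the parametrization $\psi_x$ up to replacing $\zeta$ by $e^{i\theta}\zeta$. Example: $S$ the set of saddle points, $\psi_x$ a normalized uniformization of the unstable manifold $W^u(x)$.) Notation: $m_x(r)=\max_{|\zeta|\le r}G^+(\psi_x(\zeta))$, $M(r)=\sup_{x\in S}m_x(r)$, and $\lambda_x\in\mathbb C$ is the number with $f(\psi_x(\zeta))=\psi_{fx}(\lambda_x\zeta)$ for all $\zeta$ ($|\lambda_x|$ is well defined). *)

theory Defs
  imports "HOL-Complex_Analysis.Complex_Analysis"
begin

type_synonym C2 = "complex \<times> complex"

section \<open>Polynomial diffeomorphisms and the dynamical degree\<close>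

definition poly_fun_deg_le :: "nat \<Rightarrow> (C2 \<Rightarrow> complex) \<Rightarrow> bool" where
  "poly_fun_deg_le n p \<longleftrightarrow>
     (\<exists>a :: nat \<Rightarrow> nat \<Rightarrow> complex. \<forall>z w. p (z, w) = (\<Sum>i\<le>n. \<Sum>j\<le>n - i. a i j * z ^ i * w ^ j))"

definition poly_map_deg_le :: "nat \<Rightarrow> (C2 \<Rightarrow> C2) \<Rightarrow> bool" where
  "poly_map_deg_le n f \<longleftrightarrow>
     poly_fun_deg_le n (\<lambda>x. fst (f x)) \<and> poly_fun_deg_le n (\<lambda>x. snd (f x))"

definition polynomial_map :: "(C2 \<Rightarrow> C2) \<Rightarrow> bool" where
  "polynomial_map f \<longleftrightarrow> (\<exists>n. poly_map_deg_le n f)"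

definition map_degree :: "(C2 \<Rightarrow> C2) \<Rightarrow> nat" where
  "map_degree f = (LEAST n. poly_map_deg_le n f)"

definition polynomial_diffeo :: "(C2 \<Rightarrow> C2) \<Rightarrow> bool" where
  "polynomial_diffeo f \<longleftrightarrow> bij f \<and> polynomial_map f \<and> polynomial_map (inv f)"

definition has_dynamical_degree :: "(C2 \<Rightarrow> C2) \<Rightarrow> real \<Rightarrow> bool" where
  "has_dynamical_degree f d \<longleftrightarrow> (\<lambda>n. root n (real (map_degree (f ^^ n)))) \<longlonglongrightarrow> d"

section \<open>Invariant sets and the Green function\<close>

definition K_plus :: "(C2 \<Rightarrow> C2) \<Rightarrow> C2 set" where
  "K_plus f = {x. bounded (range (\<lambda>n. (f ^^ n) x))}"

definition K_minus :: "(C2 \<Rightarrow> C2) \<Rightarrow> C2 set" where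
  "K_minus f = K_plus (inv f)"

definition J_minus :: "(C2 \<Rightarrow> C2) \<Rightarrow> C2 set" where
  "J_minus f = frontier (K_minus f)"

text \<open>Here \<open>ln (max 1 t)\<close> is \<open>log\<^sup>+ t\<close>.\<close>

definition G_plus :: "(C2 \<Rightarrow> C2) \<Rightarrow> real \<Rightarrow> C2 \<Rightarrow> real" where
  "G_plus f d x = lim (\<lambda>n. ln (max 1 (norm ((f ^^ n) x))) / d ^ n)"

definition multiplier :: "(C2 \<Rightarrow> C2) \<Rightarrow> nat \<Rightarrow> C2 \<Rightarrow> complex \<Rightarrow> bool" where
  "multiplier f n x c \<longleftrightarrow>
     (\<exists>v. v \<noteq> 0 \<and> frechet_derivative (f ^^ n) (at x) v = (c * fst v, c * snd v))"

text \<open>Any period \<open>n\<close> may be used: passing from the minimal period to a multiple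
  replaces both multipliers by the same power of themselves.\<close>

definition saddle_point :: "(C2 \<Rightarrow> C2) \<Rightarrow> C2 \<Rightarrow> bool" where
  "saddle_point f x \<longleftrightarrow>
     (\<exists>n>0. (f ^^ n) x = x \<and>
        (\<exists>a b. multiplier f n x a \<and> multiplier f n x b \<and> norm a > 1 \<and> norm b < 1))"

definition J_star :: "(C2 \<Rightarrow> C2) \<Rightarrow> C2 set" where
  "J_star f = closure {x. saddle_point f x}"

section \<open>Normalized invariant families\<close>

definition injective_holomorphic_immersion :: "(complex \<Rightarrow> C2) \<Rightarrow> bool" where
  "injective_holomorphic_immersion g \<longleftrightarrow>
     inj g \<and> (\<lambda>z. fst (g z)) holomorphic_on UNIV \<and> (\<lambda>z. snd (g z)) holomorphic_on UNIV \<and>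
     (\<forall>z. (deriv (\<lambda>z. fst (g z)) z, deriv (\<lambda>z. snd (g z)) z) \<noteq> (0, 0))"

text \<open>The function \<open>m\<^sub>x(r)\<close>. The Green function of a polynomial diffeomorphism of dynamical
  degree \<open>d > 1\<close> is continuous, so for holomorphic \<open>\<psi> x\<close> the supremum over the compact disk is a
  maximum.\<close>

definition growth ::
  "(C2 \<Rightarrow> C2) \<Rightarrow> real \<Rightarrow> (C2 \<Rightarrow> complex \<Rightarrow> C2) \<Rightarrow> C2 \<Rightarrow> real \<Rightarrow> real" where
  "growth f d \<psi> x r = (SUP z\<in>cball 0 r. G_plus f d (\<psi> x z))"

text \<open>The function \<open>M(r)\<close>, possibly infinite.\<close>

definition sup_growth ::
  "(C2 \<Rightarrow> C2) \<Rightarrow> real \<Rightarrow> C2 set \<Rightarrow> (C2 \<Rightarrow> complex \<Rightarrow> C2) \<Rightarrow> real \<Rightarrow> ereal" where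
  "sup_growth f d S \<psi> r = (SUP x\<in>S. ereal (growth f d \<psi> x r))"

definition normalized_invariant_family ::
  "(C2 \<Rightarrow> C2) \<Rightarrow> real \<Rightarrow> C2 set \<Rightarrow> (C2 \<Rightarrow> complex \<Rightarrow> C2) \<Rightarrow> bool" where
  "normalized_invariant_family f d S \<psi> \<longleftrightarrow>
     S \<subseteq> J_star f \<and> J_star f \<subseteq> closure S \<and> f ` S = S \<and>
     (\<forall>x\<in>S. injective_holomorphic_immersion (\<psi> x)) \<and>
     (\<forall>x\<in>S. x \<in> range (\<psi> x) \<and> range (\<psi> x) \<subseteq> J_minus f) \<and>
     (\<forall>x\<in>S. f ` range (\<psi> x) = range (\<psi> (f x))) \<and>
     (\<forall>x\<in>S. \<forall>y\<in>S. range (\<psi> x) \<inter> range (\<psi> y) = {} \<or> range (\<psi> x) = range (\<psi> y)) \<and>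
     (\<forall>x\<in>S. \<psi> x 0 = x \<and> growth f d \<psi> x 1 = 1)"

text \<open>The number \<open>\<lambda>\<^sub>x\<close>.\<close>

definition leaf_multiplier :: "(C2 \<Rightarrow> C2) \<Rightarrow> (C2 \<Rightarrow> complex \<Rightarrow> C2) \<Rightarrow> C2 \<Rightarrow> complex" where
  "leaf_multiplier f \<psi> x = (THE c. \<forall>z. f (\<psi> x z) = \<psi> (f x) (c * z))"

text \<open>Normality of a family of maps on the whole plane. Subsequences that diverge locally
  uniformly to infinity are not admitted; for a normalized invariant family they cannot occur,
  since \<open>\<psi> x 0 = x\<close> lies in the compact set \<open>J_star f\<close>.\<close>

definition normal_family :: "(complex \<Rightarrow> C2) set \<Rightarrow> bool" where
  "normal_family F \<longleftrightarrow>
     (\<forall>s :: nat \<Rightarrow> complex \<Rightarrow> C2. range s \<subseteq> F \<longrightarrow>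
        (\<exists>g r. strict_mono (r :: nat \<Rightarrow> nat) \<and>
           (\<forall>K. compact K \<longrightarrow> uniform_limit K (\<lambda>n. s (r n)) g sequentially)))"

end

theory Submission
  imports Defs "HOL-Computational_Algebra.Fundamental_Theorem_Algebra"
begin

text \<open>
  The equivalence rests on one estimate for the dynamics. Write \<open>L(x) = log\<^sup>+ \<parallel>x\<parallel>\<close>. There is a
  constant \<open>C\<close> such that \<open>\<bar>L(f x) - d L(x)\<bar> \<le> C\<close> for all \<open>x\<close> in the closure of \<open>K\<^sup>-\<close>
  (\<open>log_norm_forward_estimate\<close>). By telescoping, the limit defining \<open>G\<^sup>+\<close> exists on this forward
  invariant set, it satisfies \<open>G\<^sup>+ \<circ> f = d G\<^sup>+\<close>, and \<open>G\<^sup>+ - L\<close> is bounded there. So on the leaves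
  \<open>\<psi>\<^sub>x(\<complex>) \<subseteq> J\<^sup>-\<close> a bound on \<open>G\<^sup>+\<close> is the same as a bound on the norm.

  The estimate holds for every polynomial automorphism, not only for compositions of Henon maps,
  and its proof uses the structure of the automorphism group of the plane. First, every automorphism
  is a word in the coordinate swap and the triangular maps \<open>(x, y) \<mapsto> (a x + b, c y + p(x))\<close>
  (\<open>polynomial_diffeo_in_triang_words\<close>). For this one reduces the degrees \<open>k\<close>, \<open>l\<close> in \<open>t\<close> of the two
  components \<open>u(s, t)\<close>, \<open>v(s, t)\<close>. A lower bound for the degree in \<open>t\<close> of \<open>F(u, v)\<close>, obtained by
  applying the derivation \<open>w \<mapsto> u\<^sub>s w\<^sub>t - u\<^sub>t w\<^sub>s\<close> repeatedly, shows that \<open>k\<close> divides \<open>l\<close> or conversely,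
  because \<open>t\<close> itself, of degree 1, is of the form \<open>F(u, v)\<close>; and because \<open>s\<close> is of this form, the
  leading coefficients are compatible, so that some \<open>v - c u\<^sup>m\<close> has smaller degree. Second, after
  cyclic reduction, either the degrees of the iterates of \<open>f\<close> are bounded, which contradicts \<open>d > 1\<close>, or
  \<open>f = \<phi> \<circ> h \<circ> \<phi>\<^sup>-\<^sup>1\<close> where \<open>h\<close> is a composition of generalized Henon maps and no cancellation occurs in
  the product of \<open>\<phi>\<close> and \<open>h\<close> (\<open>conjugate_to_reduced\<close>). On a cone \<open>\<bar>y\<bar> \<le> \<bar>x\<bar>\<close> near infinity each
  nonlinear letter multiplies \<open>L\<close> by its degree up to a bounded error, and all points of \<open>K\<^sup>-(h)\<close> outside
  a bounded set lie in this cone. This gives the estimate for \<open>h\<close>, then for \<open>f\<close>, and it also identifies \<open>d\<close>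
  with the product of the degrees of the letters of \<open>h\<close>.

  The number \<open>\<lambda>\<^sub>x\<close> exists because \<open>\<psi>\<^bsub>fx\<^esub>\<^sup>-\<^sup>1 \<circ> f \<circ> \<psi>\<^sub>x\<close> is a holomorphic bijection of the plane
  fixing \<open>0\<close>. Only holomorphy needs an argument, since the leaves need not be embedded: by Baire's theorem
  the closed set where the map fails to be holomorphic has a point near which the map is bounded on this
  set, and there the identity theorem applies to a local equation of the leaf (\<open>reparametrization_holomorphic\<close>).

  It remains to use \<open>m\<^bsub>fx\<^esub>(\<bar>\<lambda>\<^sub>x\<bar> r) = d m\<^sub>x(r)\<close> and the convexity of \<open>m\<^sub>x\<close> in \<open>log r\<close>. Normality bounds
  the family, hence \<open>G\<^sup>+\<close>, on a disk of radius greater than 1. A bound \<open>m\<^sub>y(r\<^sub>0) \<le> M\<close> for all \<open>y\<close> with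
  \<open>r\<^sub>0 > 1\<close> forces \<open>\<bar>\<lambda>\<^sub>x\<bar>\<close> away from 1 by convexity, since \<open>m\<^bsub>fx\<^esub>(1) = 1\<close> and \<open>m\<^bsub>fx\<^esub>(\<bar>\<lambda>\<^sub>x\<bar>) = d\<close>. If
  \<open>\<bar>\<lambda>\<^sub>x\<bar> \<ge> \<kappa> > 1\<close> for all \<open>x\<close>, iteration gives \<open>m\<^sub>x(\<kappa>\<^sup>n) \<le> d\<^sup>n\<close> and \<open>m\<^sub>x(\<kappa>\<^sup>-\<^sup>n) \<ge> d\<^sup>-\<^sup>n\<close>, which are the
  power bound on \<open>m\<^sub>x\<close> and the bound on the quotients \<open>m\<^sub>x(r\<^sub>2) / m\<^sub>x(r\<^sub>1)\<close>. The power bound makes the family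
  bounded on compact sets, so it is normal by Montel's theorem; the bound on the quotients with \<open>r\<^sub>1 = 1\<close>
  bounds \<open>m\<^sub>x(r\<^sub>2)\<close>.
\<close>

section \<open>Polynomial maps of bounded degree\<close>

text \<open>A coefficient array supported in the triangle \<open>i + j \<le> n\<close> may be summed over any
square containing the triangle. Sums over squares of one fixed size are what the algebra below uses.\<close>

lemma poly_fun_deg_le_iff:
  "poly_fun_deg_le n p \<longleftrightarrow> (\<exists>a. (\<forall>i j. a i j \<noteq> 0 \<longrightarrow> i + j \<le> n) \<and>
     (\<forall>N\<ge>n. \<forall>z w. p (z, w) = (\<Sum>i\<le>N. \<Sum>j\<le>N. a i j * z ^ i * w ^ j)))"
proof -
  have key: "(\<Sum>i\<le>n. \<Sum>j\<le>n - i. a i j * z ^ i * w ^ j) =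
      (\<Sum>i\<le>N. \<Sum>j\<le>N. (if i + j \<le> n then a i j else 0) * z ^ i * w ^ j)"
    if "N \<ge> n" for a :: "nat \<Rightarrow> nat \<Rightarrow> complex" and N and z w :: complex
  proof -
    have "(\<Sum>i\<le>N. \<Sum>j\<le>N. (if i + j \<le> n then a i j else 0) * z ^ i * w ^ j)
        = (\<Sum>i\<le>n. \<Sum>j\<le>N. (if i + j \<le> n then a i j else 0) * z ^ i * w ^ j)"
      using that by (intro sum.mono_neutral_right) auto
    also have "\<dots> = (\<Sum>i\<le>n. \<Sum>j\<le>n - i. a i j * z ^ i * w ^ j)"
    proof (rule sum.cong[OF refl])
      fix i assume "i \<in> {..n}"
      thus "(\<Sum>j\<le>N. (if i + j \<le> n then a i j else 0) * z ^ i * w ^ j) = (\<Sum>j\<le>n - i. a i j * z ^ i * w ^ j)"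
        using that by (intro sum.mono_neutral_cong_right) auto
    qed
    finally show ?thesis by simp
  qed
  show ?thesis
  proof
    assume "poly_fun_deg_le n p"
    then obtain a where "\<And>z w. p (z, w) = (\<Sum>i\<le>n. \<Sum>j\<le>n - i. a i j * z ^ i * w ^ j)"
      by (auto simp: poly_fun_deg_le_def)
    thus "\<exists>a. (\<forall>i j. a i j \<noteq> 0 \<longrightarrow> i + j \<le> n) \<and>
     (\<forall>N\<ge>n. \<forall>z w. p (z, w) = (\<Sum>i\<le>N. \<Sum>j\<le>N. a i j * z ^ i * w ^ j))"
      using key by (intro exI[of _ "\<lambda>i j. if i + j \<le> n then a i j else 0"]) auto
  next
    assume "\<exists>a. (\<forall>i j. a i j \<noteq> 0 \<longrightarrow> i + j \<le> n) \<and>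
     (\<forall>N\<ge>n. \<forall>z w. p (z, w) = (\<Sum>i\<le>N. \<Sum>j\<le>N. a i j * z ^ i * w ^ j))"
    then obtain a where a: "\<And>i j. a i j \<noteq> 0 \<Longrightarrow> i + j \<le> n"
       "\<And>z w. p (z, w) = (\<Sum>i\<le>n. \<Sum>j\<le>n. a i j * z ^ i * w ^ j)" by blast
    have "(\<lambda>i j. if i + j \<le> n then a i j else 0) = a" using a(1) by (auto simp: fun_eq_iff)
    hence "p (z, w) = (\<Sum>i\<le>n. \<Sum>j\<le>n - i. a i j * z ^ i * w ^ j)" for z w
      using key[of n a z w] a(2) by (metis (no_types, lifting) order_refl sum.cong)
    thus "poly_fun_deg_le n p" by (auto simp: poly_fun_deg_le_def)
  qed
qed

lemma poly_fun_mono: "poly_fun_deg_le n p \<Longrightarrow> n \<le> m \<Longrightarrow> poly_fun_deg_le m p"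
  unfolding poly_fun_deg_le_iff by (meson le_trans)

lemma poly_fun_const: "poly_fun_deg_le n (\<lambda>x. c)"
  by (rule poly_fun_mono[of 0]) (auto simp: poly_fun_deg_le_def intro!: exI[of _ "\<lambda>i j. c"])

lemma poly_fun_add:
  assumes "poly_fun_deg_le n p" "poly_fun_deg_le n q"
  shows "poly_fun_deg_le n (\<lambda>x. p x + q x)"
proof -
  obtain a b where "\<And>z w. p (z, w) = (\<Sum>i\<le>n. \<Sum>j\<le>n - i. a i j * z ^ i * w ^ j)"
    "\<And>z w. q (z, w) = (\<Sum>i\<le>n. \<Sum>j\<le>n - i. b i j * z ^ i * w ^ j)"
    using assms by (auto simp: poly_fun_deg_le_def)
  thus ?thesis unfolding poly_fun_deg_le_def
    by (intro exI[of _ "\<lambda>i j. a i j + b i j"]) (simp add: algebra_simps sum.distrib)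
qed

lemma poly_fun_cmult:
  assumes "poly_fun_deg_le n p" shows "poly_fun_deg_le n (\<lambda>x. c * p x)"
proof -
  obtain a where "\<And>z w. p (z, w) = (\<Sum>i\<le>n. \<Sum>j\<le>n - i. a i j * z ^ i * w ^ j)"
    using assms by (auto simp: poly_fun_deg_le_def)
  thus ?thesis unfolding poly_fun_deg_le_def
    by (intro exI[of _ "\<lambda>i j. c * a i j"]) (simp add: algebra_simps sum_distrib_left)
qed

lemma poly_fun_sum:
  "(\<And>i. i \<in> A \<Longrightarrow> poly_fun_deg_le n (p i)) \<Longrightarrow> poly_fun_deg_le n (\<lambda>x. \<Sum>i\<in>A. p i x)"
  by (induction A rule: infinite_finite_induct) (auto intro!: poly_fun_add poly_fun_const)

lemma poly_fun_swap:
  assumes "poly_fun_deg_le n p" shows "poly_fun_deg_le n (\<lambda>x. p (prod.swap x))"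
proof -
  obtain a where a: "(\<forall>i j. a i j \<noteq> 0 \<longrightarrow> i + j \<le> n)"
     "(\<forall>N\<ge>n. \<forall>z w. p (z, w) = (\<Sum>i\<le>N. \<Sum>j\<le>N. a i j * z ^ i * w ^ j))"
    using assms unfolding poly_fun_deg_le_iff by blast
  show ?thesis unfolding poly_fun_deg_le_iff
  proof (intro exI[of _ "\<lambda>i j. a j i"] conjI allI impI)
    fix N z w assume "n \<le> N"
    hence "p (w, z) = (\<Sum>i\<le>N. \<Sum>j\<le>N. a i j * w ^ i * z ^ j)" using a(2) by blast
    also have "\<dots> = (\<Sum>i\<le>N. \<Sum>j\<le>N. a j i * z ^ i * w ^ j)"
      by (subst sum.swap) (simp add: algebra_simps)
    finally show "p (prod.swap (z, w)) = (\<Sum>i\<le>N. \<Sum>j\<le>N. a j i * z ^ i * w ^ j)" by simp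
  qed (use a(1) in \<open>metis add.commute\<close>)
qed

lemma poly_fun_mult_fst:
  assumes "poly_fun_deg_le n p" shows "poly_fun_deg_le (Suc n) (\<lambda>x. fst x * p x)"
proof -
  obtain a where a: "\<And>z w. p (z, w) = (\<Sum>i\<le>n. \<Sum>j\<le>n - i. a i j * z ^ i * w ^ j)"
    using assms by (auto simp: poly_fun_deg_le_def)
  show ?thesis unfolding poly_fun_deg_le_def
  proof (intro exI[of _ "\<lambda>i j. case i of 0 \<Rightarrow> 0 | Suc i \<Rightarrow> a i j"] allI)
    fix z w
    show "fst (z, w) * p (z, w) = (\<Sum>i\<le>Suc n. \<Sum>j\<le>Suc n - i. (case i of 0 \<Rightarrow> 0 | Suc i \<Rightarrow> a i j) * z ^ i * w ^ j)"
      by (subst sum.atMost_Suc_shift) (simp add: a sum_distrib_left algebra_simps)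
  qed
qed

lemma poly_fun_mult_snd:
  assumes "poly_fun_deg_le n p" shows "poly_fun_deg_le (Suc n) (\<lambda>x. snd x * p x)"
  using poly_fun_swap[OF poly_fun_mult_fst[OF poly_fun_swap[OF assms]]] by simp

lemma poly_fun_mult:
  assumes "poly_fun_deg_le n p" "poly_fun_deg_le m q"
  shows "poly_fun_deg_le (n + m) (\<lambda>x. p x * q x)"
proof -
  obtain a where a: "\<And>z w. p (z, w) = (\<Sum>i\<le>n. \<Sum>j\<le>n - i. a i j * z ^ i * w ^ j)"
    using assms by (auto simp: poly_fun_deg_le_def)
  have 1: "poly_fun_deg_le (m + j) (\<lambda>x. snd x ^ j * q x)" for j
    by (induction j) (use assms(2) in \<open>auto dest: poly_fun_mult_snd simp: mult.assoc\<close>)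
  have 2: "poly_fun_deg_le (m + j + i) (\<lambda>x. fst x ^ i * (snd x ^ j * q x))" for i j
    by (induction i) (use 1 in \<open>auto dest: poly_fun_mult_fst simp: mult.assoc\<close>)
  have "poly_fun_deg_le (n + m) (\<lambda>x. \<Sum>i\<le>n. \<Sum>j\<le>n - i. a i j * (fst x ^ i * (snd x ^ j * q x)))"
    by (intro poly_fun_sum poly_fun_cmult poly_fun_mono[OF 2]) auto
  also have "(\<lambda>x. \<Sum>i\<le>n. \<Sum>j\<le>n - i. a i j * (fst x ^ i * (snd x ^ j * q x))) = (\<lambda>x. p x * q x)"
    by (auto simp: fun_eq_iff a sum_distrib_left mult_ac)
  finally show ?thesis .
qed

lemma poly_fun_power:
  assumes "poly_fun_deg_le n p" shows "poly_fun_deg_le (n * k) (\<lambda>x. p x ^ k)"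
  by (induction k) (auto intro!: poly_fun_const poly_fun_mult assms)

lemma poly_fun_comp:
  assumes "poly_fun_deg_le n p" "poly_map_deg_le m g"
  shows "poly_fun_deg_le (n * m) (\<lambda>x. p (g x))"
proof -
  obtain a where a: "\<And>z w. p (z, w) = (\<Sum>i\<le>n. \<Sum>j\<le>n - i. a i j * z ^ i * w ^ j)"
    using assms by (auto simp: poly_fun_deg_le_def)
  have g: "poly_fun_deg_le m (\<lambda>x. fst (g x))" "poly_fun_deg_le m (\<lambda>x. snd (g x))"
    using assms(2) by (auto simp: poly_map_deg_le_def)
  have "poly_fun_deg_le (n * m) (\<lambda>x. \<Sum>i\<le>n. \<Sum>j\<le>n - i. a i j * (fst (g x) ^ i * snd (g x) ^ j))"
  proof (intro poly_fun_sum poly_fun_cmult)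
    fix i j assume "i \<in> {..n}" "j \<in> {..n - i}"
    hence "(i + j) * m \<le> n * m" by (intro mult_le_mono1) auto
    hence "m * i + m * j \<le> n * m" by (simp add: algebra_simps)
    thus "poly_fun_deg_le (n * m) (\<lambda>x. fst (g x) ^ i * snd (g x) ^ j)"
      by (rule poly_fun_mono[OF poly_fun_mult[OF poly_fun_power[OF g(1)] poly_fun_power[OF g(2)]]])
  qed
  also have "(\<lambda>x. \<Sum>i\<le>n. \<Sum>j\<le>n - i. a i j * (fst (g x) ^ i * snd (g x) ^ j)) = (\<lambda>x. p (g x))"
  proof
    fix x
    show "(\<Sum>i\<le>n. \<Sum>j\<le>n - i. a i j * (fst (g x) ^ i * snd (g x) ^ j)) = p (g x)"
      using a[of "fst (g x)" "snd (g x)"] by (simp add: mult.assoc)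
  qed
  finally show ?thesis .
qed

lemma poly_map_comp:
  "poly_map_deg_le n f \<Longrightarrow> poly_map_deg_le m g \<Longrightarrow> poly_map_deg_le (n * m) (f \<circ> g)"
  using poly_fun_comp[of n "\<lambda>x. fst (f x)" m g] poly_fun_comp[of n "\<lambda>x. snd (f x)" m g]
  by (auto simp: poly_map_deg_le_def)

lemma poly_map_mono: "poly_map_deg_le n f \<Longrightarrow> n \<le> m \<Longrightarrow> poly_map_deg_le m f"
  by (auto simp: poly_map_deg_le_def intro: poly_fun_mono)

lemma poly_fun_fst: "poly_fun_deg_le 1 fst"
  using poly_fun_mult_fst[OF poly_fun_const[of 0 1]] by simp

lemma poly_fun_snd: "poly_fun_deg_le 1 snd"
  using poly_fun_mult_snd[OF poly_fun_const[of 0 1]] by simp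

lemma poly_fun_poly:
  assumes "poly_fun_deg_le m q"
  shows "poly_fun_deg_le (m * degree p) (\<lambda>x. poly p (q x))"
  unfolding poly_altdef
  by (intro poly_fun_sum poly_fun_cmult poly_fun_mono[OF poly_fun_power[OF assms]]) auto

lemma polynomial_map_comp: "polynomial_map f \<Longrightarrow> polynomial_map g \<Longrightarrow> polynomial_map (f \<circ> g)"
  unfolding polynomial_map_def by (blast intro: poly_map_comp)

lemma polynomial_diffeo_comp:
  assumes "polynomial_diffeo f" "polynomial_diffeo g" shows "polynomial_diffeo (f \<circ> g)"
proof -
  have "inv (f \<circ> g) = inv g \<circ> inv f" using assms by (intro o_inv_distrib) (auto simp: polynomial_diffeo_def)
  thus ?thesis using assms by (auto simp: polynomial_diffeo_def intro: polynomial_map_comp bij_comp)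
qed

lemma continuous_on_poly_fun: "poly_fun_deg_le n p \<Longrightarrow> continuous_on A p"
proof -
  assume "poly_fun_deg_le n p"
  then obtain a where a: "\<And>z w. p (z, w) = (\<Sum>i\<le>n. \<Sum>j\<le>n - i. a i j * z ^ i * w ^ j)"
    by (auto simp: poly_fun_deg_le_def)
  have "p = (\<lambda>x. \<Sum>i\<le>n. \<Sum>j\<le>n - i. a i j * fst x ^ i * snd x ^ j)"
    by (auto simp: fun_eq_iff a)
  thus ?thesis by (auto intro!: continuous_intros)
qed

lemma continuous_on_polynomial_map: "polynomial_map f \<Longrightarrow> continuous_on A f"
proof -
  assume "polynomial_map f"
  then obtain n where "poly_map_deg_le n f" by (auto simp: polynomial_map_def)
  hence "continuous_on A (\<lambda>x. (fst (f x), snd (f x)))"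
    by (intro continuous_on_Pair) (auto simp: poly_map_deg_le_def intro: continuous_on_poly_fun)
  thus ?thesis by simp
qed

section \<open>The Jacobian derivation\<close>

text \<open>Polynomials in \<open>s\<close> and \<open>t\<close>, as polynomials in \<open>t\<close> with coefficients in \<open>\<complex>[s]\<close>. So \<open>degree\<close> is the degree
in \<open>t\<close>, and \<open>lead_coeff\<close> is a polynomial in \<open>s\<close>.\<close>

type_synonym bpoly = "complex poly poly"

text \<open>The derivative \<open>\<partial>/\<partial>s\<close>; the derivative
\<open>\<partial>/\<partial>t\<close> is \<open>pderiv\<close>.\<close>

definition dfst :: "bpoly \<Rightarrow> bpoly" where "dfst = map_poly pderiv"

lemma coeff_dfst: "coeff (dfst p) n = pderiv (coeff p n)"
  by (simp add: dfst_def coeff_map_poly)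

lemma dfst_add: "dfst (p + q) = dfst p + dfst q"
  by (simp add: poly_eq_iff[of "dfst _"] coeff_dfst pderiv_add)

lemma dfst_mult: "dfst (p * q) = dfst p * q + p * dfst q"
proof (rule poly_eqI)
  fix n
  have "coeff (dfst (p * q)) n = (\<Sum>i\<le>n. pderiv (coeff p i * coeff q (n - i)))"
    by (simp add: coeff_dfst coeff_mult higher_pderiv_sum[of 1, simplified])
  also have "\<dots> = coeff (dfst p * q + p * dfst q) n"
    by (simp only: coeff_add coeff_mult coeff_dfst pderiv_mult sum.distrib[symmetric])
       (simp add: algebra_simps)
  finally show "coeff (dfst (p * q)) n = coeff (dfst p * q + p * dfst q) n" .
qed

lemma degree_dfst_le: "degree (dfst p) \<le> degree p"
  by (rule degree_le) (simp add: coeff_dfst coeff_eq_0)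

text \<open>The Jacobian determinant \<open>u\<^sub>s v\<^sub>t - u\<^sub>t v\<^sub>s\<close>. For fixed
\<open>u\<close> it is a derivation in \<open>v\<close> that kills \<open>u\<close>.\<close>

definition jac :: "bpoly \<Rightarrow> bpoly \<Rightarrow> bpoly" where
  "jac u v = dfst u * pderiv v - pderiv u * dfst v"

lemma jac_add: "jac u (v + w) = jac u v + jac u w"
  by (simp add: jac_def dfst_add pderiv_add algebra_simps)

lemma jac_mult: "jac u (v * w) = jac u v * w + v * jac u w"
  by (simp add: jac_def dfst_mult pderiv_mult algebra_simps)

lemma jac_self: "jac u u = 0"
  by (simp add: jac_def)

lemma jac_swap: "jac u v = - jac v u"
  by (simp add: jac_def algebra_simps)

text \<open>The constant \<open>c\<close> as a polynomial in \<open>s\<close> and \<open>t\<close>.\<close>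

definition const2 :: "complex \<Rightarrow> bpoly" where "const2 c = [:[:c:]:]"

lemma jac_const: "jac u (const2 c) = 0"
proof -
  have "dfst [:[:c:]:] = 0" by (rule poly_eqI) (simp add: coeff_dfst coeff_pCons split: nat.splits)
  thus ?thesis by (simp add: jac_def const2_def)
qed

lemma jac_0: "jac u 0 = 0"
  using jac_const[of u 0] by (simp add: const2_def)

lemma jac_1: "jac u 1 = 0"
  using jac_const[of u 1] by (simp add: const2_def one_pCons)

lemma jac_sum: "jac u (sum g A) = (\<Sum>i\<in>A. jac u (g i))"
  by (induction A rule: infinite_finite_induct) (auto simp: jac_add jac_0)

lemma jac_power: "jac u (v ^ n) = of_nat n * v ^ (n - 1) * jac u v"
proof (induction n)
  case 0 show ?case by (simp add: jac_1)
next
  case (Suc n)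
  have "jac u (v ^ Suc n) = jac u v * v ^ n + v * (of_nat n * v ^ (n - 1) * jac u v)"
    by (simp add: jac_mult Suc)
  also have "v * (of_nat n * v ^ (n - 1) * jac u v) = of_nat n * v ^ n * jac u v"
    by (cases n) (auto simp: algebra_simps)
  finally show ?case by (simp add: algebra_simps)
qed

text \<open>The derivation raises the degree in \<open>t\<close> by at most \<open>degree u - 1\<close>; the
form with \<open>+ 1\<close> avoids truncated subtraction.\<close>

lemma degree_jac_le:
  assumes "degree u > 0"
  shows "degree (jac u w) + 1 \<le> degree u + degree w"
proof -
  have 1: "degree (pderiv u * dfst w) \<le> degree u - 1 + degree w"
    by (rule order_trans[OF degree_mult_le]) (use degree_dfst_le[of w] in \<open>simp add: degree_pderiv\<close>)
  have 2: "degree (dfst u * pderiv w) + 1 \<le> degree u + degree w"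
  proof (cases "degree w = 0")
    case True
    hence "pderiv w = 0" by (simp add: pderiv_eq_0_iff)
    thus ?thesis using assms by simp
  next
    case False
    have "degree (dfst u * pderiv w) \<le> degree u + (degree w - 1)"
      by (rule order_trans[OF degree_mult_le]) (use degree_dfst_le[of u] in \<open>simp add: degree_pderiv\<close>)
    thus ?thesis using False by simp
  qed
  have "degree (jac u w) \<le> max (degree (dfst u * pderiv w)) (degree (pderiv u * dfst w))"
    unfolding jac_def by (rule degree_diff_le_max)
  with 1 2 assms show ?thesis by linarith
qed

text \<open>The result \<open>F(u, v)\<close> of substituting \<open>u\<close> and \<open>v\<close> into
\<open>F = \<Sum> a\<^sub>i\<^sub>j x\<^sup>i y\<^sup>j\<close>. The polynomial \<open>F\<close> is given by
its coefficient array \<open>a\<close>, summed over \<open>i, j \<le> n\<close>.\<close>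

definition subst2 :: "(nat \<Rightarrow> nat \<Rightarrow> complex) \<Rightarrow> nat \<Rightarrow> bpoly \<Rightarrow> bpoly \<Rightarrow> bpoly" where
  "subst2 a n u v = (\<Sum>i\<le>n. \<Sum>j\<le>n. const2 (a i j) * u ^ i * v ^ j)"

text \<open>The array \<open>a\<close> vanishes outside the square \<open>i, j \<le> n\<close>, so
\<open>subst2 a n\<close> takes all of it into account.\<close>

definition supp_le :: "(nat \<Rightarrow> nat \<Rightarrow> complex) \<Rightarrow> nat \<Rightarrow> bool" where
  "supp_le a n \<longleftrightarrow> (\<forall>i j. a i j \<noteq> 0 \<longrightarrow> i \<le> n \<and> j \<le> n)"

text \<open>The coefficients of \<open>\<partial>F/\<partial>y\<close>.\<close>

definition dsnd_coeff :: "(nat \<Rightarrow> nat \<Rightarrow> complex) \<Rightarrow> nat \<Rightarrow> nat \<Rightarrow> complex" where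
  "dsnd_coeff a = (\<lambda>i j. of_nat (Suc j) * a i (Suc j))"

lemma supp_le_dsnd: "supp_le a n \<Longrightarrow> supp_le (dsnd_coeff a) n"
  by (force simp: supp_le_def dsnd_coeff_def dest: Suc_leD)

lemma const2_mult: "const2 (a * b) = const2 a * const2 b" by (simp add: const2_def)
lemma const2_0: "const2 0 = 0" by (simp add: const2_def)
lemma const2_1: "const2 1 = 1" by (simp add: const2_def one_pCons)
lemma const2_add: "const2 (a + b) = const2 a + const2 b" by (simp add: const2_def)
lemma const2_of_nat: "const2 (of_nat n) = of_nat n"
  by (induction n) (auto simp: const2_0 const2_add const2_1)

text \<open>The chain rule for the derivation \<open>jac u\<close>: it sends \<open>F(u, v)\<close> to
\<open>jac u v\<close> times \<open>(\<partial>F/\<partial>y)(u, v)\<close>.\<close>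

lemma jac_subst2_snd:
  assumes "supp_le a n"
  shows "jac u (subst2 a n u v) = jac u v * subst2 (dsnd_coeff a) n u v"
proof -
  have "jac u (subst2 a n u v) = (\<Sum>i\<le>n. \<Sum>j\<le>n. const2 (a i j) * u ^ i * (of_nat j * v ^ (j - 1) * jac u v))"
    by (simp add: subst2_def jac_sum jac_mult jac_const jac_power jac_self)
  also have "\<dots> = (\<Sum>i\<le>n. \<Sum>j\<le>n. const2 (dsnd_coeff a i j) * u ^ i * v ^ j * jac u v)"
  proof (rule sum.cong[OF refl])
    fix i
    let ?g = "\<lambda>j. const2 (a i j) * u ^ i * (of_nat j * v ^ (j - 1) * jac u v)"
    have "a i (Suc n) = 0" using assms unfolding supp_le_def by (metis Suc_n_not_le_n)
    hence "(\<Sum>j\<le>n. ?g j) = (\<Sum>j\<le>Suc n. ?g j)" by (simp add: const2_0)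
    also have "\<dots> = ?g 0 + (\<Sum>j\<le>n. ?g (Suc j))" by (rule sum.atMost_Suc_shift)
    also have "\<dots> = (\<Sum>j\<le>n. const2 (dsnd_coeff a i j) * u ^ i * v ^ j * jac u v)"
      by (simp only: dsnd_coeff_def const2_mult const2_of_nat)
         (simp add: algebra_simps)
    finally show "(\<Sum>j\<le>n. ?g j) = (\<Sum>j\<le>n. const2 (dsnd_coeff a i j) * u ^ i * v ^ j * jac u v)" .
  qed
  also have "\<dots> = jac u v * subst2 (dsnd_coeff a) n u v"
    by (simp add: subst2_def sum_distrib_left algebra_simps)
  finally show ?thesis .
qed

lemma subst2_flip: "subst2 a n u v = subst2 (\<lambda>i j. a j i) n v u"
  unfolding subst2_def by (subst sum.swap) (simp add: algebra_simps)

lemma supp_le_flip: "supp_le a n \<Longrightarrow> supp_le (\<lambda>i j. a j i) n"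
  by (auto simp: supp_le_def)

text \<open>The coordinate \<open>s\<close>, the variable of the coefficients.\<close>

definition var_s :: bpoly where "var_s = [:[:0,1:]:]"
text \<open>The coordinate \<open>t\<close>, the outer variable.\<close>

definition var_t :: bpoly where "var_t = [:0,1:]"

lemma jac_var_t: "jac u var_t = dfst u"
proof -
  have "dfst var_t = 0"
    by (rule poly_eqI) (simp add: coeff_dfst var_t_def coeff_pCons pderiv_1 split: nat.splits)
  thus ?thesis by (simp add: jac_def) (simp add: var_t_def pderiv_pCons)
qed

lemma jac_var_s: "jac u var_s = - pderiv u"
proof -
  have "dfst var_s = 1"
    by (rule poly_eqI) (auto simp: coeff_dfst var_s_def coeff_pCons pderiv_pCons one_pCons split: nat.splits)
  thus ?thesis by (simp add: jac_def) (simp add: var_s_def pderiv_pCons)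
qed

text \<open>If \<open>s\<close> and \<open>t\<close> are polynomials in \<open>u\<close> and \<open>v\<close>,
the chain rule shows that \<open>J = jac u v\<close> divides all four partial derivatives of \<open>u\<close>
and \<open>v\<close>. Hence \<open>J\<^sup>2\<close> divides \<open>J\<close>, and \<open>J\<close> is a
unit.\<close>

lemma jac_is_unit:
  assumes "supp_le a n" "supp_le b n"
    and A: "subst2 a n u v = var_s" and B: "subst2 b n u v = var_t"
  shows "jac u v dvd 1"
proof -
  let ?J = "jac u v"
  have 1: "?J dvd dfst u"
    using jac_subst2_snd[OF assms(2), of u v] by (simp add: B jac_var_t)
  have 2: "?J dvd pderiv u"
  proof -
    have "- pderiv u = ?J * subst2 (dsnd_coeff a) n u v"
      using jac_subst2_snd[OF assms(1), of u v] by (simp add: A jac_var_s)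
    thus ?thesis by (metis dvd_minus_iff dvd_triv_left)
  qed
  have 3: "?J dvd dfst v"
  proof -
    have "dfst v = jac v u * subst2 (dsnd_coeff (\<lambda>i j. b j i)) n v u"
      using jac_subst2_snd[OF supp_le_flip[OF assms(2)], of v u] B
        subst2_flip[of b n u v] by (simp add: jac_var_t)
    thus ?thesis by (simp add: jac_swap[of v u])
  qed
  have 4: "?J dvd pderiv v"
  proof -
    have "- pderiv v = jac v u * subst2 (dsnd_coeff (\<lambda>i j. a j i)) n v u"
      using jac_subst2_snd[OF supp_le_flip[OF assms(1)], of v u] A
        subst2_flip[of a n u v] by (simp add: jac_var_s)
    thus ?thesis by (simp add: jac_swap[of v u])
  qed
  have sq: "?J * ?J dvd ?J"
    unfolding jac_def[of u v] by (rule dvd_diff; fold jac_def) (intro mult_dvd_mono 1 2 3 4)+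
  have "?J \<noteq> 0"
  proof
    assume "?J = 0"
    with 2 have "pderiv u = 0" by simp
    from jac_subst2_snd[OF assms(2), of u v] \<open>?J = 0\<close> have du: "dfst u = 0" by (simp add: B jac_var_t)
    have "jac var_t u = 0" "jac var_s u = 0" using du \<open>pderiv u = 0\<close>
      using jac_swap[of u var_t] jac_swap[of u var_s] by (auto simp: jac_var_t jac_var_s)
    moreover have "jac var_t v = 0" "jac var_s v = 0" using 3 4 \<open>?J = 0\<close>
      using jac_swap[of v var_t] jac_swap[of v var_s] by (auto simp: jac_var_t jac_var_s)
    ultimately have "jac var_s var_t = 0"
      unfolding B[symmetric] by (simp add: B subst2_def jac_sum jac_mult jac_const jac_power)
    moreover have "jac var_s var_t = 1"
      by (simp add: jac_var_t) (rule poly_eqI, auto simp: coeff_dfst var_s_def coeff_pCons pderiv_pCons one_pCons split: nat.splits)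
    ultimately show False by simp
  qed
  with sq show ?thesis by (metis dvd_mult_cancel_left dvd_times_left_cancel_iff mult.right_neutral)
qed

section \<open>A lower bound for the degree after substitution\<close>

text \<open>The polynomial \<open>\<Sum> a\<^sub>i\<^sub>j r\<^sup>i y\<^sup>j\<close> in \<open>y\<close>,
with the sum over \<open>k i + l j = W\<close>: the part of \<open>F\<close> of weight \<open>W\<close>, where
\<open>x\<close> has weight \<open>k\<close> and \<open>y\<close> has weight \<open>l\<close>, at \<open>x =
r\<close>.\<close>

definition top_poly :: "(nat \<Rightarrow> nat \<Rightarrow> complex) \<Rightarrow> nat \<Rightarrow> nat \<Rightarrow> nat \<Rightarrow> nat \<Rightarrow> complex \<Rightarrow> complex poly" where
  "top_poly a n k l W r = (\<Sum>i\<le>n. \<Sum>j\<le>n. if k * i + l * j = W then monom (a i j * r ^ i) j else 0)"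

text \<open>All monomials of \<open>F\<close> have weight at most \<open>W\<close>.\<close>

definition weight_le :: "(nat \<Rightarrow> nat \<Rightarrow> complex) \<Rightarrow> nat \<Rightarrow> nat \<Rightarrow> nat \<Rightarrow> bool" where
  "weight_le a k l W \<longleftrightarrow> (\<forall>i j. a i j \<noteq> 0 \<longrightarrow> k * i + l * j \<le> W)"

lemma coeff_subst2_top:
  assumes "u \<noteq> 0" "v \<noteq> 0" and w: "weight_le a (degree u) (degree v) W"
  shows "coeff (subst2 a n u v) W =
     (\<Sum>i\<le>n. \<Sum>j\<le>n. if degree u * i + degree v * j = W
        then [:a i j:] * lead_coeff u ^ i * lead_coeff v ^ j else 0)"
proof -
  have "coeff (const2 (a i j) * u ^ i * v ^ j) W =
     (if degree u * i + degree v * j = W then [:a i j:] * lead_coeff u ^ i * lead_coeff v ^ j else 0)"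
    for i j
  proof (cases "a i j = 0")
    case True
    thus ?thesis by (simp add: const2_def)
  next
    case False
    have deg: "degree (u ^ i * v ^ j) = degree u * i + degree v * j"
      using assms by (simp add: degree_mult_eq degree_power_eq)
    have eq: "const2 (a i j) * u ^ i * v ^ j = smult [:a i j:] (u ^ i * v ^ j)"
      by (simp add: const2_def)
    from False w have "degree u * i + degree v * j \<le> W" by (auto simp: weight_le_def)
    thus ?thesis
      unfolding eq using deg lead_coeff_mult[of "u ^ i" "v ^ j"]
      by (auto simp: lead_coeff_power coeff_eq_0 mult.assoc simp del: mult_pCons_left)
  qed
  thus ?thesis by (simp add: subst2_def coeff_sum)
qed

text \<open>The part of \<open>F\<close> of top weight, evaluated at the leading coefficients of
\<open>u\<close> and \<open>v\<close>, is the coefficient of \<open>t\<^sup>W\<close> in \<open>F(u,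
v)\<close>.\<close>

lemma poly_top_poly:
  assumes "u \<noteq> 0" "v \<noteq> 0" and w: "weight_le a (degree u) (degree v) W"
  shows "poly (top_poly a n (degree u) (degree v) W (poly (lead_coeff u) s)) (poly (lead_coeff v) s)
      = poly (coeff (subst2 a n u v) W) s"
  by (auto simp: coeff_subst2_top[OF assms] top_poly_def poly_sum poly_monom intro!: sum.cong)

lemma coeff_top_poly:
  assumes "k > 0"
  shows "coeff (top_poly a n k l W r) j =
    (if j \<le> n \<and> l * j \<le> W \<and> k dvd (W - l * j) \<and> (W - l * j) div k \<le> n
     then a ((W - l * j) div k) j * r ^ ((W - l * j) div k) else 0)"
proof -
  have "coeff (top_poly a n k l W r) j =
     (\<Sum>i\<le>n. \<Sum>j'\<le>n. if j' = j then (if k * i + l * j = W then a i j * r ^ i else 0) else 0)"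
    unfolding top_poly_def coeff_sum by (intro sum.cong refl) auto
  also have "\<dots> = (if j \<le> n then \<Sum>i\<le>n. if k * i + l * j = W then a i j * r ^ i else 0 else 0)"
    by (simp add: sum.delta)
  also have "(\<Sum>i\<le>n. if k * i + l * j = W then a i j * r ^ i else 0) =
     (\<Sum>i\<le>n. if i = (W - l * j) div k then
         (if l * j \<le> W \<and> k dvd (W - l * j) then a i j * r ^ i else 0) else 0)"
  proof (intro sum.cong refl)
    fix i
    have "k * i + l * j = W \<longleftrightarrow> i = (W - l * j) div k \<and> l * j \<le> W \<and> k dvd (W - l * j)"
      using assms by auto
    thus "(if k * i + l * j = W then a i j * r ^ i else 0) = (if i = (W - l * j) div k then
         (if l * j \<le> W \<and> k dvd (W - l * j) then a i j * r ^ i else 0) else 0)" by auto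
  qed
  finally show ?thesis by (auto simp: sum.delta)
qed

lemma pderiv_top_poly:
  assumes "supp_le a n" "k > 0"
  shows "pderiv (top_poly a n k l (W + l) r) = top_poly (dsnd_coeff a) n k l W r"
proof (rule poly_eqI)
  fix j
  have *: "W + l - l * Suc j = W - l * j" "l * Suc j \<le> W + l \<longleftrightarrow> l * j \<le> W" by auto
  have "a i (Suc j) = 0" if "\<not> Suc j \<le> n" for i
    using assms(1) that unfolding supp_le_def by metis
  thus "coeff (pderiv (top_poly a n k l (W + l) r)) j = coeff (top_poly (dsnd_coeff a) n k l W r) j"
    unfolding coeff_pderiv coeff_top_poly[OF assms(2)] * dsnd_coeff_def by (auto simp: mult_ac)
qed

text \<open>If the top part of \<open>F\<close> vanishes to order \<open>e\<close> in \<open>y\<close> at the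
leading coefficients of \<open>u\<close> and \<open>v\<close>, then the degree of \<open>F(u, v)\<close> drops
below the weight \<open>W\<close> by at most \<open>e (k + l - 1)\<close>. By induction on \<open>e\<close>:
passing from \<open>F\<close> to \<open>\<partial>F/\<partial>y\<close> lowers the weight by \<open>l\<close>
and the order by 1, while the derivation \<open>jac u\<close> raises the degree by at most \<open>k -
1\<close>.\<close>

lemma degree_estimate:
  assumes u: "degree u > 0" and v: "v \<noteq> 0" and J: "jac u v dvd 1"
    and rs: "poly (lead_coeff v) s \<noteq> 0"
  shows "supp_le a n \<Longrightarrow> weight_le a (degree u) (degree v) W \<Longrightarrow>
    top_poly a n (degree u) (degree v) W (poly (lead_coeff u) s) \<noteq> 0 \<Longrightarrow>
    Polynomial.order (poly (lead_coeff v) s) (top_poly a n (degree u) (degree v) W (poly (lead_coeff u) s)) = e \<Longrightarrow>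
    W \<le> degree (subst2 a n u v) + e * (degree u + degree v - 1)"
proof (induction e arbitrary: a W)
  case 0
  let ?p = "top_poly a n (degree u) (degree v) W (poly (lead_coeff u) s)"
  have u0: "u \<noteq> 0" using u by auto
  have "poly ?p (poly (lead_coeff v) s) \<noteq> 0" using 0 by (simp add: order_eq_0_iff)
  hence "coeff (subst2 a n u v) W \<noteq> 0"
    using poly_top_poly[OF u0 v 0(2)] by auto
  thus ?case by (simp add: le_degree)
next
  case (Suc e)
  let ?r = "poly (lead_coeff u) s" and ?b = "poly (lead_coeff v) s"
  let ?k = "degree u" and ?l = "degree v"
  let ?p = "top_poly a n ?k ?l W ?r"
  have root: "poly ?p ?b = 0" using Suc.prems(3,4) by (simp add: order_root)
  have dp: "degree ?p \<noteq> 0"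
  proof
    assume "degree ?p = 0"
    then obtain c where "?p = [:c:]" by (metis degree_eq_zeroE)
    thus False using root Suc.prems(3) by simp
  qed
  have "coeff ?p (degree ?p) \<noteq> 0" using Suc.prems(3) by simp
  hence "?l * degree ?p \<le> W" unfolding coeff_top_poly[OF u] by (meson)
  with dp have "?l \<le> W" by (metis le_trans mult_le_mono2 mult.right_neutral le_numeral_extra(4) less_one not_le)
  then obtain W' where W': "W = W' + ?l" by (metis le_add_diff_inverse2)
  let ?a = "dsnd_coeff a"
  have pd: "pderiv ?p = top_poly ?a n ?k ?l W' ?r"
    unfolding W' by (rule pderiv_top_poly[OF Suc.prems(1) u])
  have wl: "weight_le ?a ?k ?l W'"
    using Suc.prems(2) unfolding weight_le_def dsnd_coeff_def W' by fastforce
  have pd0: "pderiv ?p \<noteq> 0" using dp by (simp add: pderiv_eq_0_iff)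
  have "Suc e = Suc (Polynomial.order ?b (pderiv ?p))"
    using order_pderiv[OF Suc.prems(3) root] Suc.prems(4) by simp
  hence "W' \<le> degree (subst2 ?a n u v) + e * (?k + ?l - 1)"
    by (intro Suc.IH supp_le_dsnd Suc.prems(1) wl) (use pd pd0 in auto)
  moreover have "degree (subst2 ?a n u v) + 1 \<le> ?k + degree (subst2 a n u v)"
  proof (cases "subst2 ?a n u v = 0")
    case True
    thus ?thesis using u by simp
  next
    case False
    have J0: "jac u v \<noteq> 0" "degree (jac u v) = 0" using J by (auto simp: is_unit_poly_iff)
    have "degree (jac u (subst2 a n u v)) = degree (subst2 ?a n u v)"
      unfolding jac_subst2_snd[OF Suc.prems(1)] using J0 False by (simp add: degree_mult_eq)
    thus ?thesis using degree_jac_le[OF u, of "subst2 a n u v"] by simp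
  qed
  ultimately show ?case using u unfolding W' by simp
qed

text \<open>If the exponents of \<open>p\<close> are \<open>j0\<close> plus multiples of
\<open>\<alpha>\<close>, a zero \<open>b \<noteq> 0\<close> of order \<open>e\<close> occurs together with all
its rotations by \<open>\<alpha>\<close>-th roots of unity, so \<open>p\<close> has degree at least
\<open>\<alpha> e + j0\<close>. The proof divides by \<open>y\<^bsup>j0\<^esup>\<close> and differentiates,
which lowers \<open>e\<close> by 1 and changes \<open>j0\<close> to \<open>\<alpha> - 1\<close>.\<close>

lemma order_sparse_poly_bound:
  fixes b :: complex
  assumes b: "b \<noteq> 0" and \<alpha>: "\<alpha> > 0"
  shows "p \<noteq> 0 \<Longrightarrow> (\<And>j. coeff p j \<noteq> 0 \<Longrightarrow> j0 \<le> j \<and> \<alpha> dvd j - j0) \<Longrightarrow>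
    Polynomial.order b p = e \<Longrightarrow> \<alpha> * e + j0 \<le> degree p"
proof (induction e arbitrary: p j0)
  case 0
  thus ?case using leading_coeff_0_iff by fastforce
next
  case (Suc e)
  have "monom 1 j0 dvd p" unfolding monom_1_dvd_iff' using Suc.prems(2) by (meson not_le)
  then obtain q where q: "p = monom 1 j0 * q" by (elim dvdE)
  have q0: "q \<noteq> 0" using Suc.prems(1) q by auto
  have m0: "monom 1 j0 \<noteq> (0 :: complex poly)" by simp
  have "Polynomial.order b (monom 1 j0) = 0" using b by (simp add: order_eq_0_iff poly_monom)
  hence oq: "Polynomial.order b q = Suc e"
    using Suc.prems(1,3) q by (simp add: order_mult)
  have dp: "degree p = j0 + degree q" using q0 m0 unfolding q by (simp add: degree_mult_eq degree_monom_eq)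
  have cq: "coeff q j = coeff p (j0 + j)" for j unfolding q by (simp add: coeff_monom_mult)
  have dq: "degree q \<noteq> 0"
  proof
    assume "degree q = 0"
    then obtain c where "q = [:c:]" by (metis degree_eq_zeroE)
    thus False using oq q0 by (metis order_0I pCons_0_0 poly_pCons mult_zero_right add_0_right poly_0 nat.distinct(1))
  qed
  have pd0: "pderiv q \<noteq> 0" using dq by (simp add: pderiv_eq_0_iff)
  have "\<alpha> * e + (\<alpha> - 1) \<le> degree (pderiv q)"
  proof (rule Suc.IH[OF pd0])
    show "Polynomial.order b (pderiv q) = e" using order_pderiv[OF q0, of b] oq q0 by (simp add: order_root)
    fix j assume "coeff (pderiv q) j \<noteq> 0"
    hence "coeff p (j0 + Suc j) \<noteq> 0" by (simp add: coeff_pderiv cq)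
    hence "\<alpha> dvd j0 + Suc j - j0" using Suc.prems(2) by blast
    hence "\<alpha> dvd Suc j" by simp
    then obtain m where m: "Suc j = \<alpha> * m" by auto
    hence "m > 0" by (cases m) auto
    then obtain m' where m': "m = Suc m'" by (cases m) auto
    have "j = \<alpha> - 1 + \<alpha> * m'" using m \<alpha> unfolding m' by simp
    thus "\<alpha> - 1 \<le> j \<and> \<alpha> dvd j - (\<alpha> - 1)" by simp
  qed
  thus ?case using dq \<alpha> unfolding dp by (simp add: degree_pderiv)
qed

lemma order_top_poly_bound:
  assumes kl: "k > 0" and p0: "top_poly a n k l W r \<noteq> 0" and b: "b \<noteq> 0"
  shows "l * ((k div gcd k l) * Polynomial.order b (top_poly a n k l W r)) \<le> W"
proof -
  let ?p = "top_poly a n k l W r"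
  define \<alpha> where "\<alpha> = k div gcd k l"
  have \<alpha>: "\<alpha> > 0" using kl by (simp add: \<alpha>_def div_greater_zero_iff)
  define j0 where "j0 = (LEAST j. coeff ?p j \<noteq> 0)"
  have ex: "coeff ?p (degree ?p) \<noteq> 0" using p0 by simp
  have j0: "coeff ?p j0 \<noteq> 0" unfolding j0_def by (rule LeastI) (rule ex)
  have j0min: "j0 \<le> j" if "coeff ?p j \<noteq> 0" for j unfolding j0_def by (rule Least_le) (rule that)
  have cong: "\<alpha> dvd j - j0" if "coeff ?p j \<noteq> 0" for j
  proof -
    have "l * j \<le> W" "k dvd W - l * j" "l * j0 \<le> W" "k dvd W - l * j0"
      using that j0 unfolding coeff_top_poly[OF kl] by meson+
    hence "k dvd (W - l * j0) - (W - l * j)" by (metis dvd_diff_nat)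
    also have "(W - l * j0) - (W - l * j) = l * (j - j0)"
      using j0min[OF that] \<open>l * j \<le> W\<close> by (simp add: right_diff_distrib')
    finally have "k dvd l * (j - j0)" .
    moreover have "k = gcd k l * \<alpha>" "l = gcd k l * (l div gcd k l)" by (auto simp: \<alpha>_def)
    ultimately have "gcd k l * \<alpha> dvd gcd k l * ((l div gcd k l) * (j - j0))" by (metis mult.assoc)
    hence "\<alpha> dvd (l div gcd k l) * (j - j0)" using kl by simp
    moreover have "coprime \<alpha> (l div gcd k l)" unfolding \<alpha>_def using kl by (intro div_gcd_coprime) auto
    ultimately show "\<alpha> dvd j - j0" by (simp add: coprime_dvd_mult_right_iff)
  qed
  have "\<alpha> * Polynomial.order b ?p + j0 \<le> degree ?p"
    by (rule order_sparse_poly_bound[OF b \<alpha> p0]) (use cong j0min in auto)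
  hence "l * (\<alpha> * Polynomial.order b ?p) \<le> l * degree ?p" by simp
  also have "l * degree ?p \<le> W" using ex unfolding coeff_top_poly[OF kl] by meson
  finally show ?thesis by (simp add: \<alpha>_def)
qed

lemma max_weight_exists:
  assumes "supp_le a n" "a i0 j0 \<noteq> 0"
  obtains W i j where "weight_le a k l W" "a i j \<noteq> 0" "k * i + l * j = W"
proof -
  define A where "A = (\<lambda>(i,j). k * i + l * j) ` {(i,j). a i j \<noteq> 0}"
  have "{(i,j). a i j \<noteq> 0} \<subseteq> {..n} \<times> {..n}" using assms(1) by (auto simp: supp_le_def)
  hence fin: "finite A" unfolding A_def by (meson finite_SigmaI finite_atMost finite_imageI finite_subset)
  have "A \<noteq> {}" using assms(2) by (auto simp: A_def)
  with fin have "Max A \<in> A" by simp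
  moreover have "weight_le a k l (Max A)"
    unfolding weight_le_def using fin by (auto intro!: Max_ge simp: A_def)
  ultimately show ?thesis using that unfolding A_def by auto
qed

lemma top_poly_nonzero:
  assumes "supp_le a n" "k > 0" "a i j \<noteq> 0" "k * i + l * j = W" "r \<noteq> 0"
  shows "top_poly a n k l W r \<noteq> 0"
proof -
  have "coeff (top_poly a n k l W r) j = a i j * r ^ i"
    using assms unfolding coeff_top_poly[OF assms(2)] supp_le_def by (auto simp flip: assms(4))
  thus ?thesis using assms by auto
qed

lemma coprime_prod_gap:
  fixes \<alpha> \<beta> :: nat
  assumes "coprime \<alpha> \<beta>" "\<alpha> \<ge> 2" "\<beta> \<ge> 2"
  shows "\<alpha> * \<beta> \<ge> \<alpha> + \<beta> + 1"
proof -
  obtain x where x: "\<alpha> = x + 2" using assms(2) by (metis le_add_diff_inverse2)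
  obtain y where y: "\<beta> = y + 2" using assms(3) by (metis le_add_diff_inverse2)
  have "\<alpha> \<noteq> \<beta>" using assms by auto
  hence "x + y > 0" using x y by auto
  thus ?thesis unfolding x y by (auto simp: algebra_simps)
qed

text \<open>Let \<open>k = g \<alpha>\<close> and \<open>l = g \<beta>\<close> with \<open>\<alpha>\<close>,
\<open>\<beta>\<close> coprime, and let \<open>t = F(u, v)\<close>. The preceding bounds give \<open>g
\<alpha> \<beta> e \<le> W \<le> 1 + e (k + l - 1)\<close>. If \<open>\<alpha>, \<beta> \<ge> 2\<close> this
is impossible for \<open>e > 0\<close>, because then \<open>\<alpha> \<beta> > \<alpha> + \<beta>\<close>, and
also for \<open>e = 0\<close>, because \<open>W \<ge> min k l \<ge> 2\<close>.\<close>

lemma degree_divides: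
  assumes u: "degree u > 0" and v: "degree v > 0" and J: "jac u v dvd 1"
    and b: "supp_le b n" "subst2 b n u v = var_t"
  shows "degree u dvd degree v \<or> degree v dvd degree u"
proof (rule ccontr)
  assume neg: "\<not> ?thesis"
  define k where "k = degree u" 
  define l where "l = degree v"
  define g where "g = gcd k l"
  define \<alpha> where "\<alpha> = k div g"
  define \<beta> where "\<beta> = l div g"
  have g: "g > 0" using u by (simp add: g_def k_def)
  have k: "k = g * \<alpha>" and l: "l = g * \<beta>" by (auto simp: \<alpha>_def \<beta>_def g_def)
  have cop: "coprime \<alpha> \<beta>" unfolding \<alpha>_def \<beta>_def g_def using u by (intro div_gcd_coprime) (simp add: k_def)
  have "\<alpha> \<noteq> 0" "\<beta> \<noteq> 0" using u v k l by (auto simp: k_def l_def)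
  moreover have "\<alpha> \<noteq> 1" "\<beta> \<noteq> 1" using neg k l by (auto simp: k_def l_def)
  ultimately have ab: "\<alpha> \<ge> 2" "\<beta> \<ge> 2" by auto
  have kl2: "k \<ge> 2" "l \<ge> 2"
    using mult_le_mono[of 1 g 2 \<alpha>] mult_le_mono[of 1 g 2 \<beta>] ab g unfolding k l by auto
  have u0: "u \<noteq> 0" and v0: "v \<noteq> 0" using u v by auto
  have "lead_coeff u * lead_coeff v \<noteq> 0" using u0 v0 by simp
  then obtain s where "poly (lead_coeff u * lead_coeff v) s \<noteq> 0"
    by (metis poly_all_0_iff_0)
  hence s: "poly (lead_coeff u) s \<noteq> 0" "poly (lead_coeff v) s \<noteq> 0" by auto
  have "\<exists>i j. b i j \<noteq> 0 \<and> (i, j) \<noteq> (0, 0)"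
  proof (rule ccontr)
    assume "\<not> ?thesis"
    hence z: "b i j = 0" if "(i, j) \<noteq> (0,0)" for i j using that by blast
    have "const2 (b i j) * u ^ i * v ^ j = const2 (if (i, j) = (0,0) then b 0 0 else 0)" for i j
      using z[of i j] by (auto simp: const2_0)
    hence "degree (subst2 b n u v) \<le> 0"
      unfolding subst2_def by (intro degree_sum_le) (auto simp: const2_def)
    thus False using b(2) by (simp add: var_t_def)
  qed
  then obtain i1 j1 where ij1: "b i1 j1 \<noteq> 0" "(i1, j1) \<noteq> (0,0)" by blast
  obtain W i j where W: "weight_le b k l W" "b i j \<noteq> 0" "k * i + l * j = W"
    by (rule max_weight_exists[OF b(1) ij1(1)])
  have W2: "W \<ge> 2"
  proof -
    have "k * i1 + l * j1 \<le> W" using W(1) ij1 by (auto simp: weight_le_def)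
    moreover have "k * i1 + l * j1 \<ge> 2"
    proof (cases "i1 = 0")
      case True
      hence "j1 \<ge> 1" using ij1 by auto
      hence "l * j1 \<ge> l * 1" by (intro mult_le_mono2)
      thus ?thesis using kl2 by linarith
    next
      case False
      hence "k * i1 \<ge> k * 1" by (intro mult_le_mono2) auto
      thus ?thesis using kl2 by linarith
    qed
    ultimately show ?thesis by simp
  qed
  let ?p = "top_poly b n k l W (poly (lead_coeff u) s)"
  define e where "e = Polynomial.order (poly (lead_coeff v) s) ?p"
  have p0: "?p \<noteq> 0" using top_poly_nonzero[OF b(1) _ W(2,3) s(1)] u by (simp add: k_def)
  have 1: "l * (\<alpha> * e) \<le> W"
    unfolding \<alpha>_def g_def e_def by (rule order_top_poly_bound[OF _ p0 s(2)]) (use u in \<open>simp add: k_def\<close>)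
  have 2: "W \<le> 1 + e * (k + l - 1)"
    using degree_estimate[OF u v0 J s(2) b(1) W(1)[unfolded k_def l_def] _ refl] p0
    unfolding b(2) e_def k_def l_def by (simp add: var_t_def)
  have "k + l + g \<le> l * \<alpha>"
    using mult_le_mono2[OF coprime_prod_gap[OF cop ab], of g] unfolding k l by (simp add: algebra_simps)
  hence "e * (k + l + g) \<le> e * (l * \<alpha>)" by (rule mult_le_mono2)
  also have "e * (l * \<alpha>) = l * (\<alpha> * e)" by (simp only: mult_ac)
  finally have "e * (k + l + g) \<le> W" using 1 by (rule order_trans)
  moreover have "e * ((k + l - 1) + 2) \<le> e * (k + l + g)"
    by (rule mult_le_mono2) (use g kl2 in linarith)
  hence "e * (k + l - 1) + 2 * e \<le> e * (k + l + g)" by (simp add: algebra_simps)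
  ultimately have "2 * e \<le> 1" using 2 by linarith
  hence "e = 0" by simp
  with 2 W2 show False by simp
qed

section \<open>Reduction of the degree\<close>

lemma nonconst_coeff:
  assumes "subst2 b n u v \<noteq> const2 (b 0 0)"
  shows "\<exists>i j. b i j \<noteq> 0 \<and> (i, j) \<noteq> (0, 0)"
proof (rule ccontr)
  assume "\<not> ?thesis"
  hence z: "b i j = 0" if "(i, j) \<noteq> (0,0)" for i j using that by blast
  have "const2 (b i j) * u ^ i * v ^ j = (if j = 0 then (if i = 0 then const2 (b 0 0) else 0) else 0)" for i j
    using z[of i j] by (auto simp: const2_0)
  hence "subst2 b n u v = const2 (b 0 0)"
    unfolding subst2_def by (simp add: sum.delta)
  with assms show False by simp
qed

text \<open>Here \<open>s = F(u, v)\<close> has degree 0 in \<open>t\<close>, so the top part of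
\<open>F\<close> vanishes at the leading coefficients \<open>U(s)\<close>, \<open>V(s)\<close> for all
\<open>s\<close>. By homogeneity \<open>V(s) / U(s)\<^sup>m\<close> is always a root of one fixed polynomial,
so one root is attained infinitely often.\<close>

lemma lead_coeff_proportional:
  assumes u: "degree u > 0" and v: "degree v = m * degree u" and m: "m > 0"
    and a: "supp_le a n" "subst2 a n u v = var_s"
  shows "\<exists>c. lead_coeff v = smult c (lead_coeff u ^ m)"
proof -
  define k where "k = degree u"
  define l where "l = degree v"
  have l: "l = m * k" using v by (simp add: l_def k_def)
  have k0: "k > 0" using u by (simp add: k_def)
  have u0: "u \<noteq> 0" and v0: "v \<noteq> 0" using u v m by auto
  let ?U = "lead_coeff u" and ?V = "lead_coeff v"
  have U0: "?U \<noteq> 0" and V0: "?V \<noteq> 0" using u0 v0 by auto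
  have "subst2 a n u v \<noteq> const2 (a 0 0)" unfolding a(2) by (simp add: var_s_def const2_def)
  then obtain i1 j1 where ij1: "a i1 j1 \<noteq> 0" "(i1, j1) \<noteq> (0,0)" using nonconst_coeff by blast
  obtain W i j where W: "weight_le a k l W" "a i j \<noteq> 0" "k * i + l * j = W"
    by (rule max_weight_exists[OF a(1) ij1(1)])
  have "k * i1 + l * j1 \<le> W" using W(1) ij1 by (auto simp: weight_le_def)
  moreover have "k * i1 + l * j1 > 0" using ij1(2) k0 m by (auto simp: l)
  ultimately have W0: "W > 0" by linarith
  let ?Q = "top_poly a n k l W 1"
  have Q0: "?Q \<noteq> 0" using top_poly_nonzero[OF a(1) k0 W(2,3)] by simp
  have hom: "poly (top_poly a n k l W r) y = r ^ (W div k) * poly ?Q (y / r ^ m)" if "r \<noteq> 0" for r y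
  proof -
    have "(if k * i + l * j = W then a i j * r ^ i * y ^ j else 0) =
      r ^ (W div k) * (if k * i + l * j = W then a i j * (y / r ^ m) ^ j else 0)" for i j
    proof (cases "k * i + l * j = W")
      case True
      hence "W = k * (i + m * j)" by (simp add: l algebra_simps)
      hence "W div k = i + m * j" using k0 by simp
      thus ?thesis using True that by (simp add: power_add power_divide power_mult[symmetric])
    qed simp
    hence "(\<Sum>i\<le>n. \<Sum>j\<le>n. (if k * i + l * j = W then a i j * r ^ i * y ^ j else 0)) =
      r ^ (W div k) * (\<Sum>i\<le>n. \<Sum>j\<le>n. (if k * i + l * j = W then a i j * (y / r ^ m) ^ j else 0))"
      by (simp add: sum_distrib_left)
    moreover have "poly (top_poly a n k l W r') y' = (\<Sum>i\<le>n. \<Sum>j\<le>n. (if k * i + l * j = W then a i j * r' ^ i * y' ^ j else 0))"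
      for r' y' unfolding top_poly_def poly_sum by (intro sum.cong refl) (auto simp: poly_monom)
    ultimately show ?thesis by (simp cong: if_cong)
  qed
  have "coeff (subst2 a n u v) W = 0" unfolding a(2) using W0 by (simp add: var_s_def coeff_eq_0)
  hence root: "poly ?Q (poly ?V s / poly ?U s ^ m) = 0" if "poly ?U s \<noteq> 0" for s
    using poly_top_poly[OF u0 v0 W(1)[unfolded k_def l_def], of n s] hom[OF that, of "poly ?V s"] that
    unfolding k_def l_def by simp
  define A where "A = {s. poly ?U s \<noteq> 0}"
  have "infinite A"
  proof
    assume "finite A"
    moreover have "finite {s. poly ?U s = 0}" using U0 by (rule poly_roots_finite)
    moreover have "UNIV = A \<union> {s. poly ?U s = 0}" by (auto simp: A_def)
    ultimately have "finite (UNIV :: complex set)" by (metis finite_UnI)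
    thus False by (simp add: infinite_UNIV_char_0)
  qed
  moreover have "finite ((\<lambda>s. poly ?V s / poly ?U s ^ m) ` A)"
    by (rule finite_subset[OF _ poly_roots_finite[OF Q0]]) (use root in \<open>auto simp: A_def\<close>)
  ultimately obtain s0 where "s0 \<in> A" and inf: "infinite {s \<in> A. poly ?V s / poly ?U s ^ m = poly ?V s0 / poly ?U s0 ^ m}"
    using pigeonhole_infinite by blast
  define c where "c = poly ?V s0 / poly ?U s0 ^ m"
  have "{s \<in> A. poly ?V s / poly ?U s ^ m = c} \<subseteq> {s. poly (?V - smult c (?U ^ m)) s = 0}"
    by (auto simp: A_def field_simps)
  hence "infinite {s. poly (?V - smult c (?U ^ m)) s = 0}"
    using inf finite_subset unfolding c_def by blast
  hence "?V - smult c (?U ^ m) = 0" using poly_roots_finite by blast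
  thus ?thesis by auto
qed

lemma degree_reduction:
  assumes u: "degree u > 0" and v: "degree v = m * degree u" and m: "m > 0"
    and a: "supp_le a n" "subst2 a n u v = var_s"
  shows "\<exists>c. degree (v - const2 c * u ^ m) < degree v"
proof -
  obtain c where c: "lead_coeff v = smult c (lead_coeff u ^ m)"
    using lead_coeff_proportional[OF assms] by blast
  let ?w = "v - const2 c * u ^ m"
  have u0: "u \<noteq> 0" using u by auto
  have d: "degree (u ^ m) = degree v" using u0 v by (simp add: degree_power_eq)
  have "degree (const2 c * u ^ m) \<le> degree v"
    using degree_smult_le[of "[:c:]" "u ^ m"] d by (simp add: const2_def)
  hence le: "degree ?w \<le> degree v" by (rule degree_diff_le[OF order_refl])
  have "coeff (u ^ m) (degree v) = lead_coeff u ^ m" using lead_coeff_power[of u m] d by simp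
  hence "coeff ?w (degree v) = 0" using c by (simp add: const2_def)
  moreover have "degree v > 0" using v u m by simp
  ultimately have "degree ?w \<noteq> degree v" by (metis leading_coeff_0_iff degree_0 less_numeral_extra(3))
  with le show ?thesis by (intro exI[of _ c]) simp
qed

text \<open>Evaluation at the point \<open>(s, t)\<close>.\<close>

definition ev2 :: "bpoly \<Rightarrow> complex \<Rightarrow> complex \<Rightarrow> complex" where
  "ev2 u s t = poly (poly u [:t:]) s"

lemma ev2_simps [simp]:
  "ev2 (u + v) s t = ev2 u s t + ev2 v s t" "ev2 (u - v) s t = ev2 u s t - ev2 v s t"
  "ev2 (u * v) s t = ev2 u s t * ev2 v s t" "ev2 (u ^ n) s t = ev2 u s t ^ n"
  "ev2 (const2 c) s t = c" "ev2 var_s s t = s" "ev2 var_t s t = t" "ev2 0 s t = 0"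
  by (auto simp: ev2_def const2_def var_s_def var_t_def)

lemma ev2_sum: "ev2 (sum g A) s t = (\<Sum>i\<in>A. ev2 (g i) s t)"
  by (simp add: ev2_def poly_sum)

lemma ev2_subst2: "ev2 (subst2 a n u v) s t = (\<Sum>i\<le>n. \<Sum>j\<le>n. a i j * ev2 u s t ^ i * ev2 v s t ^ j)"
  by (simp add: subst2_def ev2_sum)

lemma ev2_eq_0:
  assumes "\<And>s t. ev2 u s t = 0" shows "u = 0"
proof (rule ccontr)
  assume u: "u \<noteq> 0"
  have "poly u [:t:] = 0" for t
    by (rule poly_all_0_iff_0[THEN iffD1]) (use assms in \<open>auto simp: ev2_def\<close>)
  hence "range (\<lambda>t. [:t:]) \<subseteq> {x. poly u x = 0}" by auto
  moreover have "infinite (range (\<lambda>t::complex. [:t:]))"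
    by (subst finite_image_iff) (auto simp: inj_on_def infinite_UNIV_char_0)
  ultimately show False using poly_roots_finite[OF u] finite_subset by blast
qed

lemma ev2_inject: "(\<And>s t. ev2 u s t = ev2 v s t) \<Longrightarrow> u = v"
  using ev2_eq_0[of "u - v"] by simp

text \<open>The polynomial map with components \<open>u\<close> and \<open>v\<close>.\<close>

definition pmap2 :: "bpoly \<Rightarrow> bpoly \<Rightarrow> C2 \<Rightarrow> C2" where
  "pmap2 u v = (\<lambda>(s, t). (ev2 u s t, ev2 v s t))"

lemma poly_fun_ev2:
  assumes "poly_fun_deg_le n p" obtains u where "\<And>s t. p (s, t) = ev2 u s t"
proof -
  obtain a where a: "\<And>z w. p (z, w) = (\<Sum>i\<le>n. \<Sum>j\<le>n - i. a i j * z ^ i * w ^ j)"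
    using assms by (auto simp: poly_fun_deg_le_def)
  show ?thesis
    by (rule that[of "\<Sum>i\<le>n. \<Sum>j\<le>n - i. const2 (a i j) * var_s ^ i * var_t ^ j"]) (simp add: a ev2_sum)
qed

lemma poly_fun_supp:
  assumes "poly_fun_deg_le n p" "n \<le> N"
  obtains a where "supp_le a N" "\<And>z w. p (z, w) = (\<Sum>i\<le>N. \<Sum>j\<le>N. a i j * z ^ i * w ^ j)"
proof -
  obtain a where a: "\<forall>i j. a i j \<noteq> 0 \<longrightarrow> i + j \<le> n"
     "\<forall>N\<ge>n. \<forall>z w. p (z, w) = (\<Sum>i\<le>N. \<Sum>j\<le>N. a i j * z ^ i * w ^ j)"
    using assms(1) unfolding poly_fun_deg_le_iff by blast
  have "supp_le a N" using a(1) assms(2) unfolding supp_le_def by fastforce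
  with a(2) assms(2) show ?thesis by (intro that[of a]) blast+
qed

lemma polynomial_diffeo_pmap2:
  assumes "polynomial_diffeo g"
  obtains u v where "g = pmap2 u v"
proof -
  obtain n where n: "poly_map_deg_le n g" using assms by (auto simp: polynomial_diffeo_def polynomial_map_def)
  obtain u where u: "\<And>s t. fst (g (s, t)) = ev2 u s t"
    by (rule poly_fun_ev2[of n "\<lambda>x. fst (g x)"]) (use n in \<open>auto simp: poly_map_deg_le_def\<close>)
  obtain v where v: "\<And>s t. snd (g (s, t)) = ev2 v s t"
    by (rule poly_fun_ev2[of n "\<lambda>x. snd (g x)"]) (use n in \<open>auto simp: poly_map_deg_le_def\<close>)
  have "g = pmap2 u v" by (auto simp: fun_eq_iff pmap2_def u[symmetric] v[symmetric])
  thus ?thesis by (rule that)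
qed

lemma polynomial_diffeo_inverse_coeffs:
  assumes "polynomial_diffeo (pmap2 u v)"
  obtains a b n where "supp_le a n" "supp_le b n" "subst2 a n u v = var_s" "subst2 b n u v = var_t"
proof -
  let ?g = "pmap2 u v"
  obtain n where n: "poly_map_deg_le n (inv ?g)" using assms by (auto simp: polynomial_diffeo_def polynomial_map_def)
  have inv: "inv ?g (?g x) = x" for x using assms by (simp add: polynomial_diffeo_def bij_is_inj)
  obtain a where a: "supp_le a n" "\<And>z w. fst (inv ?g (z, w)) = (\<Sum>i\<le>n. \<Sum>j\<le>n. a i j * z ^ i * w ^ j)"
    by (rule poly_fun_supp[of n "\<lambda>x. fst (inv ?g x)" n]) (use n in \<open>auto simp: poly_map_deg_le_def\<close>)
  obtain b where b: "supp_le b n" "\<And>z w. snd (inv ?g (z, w)) = (\<Sum>i\<le>n. \<Sum>j\<le>n. b i j * z ^ i * w ^ j)"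
    by (rule poly_fun_supp[of n "\<lambda>x. snd (inv ?g x)" n]) (use n in \<open>auto simp: poly_map_deg_le_def\<close>)
  have "ev2 (subst2 a n u v) s t = ev2 var_s s t" for s t
    using inv[of "(s, t)"] a(2)[of "ev2 u s t" "ev2 v s t"] by (simp add: ev2_subst2 pmap2_def)
  moreover have "ev2 (subst2 b n u v) s t = ev2 var_t s t" for s t
    using inv[of "(s, t)"] b(2)[of "ev2 u s t" "ev2 v s t"] by (simp add: ev2_subst2 pmap2_def)
  ultimately show ?thesis using ev2_inject a(1) b(1) by (intro that[of a n b]) blast+
qed

text \<open>The triangular map \<open>(x, y) \<mapsto> (a x + b, c y + p(x))\<close>; it is invertible if
\<open>a\<close> and \<open>c\<close> are nonzero.\<close>

definition tri :: "complex \<Rightarrow> complex \<Rightarrow> complex \<Rightarrow> complex poly \<Rightarrow> C2 \<Rightarrow> C2" where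
  "tri a b c p = (\<lambda>(x, y). (a * x + b, c * y + poly p x))"

text \<open>The group of invertible triangular maps.\<close>

definition Triang :: "(C2 \<Rightarrow> C2) set" where
  "Triang = {tri a b c p |a b c p. a \<noteq> 0 \<and> c \<noteq> 0}"

text \<open>If \<open>u\<close> depends on \<open>s\<close> only, then \<open>J = u\<^sub>s v\<^sub>t\<close>
is a unit, so both factors are constants.\<close>

lemma degree_0_triangular:
  assumes "degree u = 0" and J: "jac u v dvd 1"
  shows "pmap2 u v \<in> Triang"
proof -
  from assms(1) obtain p where p: "u = [:p:]" by (metis degree_eq_zeroE)
  have "jac u v = dfst u * pderiv v" by (simp add: jac_def p pderiv_pCons)
  hence "dfst u * pderiv v dvd 1" using J by simp
  hence 1: "dfst u dvd 1" and 2: "pderiv v dvd 1" by (auto dest: dvd_mult_left dvd_mult_right)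
  have "dfst u = [:pderiv p:]" by (rule poly_eqI) (auto simp: p coeff_dfst coeff_pCons split: nat.splits)
  with 1 have "pderiv p dvd 1" by (simp add: is_unit_const_poly_iff)
  then obtain a where a: "pderiv p = [:a:]" "a dvd 1" by (auto simp: is_unit_poly_iff)
  hence a0: "a \<noteq> 0" by auto
  from a have "degree (pderiv p) = 0" by simp
  hence "degree p \<le> 1" by (simp add: degree_pderiv)
  then obtain b0 b1 where p': "p = [:b0, b1:]" by (metis degree1_coeffs degree_eq_zeroE le_antisym le_zero_eq less_one not_le pCons_0_0)
  have b1: "b1 \<noteq> 0" using a(1) a0 by (auto simp: p' pderiv_pCons)
  from 2 obtain q where q: "pderiv v = [:q:]" "q dvd 1" by (auto simp: is_unit_poly_iff)
  from q(2) obtain c where c: "q = [:c:]" "c dvd 1" by (auto simp: is_unit_poly_iff)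
  hence c0: "c \<noteq> 0" by auto
  from q have "degree (pderiv v) = 0" by simp
  hence "degree v \<le> 1" by (simp add: degree_pderiv)
  then obtain v0 v1 where v: "v = [:v0, v1:]" by (metis degree1_coeffs degree_eq_zeroE le_antisym le_zero_eq less_one not_le pCons_0_0)
  have v1: "v1 = [:c:]" using q(1) c by (auto simp: v pderiv_pCons)
  have "pmap2 u v = tri b1 b0 c v0"
    by (auto simp: pmap2_def tri_def fun_eq_iff ev2_def p p' v v1 algebra_simps)
  thus ?thesis using b1 c0 by (auto simp: Triang_def)
qed

section \<open>Generation by triangular maps and the swap\<close>

text \<open>Invertible triangular maps of degree at least 2; composing one with the swap gives a generalized
Henon map.\<close>

definition Nonlin :: "(C2 \<Rightarrow> C2) set" where
  "Nonlin = {tri a b c p |a b c p. a \<noteq> 0 \<and> c \<noteq> 0 \<and> degree p \<ge> 2}"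

text \<open>Invertible triangular maps that are affine.\<close>

definition Affin :: "(C2 \<Rightarrow> C2) set" where
  "Affin = {tri a b c p |a b c p. a \<noteq> 0 \<and> c \<noteq> 0 \<and> degree p \<le> 1}"

lemma Triang_split: "Triang = Nonlin \<union> Affin"
proof -
  have "2 \<le> degree p \<or> degree p \<le> 1" for p :: "complex poly" by linarith
  thus ?thesis unfolding Triang_def Nonlin_def Affin_def by blast
qed

lemma tri_comp: "tri a b c p \<circ> tri a' b' c' p' = tri (a * a') (a * b' + b) (c * c') (smult c p' + pcompose p [:b', a':])"
  by (auto simp: tri_def fun_eq_iff poly_pcompose algebra_simps)

lemma degree_pcompose_lin: "a \<noteq> 0 \<Longrightarrow> degree (pcompose p [:b, a:]) = degree (p :: complex poly)"
  by (simp add: degree_pcompose)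

lemma Triang_comp: "T \<in> Triang \<Longrightarrow> U \<in> Triang \<Longrightarrow> T \<circ> U \<in> Triang"
  unfolding Triang_def by (force simp: tri_comp)

lemma Affin_Nonlin_comp: "T \<in> Affin \<Longrightarrow> U \<in> Nonlin \<Longrightarrow> T \<circ> U \<in> Nonlin"
  unfolding Affin_def Nonlin_def
proof clarsimp
  fix a b c a' b' c' :: complex and p p' :: "complex poly"
  assume h: "a \<noteq> 0" "c \<noteq> 0" "degree p \<le> Suc 0" "a' \<noteq> 0" "c' \<noteq> 0" "2 \<le> degree p'"
  have "degree (smult c p' + pcompose p [:b', a':]) = degree p'"
    using h by (subst degree_add_eq_left) (auto simp: degree_pcompose_lin)
  thus "\<exists>a'' b'' c'' q. tri a b c p \<circ> tri a' b' c' p' = tri a'' b'' c'' q \<and> a'' \<noteq> 0 \<and> c'' \<noteq> 0 \<and> 2 \<le> degree q"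
    unfolding tri_comp using h by (metis mult_eq_0_iff)
qed

lemma Nonlin_Affin_comp: "T \<in> Nonlin \<Longrightarrow> U \<in> Affin \<Longrightarrow> T \<circ> U \<in> Nonlin"
  unfolding Affin_def Nonlin_def
proof clarsimp
  fix a b c a' b' c' :: complex and p p' :: "complex poly"
  assume h: "a \<noteq> 0" "c \<noteq> 0" "2 \<le> degree p" "a' \<noteq> 0" "c' \<noteq> 0" "degree p' \<le> Suc 0"
  have "degree (smult c p' + pcompose p [:b', a':]) = degree p"
    using h by (subst degree_add_eq_right) (auto simp: degree_pcompose_lin)
  thus "\<exists>a'' b'' c'' q. tri a b c p \<circ> tri a' b' c' p' = tri a'' b'' c'' q \<and> a'' \<noteq> 0 \<and> c'' \<noteq> 0 \<and> 2 \<le> degree q"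
    unfolding tri_comp using h by (metis mult_eq_0_iff)
qed

lemma tri_inverse:
  fixes b :: complex and p :: "complex poly"
  assumes "a \<noteq> 0" "c \<noteq> 0"
  defines "q \<equiv> smult (- 1 / c) (pcompose p [:- b / a, 1 / a:])"
  shows "tri a b c p \<circ> tri (1 / a) (- b / a) (1 / c) q = id" "tri (1 / a) (- b / a) (1 / c) q \<circ> tri a b c p = id"
    "degree q = degree p"
proof -
  show "tri a b c p \<circ> tri (1 / a) (- b / a) (1 / c) q = id"
    using assms by (auto simp: tri_def fun_eq_iff poly_pcompose field_simps)
  show "tri (1 / a) (- b / a) (1 / c) q \<circ> tri a b c p = id"
    using assms by (auto simp: tri_def fun_eq_iff poly_pcompose field_simps)
  show "degree q = degree p" using assms by (simp add: degree_pcompose_lin)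
qed

lemma inv_tri:
  assumes "a \<noteq> 0" "c \<noteq> 0"
  shows "bij (tri a b c p)"
    "inv (tri a b c p) = tri (1 / a) (- b / a) (1 / c) (smult (- 1 / c) (pcompose p [:- b / a, 1 / a:]))"
  using tri_inverse(1,2)[OF assms, of b p] by (auto intro: o_bij inv_unique_comp)

lemma Triang_bij: "T \<in> Triang \<Longrightarrow> bij T"
  by (auto simp: Triang_def inv_tri)

lemma Triang_inv: "T \<in> Triang \<Longrightarrow> inv T \<in> Triang"
  unfolding Triang_def by (fastforce simp: inv_tri)

lemma Nonlin_inv: "T \<in> Nonlin \<Longrightarrow> inv T \<in> Nonlin"
proof -
  assume "T \<in> Nonlin"
  then obtain a b c p where T: "T = tri a b c p" "a \<noteq> 0" "c \<noteq> 0" "2 \<le> degree p" unfolding Nonlin_def by blast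
  show ?thesis unfolding Nonlin_def T(1) inv_tri[OF T(2,3)] mem_Collect_eq
    using T tri_inverse(3)[OF T(2,3), of p b]
    by (intro exI conjI) (rule refl, auto)
qed

lemma tri_id: "tri 1 0 1 0 = id" by (auto simp: tri_def)
lemma id_Triang: "id \<in> Triang" unfolding Triang_def tri_id[symmetric] mem_Collect_eq
  by (rule exI[of _ 1], rule exI[of _ 0], rule exI[of _ 1], rule exI[of _ 0]) simp

lemma poly_map_tri: "poly_map_deg_le (max 1 (degree p)) (tri a b c p)"
  unfolding poly_map_deg_le_def tri_def case_prod_beta fst_conv snd_conv
proof (intro conjI poly_fun_add poly_fun_const poly_fun_cmult)
  show "poly_fun_deg_le (max 1 (degree p)) (\<lambda>x. poly p (fst x))"
    by (rule poly_fun_mono[OF poly_fun_poly[OF poly_fun_fst]]) simp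
qed (auto intro: poly_fun_mono[OF poly_fun_fst] poly_fun_mono[OF poly_fun_snd])

lemma polynomial_map_Triang: "T \<in> Triang \<Longrightarrow> polynomial_map T"
  unfolding polynomial_map_def Triang_def using poly_map_tri by blast

lemma polynomial_diffeo_Triang: "T \<in> Triang \<Longrightarrow> polynomial_diffeo T"
  unfolding polynomial_diffeo_def using Triang_bij Triang_inv polynomial_map_Triang by blast

lemma poly_map_swap: "poly_map_deg_le 1 prod.swap"
  using poly_fun_fst poly_fun_snd by (simp add: poly_map_deg_le_def)

lemma swap_swap: "prod.swap \<circ> prod.swap = id" by (auto simp: fun_eq_iff)

lemma inv_swap: "inv prod.swap = prod.swap" by (rule inv_unique_comp) (auto simp: swap_swap)

lemma polynomial_diffeo_swap: "polynomial_diffeo prod.swap"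
  using poly_map_swap by (auto simp: polynomial_diffeo_def inv_swap polynomial_map_def)

text \<open>The word \<open>\<sigma> T\<^sub>1 \<sigma> T\<^sub>2 \<dots> \<sigma> T\<^sub>n\<close>, where
\<open>\<sigma>\<close> is the swap of the coordinates.\<close>

fun henon_word :: "(C2 \<Rightarrow> C2) list \<Rightarrow> C2 \<Rightarrow> C2" where
  "henon_word [] = id" | "henon_word (T # Ts) = prod.swap \<circ> T \<circ> henon_word Ts"

lemma henon_word_append: "henon_word (Ts @ Us) = henon_word Ts \<circ> henon_word Us"
  by (induction Ts) (auto simp: o_assoc)

text \<open>Words \<open>T\<^sub>0 \<sigma> T\<^sub>1 \<dots> \<sigma> T\<^sub>n\<close> in triangular maps
and the swap \<open>\<sigma>\<close>.\<close>

definition triang_words :: "(C2 \<Rightarrow> C2) set" where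
  "triang_words = {T \<circ> henon_word Ts |T Ts. T \<in> Triang \<and> set Ts \<subseteq> Triang}"

lemma triang_words_Triang: "T \<in> Triang \<Longrightarrow> T \<in> triang_words"
  unfolding triang_words_def by (auto intro!: exI[of _ T] exI[of _ "[]"])

lemma triang_words_Triang_comp: "T \<in> Triang \<Longrightarrow> g \<in> triang_words \<Longrightarrow> T \<circ> g \<in> triang_words"
  unfolding triang_words_def using Triang_comp by (fastforce simp: o_assoc)

lemma triang_words_swap_comp: "g \<in> triang_words \<Longrightarrow> prod.swap \<circ> g \<in> triang_words"
  unfolding triang_words_def
proof clarsimp
  fix T Ts assume "T \<in> Triang" "set Ts \<subseteq> Triang"
  thus "\<exists>T' Ts'. prod.swap \<circ> (T \<circ> henon_word Ts) = T' \<circ> henon_word Ts' \<and> T' \<in> Triang \<and> set Ts' \<subseteq> Triang"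
    using id_Triang by (intro exI[of _ id] exI[of _ "T # Ts"]) (auto simp: o_assoc)
qed

lemma pmap2_swap: "prod.swap \<circ> pmap2 u v = pmap2 v u"
  by (auto simp: pmap2_def fun_eq_iff)

lemma triang_words_reduction_step:
  assumes pd: "polynomial_diffeo (pmap2 u v)" and u: "degree u > 0" and v: "degree v > 0"
    and dvd: "degree u dvd degree v"
    and IH: "\<And>w. degree w < degree v \<Longrightarrow> polynomial_diffeo (pmap2 u w) \<Longrightarrow> pmap2 u w \<in> triang_words"
  shows "pmap2 u v \<in> triang_words"
proof -
  obtain a b n where ab: "supp_le a n" "supp_le b n" "subst2 a n u v = var_s" "subst2 b n u v = var_t"
    using polynomial_diffeo_inverse_coeffs[OF pd] .
  from dvd obtain m where "degree v = degree u * m" by (elim dvdE)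
  hence m: "degree v = m * degree u" by (simp only: mult.commute)
  with v have "m > 0" by (cases m) auto
  then obtain c where c: "degree (v - const2 c * u ^ m) < degree v"
    using degree_reduction[OF u m _ ab(1,3)] by blast
  let ?w = "v - const2 c * u ^ m"
  let ?E = "tri 1 0 1 (monom c m)" and ?F = "tri 1 0 1 (monom (- c) m)"
  have E: "?E \<in> Triang" and F: "?F \<in> Triang" unfolding Triang_def mem_Collect_eq
    by (intro exI conjI, rule refl, simp_all)+
  have 1: "pmap2 u ?w = ?F \<circ> pmap2 u v" and 2: "pmap2 u v = ?E \<circ> pmap2 u ?w"
    by (auto simp: pmap2_def tri_def fun_eq_iff poly_monom)
  have "pmap2 u ?w \<in> triang_words"
    by (rule IH[OF c]) (unfold 1, rule polynomial_diffeo_comp[OF polynomial_diffeo_Triang[OF F] pd])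
  thus ?thesis unfolding 2 using triang_words_Triang_comp[OF E] by blast
qed

text \<open>The theorem of Jung and van der Kulk for the complex plane: the triangular maps and the swap
generate all polynomial automorphisms.\<close>

theorem polynomial_diffeo_in_triang_words:
  assumes "polynomial_diffeo g" shows "g \<in> triang_words"
proof -
  obtain u v where g: "g = pmap2 u v" using polynomial_diffeo_pmap2[OF assms] .
  have "polynomial_diffeo (pmap2 u v) \<Longrightarrow> pmap2 u v \<in> triang_words"
  proof (induction "degree u + degree v" arbitrary: u v rule: less_induct)
    case less
    obtain a b n where ab: "supp_le a n" "supp_le b n" "subst2 a n u v = var_s" "subst2 b n u v = var_t"
      using polynomial_diffeo_inverse_coeffs[OF less.prems] .
    have J: "jac u v dvd 1" by (rule jac_is_unit[OF ab])
    have J': "jac v u dvd 1" using J jac_swap[of v u] by simp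
    have pd': "polynomial_diffeo (pmap2 v u)"
      using polynomial_diffeo_comp[OF polynomial_diffeo_swap less.prems] by (simp only: pmap2_swap)
    have flip: "pmap2 u v \<in> triang_words" if "pmap2 v u \<in> triang_words"
      using triang_words_swap_comp[OF that] by (simp add: pmap2_swap)
    consider "degree u = 0" | "degree v = 0" | "degree u > 0" "degree v > 0" by auto
    thus ?case
    proof cases
      case 1
      thus ?thesis using degree_0_triangular[OF _ J] triang_words_Triang by blast
    next
      case 2
      thus ?thesis using degree_0_triangular[OF _ J'] triang_words_Triang flip by blast
    next
      case 3
      from degree_divides[OF 3 J ab(2,4)] show ?thesis
      proof
        assume "degree u dvd degree v"
        thus ?thesis
        proof (rule triang_words_reduction_step[OF less.prems 3])
          fix w assume "degree w < degree v" "polynomial_diffeo (pmap2 u w)"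
          thus "pmap2 u w \<in> triang_words" by (intro less.hyps) simp_all
        qed
      next
        assume "degree v dvd degree u"
        hence "pmap2 v u \<in> triang_words"
        proof (rule triang_words_reduction_step[OF pd' 3(2,1)])
          fix w assume "degree w < degree u" "polynomial_diffeo (pmap2 v w)"
          thus "pmap2 v w \<in> triang_words" by (intro less.hyps) simp_all
        qed
        thus ?thesis by (rule flip)
      qed
    qed
  qed
  thus ?thesis using assms g by simp
qed

section \<open>Reduced words and cyclic reduction\<close>

lemma Affin_I: "a \<noteq> 0 \<Longrightarrow> c \<noteq> 0 \<Longrightarrow> degree p \<le> 1 \<Longrightarrow> tri a b c p \<in> Affin"
  unfolding Affin_def by blast

text \<open>The Bruhat decomposition of two by two matrices. It shortens a word that has an affine letter
between two swaps.\<close>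

lemma swap_Affin_swap:
  assumes "T \<in> Affin"
  shows "prod.swap \<circ> T \<circ> prod.swap \<in> Affin \<or>
    (\<exists>A\<in>Affin. \<exists>B\<in>Affin. prod.swap \<circ> T \<circ> prod.swap = A \<circ> prod.swap \<circ> B)"
proof -
  obtain a b c p where T: "T = tri a b c p" "a \<noteq> 0" "c \<noteq> 0" "degree p \<le> 1" using assms unfolding Affin_def by blast
  have "p = [:coeff p 0, coeff p 1:]"
    by (rule poly_eqI) (use T(4) in \<open>auto simp: coeff_pCons coeff_eq_0 split: nat.splits\<close>)
  then obtain p0 p1 where p: "p = [:p0, p1:]" by blast
  show ?thesis
  proof (cases "p1 = 0")
    case True
    have "prod.swap \<circ> T \<circ> prod.swap = tri c p0 a [:b:]"
      by (auto simp: T p True tri_def fun_eq_iff)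
    moreover have "tri c p0 a [:b:] \<in> Affin" using T by (intro Affin_I) auto
    ultimately show ?thesis by simp
  next
    case False
    let ?A = "tri 1 0 (- a * c / p1) [:b - a * p0 / p1, a / p1:]" and ?B = "tri 1 0 p1 [:p0, c:]"
    have "prod.swap \<circ> T \<circ> prod.swap = ?A \<circ> prod.swap \<circ> ?B"
      using False by (auto simp: T p tri_def fun_eq_iff field_simps)
    moreover have "?A \<in> Affin" "?B \<in> Affin"
      using T False by (auto intro!: Affin_I)
    ultimately show ?thesis by blast
  qed
qed

lemma Affin_Triang: "Affin \<subseteq> Triang" and Nonlin_Triang: "Nonlin \<subseteq> Triang" by (auto simp: Triang_split)

lemma henon_word_shorten:
  assumes "X \<in> Triang" "T \<in> Affin" "Y \<in> Triang"
  obtains Zs where "henon_word [X, T, Y] = henon_word Zs" "set Zs \<subseteq> Triang" "Zs \<noteq> []" "length Zs < 3"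
proof -
  have eq: "henon_word [X, T, Y] = prod.swap \<circ> X \<circ> (prod.swap \<circ> T \<circ> prod.swap) \<circ> Y" by (simp add: o_assoc)
  from swap_Affin_swap[OF assms(2)] show ?thesis
  proof (elim disjE bexE)
    assume "prod.swap \<circ> T \<circ> prod.swap \<in> Affin"
    hence "X \<circ> (prod.swap \<circ> T \<circ> prod.swap) \<circ> Y \<in> Triang" 
      using Triang_comp[OF Triang_comp[OF assms(1), of "prod.swap \<circ> T \<circ> prod.swap"] assms(3)] Affin_Triang by blast
    thus ?thesis by (intro that[of "[X \<circ> (prod.swap \<circ> T \<circ> prod.swap) \<circ> Y]"]) (auto simp: eq o_assoc)
  next
    fix A B assume AB: "A \<in> Affin" "B \<in> Affin" "prod.swap \<circ> T \<circ> prod.swap = A \<circ> prod.swap \<circ> B"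
    have "X \<circ> A \<in> Triang" "B \<circ> Y \<in> Triang" using assms AB Affin_Triang by (auto intro!: Triang_comp)
    thus ?thesis by (intro that[of "[X \<circ> A, B \<circ> Y]"]) (auto simp: eq AB(3) o_assoc)
  qed
qed

text \<open>In a shortest word for \<open>g\<close> all letters except possibly the two outer ones are
nonlinear.\<close>

theorem reduced_word:
  assumes "polynomial_diffeo g"
  obtains T Ts where "g = T \<circ> henon_word Ts" "T \<in> Triang" "set Ts \<subseteq> Triang" "set (butlast Ts) \<subseteq> Nonlin"
proof -
  define P where "P = (\<lambda>Us. Us \<noteq> [] \<and> set Us \<subseteq> Triang \<and> henon_word Us = prod.swap \<circ> g)"
  obtain T Ts where "g = T \<circ> henon_word Ts" "T \<in> Triang" "set Ts \<subseteq> Triang"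
    using polynomial_diffeo_in_triang_words[OF assms] unfolding triang_words_def by blast
  hence "P (T # Ts)" by (auto simp: P_def o_assoc)
  then obtain Us where Us: "P Us" and min: "\<And>Vs. P Vs \<Longrightarrow> length Us \<le> length Vs"
    using ex_has_least_nat[of P _ length] by blast
  obtain T0 Vs where TV: "Us = T0 # Vs" using Us by (cases Us) (auto simp: P_def)
  have "set (butlast Vs) \<subseteq> Nonlin"
  proof (rule ccontr)
    assume "\<not> ?thesis"
    then obtain T where T: "T \<in> set (butlast Vs)" "T \<notin> Nonlin" by blast
    then obtain P1 Q1 where PQ: "butlast Vs = P1 @ T # Q1" by (metis in_set_conv_decomp)
    have "Vs \<noteq> []" using T by auto
    then obtain L where "Vs = butlast Vs @ [L]" by (metis append_butlast_last_id)
    hence Vs: "Vs = P1 @ T # Q1 @ [L]" using PQ by simp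
    obtain P2 X where PX: "T0 # P1 = P2 @ [X]" by (metis append_butlast_last_id list.distinct(1))
    obtain Y Q2 where YQ: "Q1 @ [L] = Y # Q2" by (metis append_is_Nil_conv list.exhaust list.distinct(1))
    have U: "Us = P2 @ [X, T, Y] @ Q2" unfolding TV Vs YQ using PX by simp
    have sub: "set Us \<subseteq> Triang" and eq: "henon_word Us = prod.swap \<circ> g" using Us by (auto simp: P_def)
    have "T \<in> Affin" using T(2) sub unfolding U Triang_split by auto
    then obtain Zs where Zs: "henon_word [X, T, Y] = henon_word Zs" "set Zs \<subseteq> Triang" "Zs \<noteq> []" "length Zs < 3"
      using henon_word_shorten[of X T Y] sub unfolding U by auto
    have "P (P2 @ Zs @ Q2)"
      using Zs sub eq unfolding P_def U henon_word_append by auto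
    from min[OF this] Zs(4) show False unfolding U by simp
  qed
  moreover have "g = T0 \<circ> henon_word Vs"
  proof -
    have "prod.swap \<circ> (T0 \<circ> henon_word Vs) = prod.swap \<circ> g" using Us unfolding P_def TV by (simp add: o_assoc)
    hence "(prod.swap \<circ> prod.swap) \<circ> (T0 \<circ> henon_word Vs) = (prod.swap \<circ> prod.swap) \<circ> g" by (metis o_assoc)
    thus ?thesis by (simp add: swap_swap)
  qed
  ultimately show ?thesis using Us that unfolding P_def TV by auto
qed

text \<open>The degrees of the iterates of \<open>f\<close> are bounded.\<close>

definition bounded_degree :: "(C2 \<Rightarrow> C2) \<Rightarrow> bool" where
  "bounded_degree f \<longleftrightarrow> (\<exists>N. \<forall>n. poly_map_deg_le N (f ^^ n))"

lemma conj_funpow: "f \<circ> \<phi> = \<phi> \<circ> h \<Longrightarrow> (f ^^ n) \<circ> \<phi> = \<phi> \<circ> (h ^^ n)"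
proof (rule ext)
  fix x
  assume "f \<circ> \<phi> = \<phi> \<circ> h"
  hence "f (\<phi> y) = \<phi> (h y)" for y by (metis comp_apply)
  thus "((f ^^ n) \<circ> \<phi>) x = (\<phi> \<circ> (h ^^ n)) x" by (induction n) auto
qed

lemma poly_map_deg_le_conj:
  assumes "f \<circ> \<phi> = \<phi> \<circ> h" "polynomial_diffeo \<phi>"
  obtains K where "K > 0" "\<And>n N. poly_map_deg_le N (h ^^ n) \<Longrightarrow> poly_map_deg_le (K * N) (f ^^ n)"
proof -
  obtain a where a: "poly_map_deg_le a \<phi>" using assms(2) by (auto simp: polynomial_diffeo_def polynomial_map_def)
  obtain b where b: "poly_map_deg_le b (inv \<phi>)" using assms(2) by (auto simp: polynomial_diffeo_def polynomial_map_def)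
  have "poly_map_deg_le ((a * b + 1) * N) (f ^^ n)" if "poly_map_deg_le N (h ^^ n)" for n N
  proof -
    have "\<phi> \<circ> inv \<phi> = id" using assms(2) by (meson polynomial_diffeo_def bij_is_surj surj_iff)
    hence "f ^^ n = (f ^^ n) \<circ> \<phi> \<circ> inv \<phi>" by (simp flip: o_assoc)
    also have "\<dots> = \<phi> \<circ> (h ^^ n) \<circ> inv \<phi>" using conj_funpow[OF assms(1)] by simp
    finally have "poly_map_deg_le (a * N * b) (f ^^ n)"
      using poly_map_comp[OF poly_map_comp[OF a that] b] by simp
    thus ?thesis by (rule poly_map_mono) (simp add: algebra_simps)
  qed
  thus ?thesis by (intro that[of "a * b + 1"]) auto
qed

lemma bounded_degree_conj:
  assumes "f \<circ> \<phi> = \<phi> \<circ> h" "polynomial_diffeo \<phi>" "bounded_degree h"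
  shows "bounded_degree f"
  using poly_map_deg_le_conj[OF assms(1,2)] assms(3) unfolding bounded_degree_def by metis

lemma bounded_degree_Triang:
  assumes "T \<in> Triang" shows "bounded_degree T"
proof -
  obtain a b c p where T: "T = tri a b c p" "a \<noteq> 0" using assms unfolding Triang_def by blast
  have "\<exists>a' b' c' q. T ^^ n = tri a' b' c' q \<and> a' \<noteq> 0 \<and> degree q \<le> degree p" for n
  proof (induction n)
    case 0
    thus ?case by (rule exI[of _ 1], rule exI[of _ 0], rule exI[of _ 1], rule exI[of _ 0]) (simp add: tri_id)
  next
    case (Suc n)
    then obtain a' b' c' q where q: "T ^^ n = tri a' b' c' q" "a' \<noteq> 0" "degree q \<le> degree p" by blast
    have "T ^^ Suc n = tri (a * a') (a * b' + b) (c * c') (smult c q + pcompose p [:b', a':])"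
      unfolding funpow.simps q(1) unfolding T(1) tri_comp ..
    moreover have "degree (smult c q + pcompose p [:b', a':]) \<le> degree p"
      using q by (intro degree_add_le) (auto simp: degree_pcompose_lin)
    ultimately show ?case using T(2) q(2) by (metis mult_eq_0_iff)
  qed
  hence "poly_map_deg_le (max 1 (degree p)) (T ^^ n)" for n
    by (metis max.mono order_refl poly_map_mono poly_map_tri)
  thus ?thesis unfolding bounded_degree_def by blast
qed

lemma bounded_degree_swap_Affin:
  assumes "T \<in> Affin" shows "bounded_degree (prod.swap \<circ> T)"
proof -
  obtain a b c p where T: "T = tri a b c p" "degree p \<le> 1" using assms unfolding Affin_def by blast
  have "poly_map_deg_le 1 T" unfolding T(1) by (rule poly_map_mono[OF poly_map_tri]) (use T in simp)
  hence 1: "poly_map_deg_le 1 (prod.swap \<circ> T)" using poly_map_comp[OF poly_map_swap] by fastforce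
  have "poly_map_deg_le 1 ((prod.swap \<circ> T) ^^ n)" for n
  proof (induction n)
    case 0
    show ?case using poly_fun_fst poly_fun_snd by (simp add: poly_map_deg_le_def)
  next
    case (Suc n)
    show ?case using poly_map_comp[OF 1 Suc] by (simp only: funpow.simps mult_1)
  qed
  thus ?thesis unfolding bounded_degree_def by blast
qed

lemma polynomial_diffeo_id: "polynomial_diffeo id"
  using polynomial_diffeo_Triang[OF id_Triang] .

lemma polynomial_diffeo_henon_word: "set Ts \<subseteq> Triang \<Longrightarrow> polynomial_diffeo (henon_word Ts)"
proof (induction Ts)
  case (Cons T Ts)
  hence "polynomial_diffeo (prod.swap \<circ> T)" "polynomial_diffeo (henon_word Ts)"
    using polynomial_diffeo_comp[OF polynomial_diffeo_swap polynomial_diffeo_Triang[of T]] by auto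
  from polynomial_diffeo_comp[OF this] show ?case by (simp only: henon_word.simps)
qed (simp add: polynomial_diffeo_id)

text \<open>Cyclic reduction. For \<open>f = T \<sigma> T\<^sub>1 \<dots> \<sigma> L\<close>, conjugation by
\<open>T\<close> merges the last letter with the first to \<open>T' = L T\<close>. If \<open>T'\<close> is
nonlinear, the word is cyclically reduced. Otherwise \<open>\<sigma> T' \<sigma>\<close> is either an affine
triangular map, and the word becomes shorter, or \<open>A \<sigma> B\<close> with affine \<open>A\<close>,
\<open>B\<close>, which are absorbed by the neighbouring nonlinear letters. The conjugating word \<open>T
\<circ> henon_word Qs\<close> has nonlinear letters after \<open>T\<close>, so its growth on the cone is
known; this is why the first letter is kept in the induction.\<close>

theorem conjugate_to_reduced:
  "T \<in> Triang \<Longrightarrow> set Ts \<subseteq> Triang \<Longrightarrow> set (butlast Ts) \<subseteq> Nonlin \<Longrightarrow> f = T \<circ> henon_word Ts \<Longrightarrow>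
   bounded_degree f \<or> (\<exists>Qs Rs. set Qs \<subseteq> Nonlin \<and> set Rs \<subseteq> Nonlin \<and> Rs \<noteq> [] \<and>
      f \<circ> (T \<circ> henon_word Qs) = (T \<circ> henon_word Qs) \<circ> henon_word Rs)"
proof (induction "length Ts" arbitrary: T Ts f rule: less_induct)
  case (less Ts T f)
  note T = \<open>T \<in> Triang\<close>
  show ?case
  proof (cases Ts rule: rev_cases)
    case Nil
    thus ?thesis using bounded_degree_Triang T less.prems by simp
  next
    case (snoc F L)
    have L: "L \<in> Triang" and F: "set F \<subseteq> Nonlin" using less.prems snoc by auto
    have f: "f = T \<circ> henon_word F \<circ> prod.swap \<circ> L" using less.prems(4) by (simp add: snoc henon_word_append o_assoc)
    define T' where "T' = L \<circ> T"
    have T': "T' \<in> Triang" using L T by (simp add: T'_def Triang_comp)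
    show ?thesis
    proof (cases "T' \<in> Nonlin")
      case True
      have "f \<circ> (T \<circ> henon_word []) = (T \<circ> henon_word []) \<circ> henon_word (F @ [T'])"
        by (simp add: f henon_word_append T'_def o_assoc)
      thus ?thesis using True F
        by (intro disjI2 exI[of _ "[]"] exI[of _ "F @ [T']"]) auto
    next
      case False
      hence Affin: "T' \<in> Affin" using T' Triang_split by auto
      show ?thesis
      proof (cases F)
        case Nil
        have "f \<circ> T = T \<circ> (prod.swap \<circ> T')" by (simp add: f Nil T'_def o_assoc)
        thus ?thesis using bounded_degree_conj[OF _ polynomial_diffeo_Triang[OF T] bounded_degree_swap_Affin[OF Affin]] by blast
      next
        case (Cons T1 F1)
        have T1: "T1 \<in> Nonlin" and F1: "set F1 \<subseteq> Nonlin" using F Cons by auto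
        have f1: "f = T \<circ> prod.swap \<circ> T1 \<circ> henon_word F1 \<circ> prod.swap \<circ> L"
          by (simp add: f Cons o_assoc)
        have Tsw: "polynomial_diffeo (T \<circ> prod.swap)"
          by (rule polynomial_diffeo_comp[OF polynomial_diffeo_Triang[OF T] polynomial_diffeo_swap])
        have key: "f \<circ> T \<circ> prod.swap = T \<circ> prod.swap \<circ> T1 \<circ> henon_word F1 \<circ> (prod.swap \<circ> T' \<circ> prod.swap)"
          by (simp add: f1 T'_def o_assoc)
        from swap_Affin_swap[OF Affin] show ?thesis
        proof (elim disjE bexE)
          define D where "D = prod.swap \<circ> T' \<circ> prod.swap"
          assume "prod.swap \<circ> T' \<circ> prod.swap \<in> Affin"
          hence D: "D \<in> Affin" by (simp add: D_def)
          show ?thesis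
          proof (cases F1 rule: rev_cases)
            case Nil
            have "f \<circ> (T \<circ> prod.swap) = (T \<circ> prod.swap) \<circ> (T1 \<circ> D)"
              using key by (simp add: Nil D_def o_assoc)
            moreover have "T1 \<circ> D \<in> Triang" using T1 D Nonlin_Triang Affin_Triang by (intro Triang_comp) auto
            ultimately show ?thesis using bounded_degree_conj[OF _ Tsw bounded_degree_Triang] by blast
          next
            case (snoc F2 M)
            define f' where "f' = T1 \<circ> henon_word (F2 @ [M \<circ> D])"
            have conj: "f \<circ> (T \<circ> prod.swap) = (T \<circ> prod.swap) \<circ> f'"
              using key by (simp add: snoc D_def[symmetric] f'_def henon_word_append o_assoc)
            have MD: "M \<circ> D \<in> Nonlin" using snoc F1 D by (auto intro: Nonlin_Affin_comp)
            have "bounded_degree f' \<or> (\<exists>Qs Rs. set Qs \<subseteq> Nonlin \<and> set Rs \<subseteq> Nonlin \<and> Rs \<noteq> [] \<and>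
               f' \<circ> (T1 \<circ> henon_word Qs) = (T1 \<circ> henon_word Qs) \<circ> henon_word Rs)"
            proof (rule less.hyps[OF _ _ _ _ f'_def])
              show "length (F2 @ [M \<circ> D]) < length Ts" using \<open>Ts = F @ [L]\<close> Cons snoc by simp
              show "T1 \<in> Triang" using T1 Nonlin_Triang by auto
              show "set (F2 @ [M \<circ> D]) \<subseteq> Triang" using MD F1 snoc Nonlin_Triang by auto
              show "set (butlast (F2 @ [M \<circ> D])) \<subseteq> Nonlin" using F1 snoc by auto
            qed
            thus ?thesis
            proof (elim disjE exE conjE)
              assume "bounded_degree f'"
              thus ?thesis using bounded_degree_conj[OF conj Tsw] by blast
            next
              fix Qs Rs assume h: "set Qs \<subseteq> Nonlin" "set Rs \<subseteq> Nonlin" "Rs \<noteq> []"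
                and c': "f' \<circ> (T1 \<circ> henon_word Qs) = (T1 \<circ> henon_word Qs) \<circ> henon_word Rs"
              have "f \<circ> (T \<circ> henon_word (T1 # Qs)) = (f \<circ> (T \<circ> prod.swap)) \<circ> (T1 \<circ> henon_word Qs)" by (simp add: o_assoc)
              also have "\<dots> = (T \<circ> prod.swap) \<circ> (f' \<circ> (T1 \<circ> henon_word Qs))" unfolding conj by (simp add: o_assoc)
              also have "\<dots> = (T \<circ> henon_word (T1 # Qs)) \<circ> henon_word Rs" unfolding c' by (simp add: o_assoc)
              finally show ?thesis using h T1 by (intro disjI2 exI[of _ "T1 # Qs"] exI[of _ Rs]) auto
            qed
          qed
        next
          fix A B assume A: "A \<in> Affin" and B: "B \<in> Affin"
            and AB: "prod.swap \<circ> T' \<circ> prod.swap = A \<circ> prod.swap \<circ> B"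
          show ?thesis
          proof (cases F1 rule: rev_cases)
            case Nil
            have "f \<circ> (T \<circ> henon_word [T1 \<circ> A]) = (f \<circ> T \<circ> prod.swap) \<circ> (T1 \<circ> A)" by (simp add: o_assoc)
            also have "\<dots> = (T \<circ> henon_word [T1 \<circ> A]) \<circ> henon_word [B \<circ> (T1 \<circ> A)]"
              unfolding key AB by (simp add: Nil o_assoc)
            finally show ?thesis using T1 A B
              by (intro disjI2 exI[of _ "[T1 \<circ> A]"] exI[of _ "[B \<circ> (T1 \<circ> A)]"])
                 (auto intro: Nonlin_Affin_comp Affin_Nonlin_comp)
          next
            case (snoc F2 M)
            have "f \<circ> (T \<circ> henon_word [T1]) = (f \<circ> T \<circ> prod.swap) \<circ> T1" by (simp add: o_assoc)
            also have "\<dots> = (T \<circ> henon_word [T1]) \<circ> henon_word (F2 @ [M \<circ> A, B \<circ> T1])"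
              unfolding key AB by (simp add: snoc henon_word_append o_assoc)
            finally show ?thesis using T1 A B F1 snoc
              by (intro disjI2 exI[of _ "[T1]"] exI[of _ "F2 @ [M \<circ> A, B \<circ> T1]"])
                 (auto intro: Nonlin_Affin_comp Affin_Nonlin_comp)
          qed
        qed
      qed
    qed
  qed
qed

section \<open>Growth of triangular maps on a cone\<close>

text \<open>\<open>L(z) = log\<^sup>+ \<parallel>z\<parallel>\<close>.\<close>

definition log_norm :: "C2 \<Rightarrow> real" where "log_norm z = ln (max 1 (norm z))"

lemma log_norm_nonneg: "log_norm z \<ge> 0" by (simp add: log_norm_def)

lemma log_norm_swap: "log_norm (prod.swap z) = log_norm z"
  by (simp add: log_norm_def norm_prod_def prod.swap_def add.commute)

text \<open>The part of the cone \<open>\<bar>y\<bar> \<le> \<bar>x\<bar>\<close> where \<open>\<bar>x\<bar>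
\<ge> R\<close>.\<close>

definition cone :: "real \<Rightarrow> C2 set" where
  "cone R = {z. norm (snd z) \<le> norm (fst z) \<and> R \<le> norm (fst z)}"

lemma norm_le_2fst: "norm (snd z) \<le> norm (fst z) \<Longrightarrow> norm z \<le> 2 * norm (fst (z::C2))"
  using norm_Pair_le[of "fst z" "snd z"] by simp

lemma log_norm_cone:
  assumes "z \<in> cone 1" shows "ln (norm (fst z)) \<le> log_norm z" "log_norm z \<le> ln (norm (fst z)) + ln 2"
proof -
  have f: "1 \<le> norm (fst z)" using assms by (auto simp: cone_def)
  have "norm (fst z) \<le> norm z" by (metis norm_fst_le prod.collapse)
  thus "ln (norm (fst z)) \<le> log_norm z" unfolding log_norm_def using f by (subst ln_le_cancel_iff) auto
  have "max 1 (norm z) \<le> 2 * norm (fst z)" using f norm_le_2fst[of z] assms by (auto simp: cone_def)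
  hence "log_norm z \<le> ln (2 * norm (fst z))" unfolding log_norm_def using f by (subst ln_le_cancel_iff) auto
  also have "\<dots> = ln (norm (fst z)) + ln 2" using f by (subst ln_mult) auto
  finally show "log_norm z \<le> ln (norm (fst z)) + ln 2" .
qed

lemma log_norm_power_bounds:
  assumes "z \<in> cone 1" "w \<in> cone 1" "K1 > 0" "K1 * norm (fst z) ^ n \<le> norm (fst w)" "norm (fst w) \<le> K2 * norm (fst z) ^ n"
  shows "\<bar>log_norm w - real n * log_norm z\<bar> \<le> \<bar>ln K1\<bar> + \<bar>ln K2\<bar> + (real n + 1) * ln 2"
proof -
  have z: "norm (fst z) \<ge> 1" and w: "norm (fst w) \<ge> 1" using assms by (auto simp: cone_def)
  have zp: "norm (fst z) ^ n > 0" using z by (intro zero_less_power) linarith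
  have "0 < K1 * norm (fst z) ^ n" using zp assms(3) by (rule mult_pos_pos[rotated])
  hence "0 < K2 * norm (fst z) ^ n" using assms(4,5) by linarith
  hence K2: "K2 > 0" using zp by (simp add: zero_less_mult_iff)
  have lnm: "ln (K * norm (fst z) ^ n) = ln K + n * ln (norm (fst z))" if "K > 0" for K
  proof -
    have "ln (K * norm (fst z) ^ n) = ln K + ln (norm (fst z) ^ n)" using that zp by (intro ln_mult_pos)
    moreover have "norm (fst z) > 0" using z by linarith
    ultimately show ?thesis by (simp only: ln_realpow)
  qed
  have "ln (K1 * norm (fst z) ^ n) \<le> ln (norm (fst w))" using z w zp assms \<open>0 < K1 * norm (fst z) ^ n\<close> by (intro ln_mono) auto
  hence 1: "ln K1 + n * ln (norm (fst z)) \<le> ln (norm (fst w))" using lnm[OF assms(3)] by simp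
  have "ln (norm (fst w)) \<le> ln (K2 * norm (fst z) ^ n)" using z w K2 assms by (intro ln_mono) auto
  hence 2: "ln (norm (fst w)) \<le> ln K2 + n * ln (norm (fst z))" using lnm[OF K2] by simp
  have 3: "real n * ln (norm (fst z)) \<le> n * log_norm z" "real n * log_norm z \<le> n * (ln (norm (fst z)) + ln 2)"
    using log_norm_cone[OF assms(1)] by (auto intro!: mult_left_mono)
  have "ln (2::real) > 0" by simp
  hence "real n * ln 2 \<ge> 0" by simp
  with 1 2 3 log_norm_cone[OF assms(2)] \<open>ln (2::real) > 0\<close> 
    abs_ge_self[of "ln K1"] abs_ge_minus_self[of "ln K1"] abs_ge_self[of "ln K2"] abs_ge_minus_self[of "ln K2"]
  show ?thesis by (simp add: algebra_simps abs_le_iff)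
qed

text \<open>Near infinity \<open>g\<close> maps the cone into itself, at least doubles
\<open>\<bar>x\<bar>\<close>, and multiplies \<open>L\<close> by \<open>D\<close> up to a bounded
error.\<close>

definition expanding :: "real \<Rightarrow> (C2 \<Rightarrow> C2) \<Rightarrow> bool" where
  "expanding D g \<longleftrightarrow> (\<exists>R C. R \<ge> 1 \<and> (\<forall>z\<in>cone R. norm (snd (g z)) \<le> norm (fst (g z)) \<and>
      2 * norm (fst z) \<le> norm (fst (g z)) \<and> \<bar>log_norm (g z) - D * log_norm z\<bar> \<le> C))"

lemma expanding_comp:
  assumes "expanding D g" "expanding D' g'" shows "expanding (D * D') (g \<circ> g')"
proof -
  obtain R C where R: "R \<ge> 1" "\<And>z. z \<in> cone R \<Longrightarrow> norm (snd (g z)) \<le> norm (fst (g z)) \<and>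
      2 * norm (fst z) \<le> norm (fst (g z)) \<and> \<bar>log_norm (g z) - D * log_norm z\<bar> \<le> C"
    using assms(1) unfolding expanding_def by blast
  obtain R' C' where R': "R' \<ge> 1" "\<And>z. z \<in> cone R' \<Longrightarrow> norm (snd (g' z)) \<le> norm (fst (g' z)) \<and>
      2 * norm (fst z) \<le> norm (fst (g' z)) \<and> \<bar>log_norm (g' z) - D' * log_norm z\<bar> \<le> C'"
    using assms(2) unfolding expanding_def by blast
  show ?thesis unfolding expanding_def
  proof (rule exI[of _ "max R R'"], rule exI[of _ "C + \<bar>D\<bar> * C'"], intro conjI ballI)
    show "max R R' \<ge> 1" using R by simp
  next
    fix z assume z: "z \<in> cone (max R R')"
    hence z': "z \<in> cone R'" by (auto simp: cone_def)
    note g' = R'(2)[OF z']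
    have "g' z \<in> cone R" using g' z R by (auto simp: cone_def)
    note g = R(2)[OF this]
    show "norm (snd ((g \<circ> g') z)) \<le> norm (fst ((g \<circ> g') z))" using g by simp
    show "2 * norm (fst z) \<le> norm (fst ((g \<circ> g') z))" using g g' norm_ge_zero[of "fst z"]
      by (simp only: comp_apply) linarith
    have "D * log_norm (g' z) - D * D' * log_norm z = D * (log_norm (g' z) - D' * log_norm z)" by (simp add: algebra_simps)
    moreover have "\<bar>D * (log_norm (g' z) - D' * log_norm z)\<bar> \<le> \<bar>D\<bar> * C'" unfolding abs_mult using g' by (intro mult_left_mono) auto
    ultimately show "\<bar>log_norm ((g \<circ> g') z) - D * D' * log_norm z\<bar> \<le> C + \<bar>D\<bar> * C'" using g by (simp only: comp_apply) linarith
  qed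
qed

lemma poly_growth:
  fixes p :: "complex poly"
  obtains R K1 K2 where "p \<noteq> 0 \<Longrightarrow> 0 < K1" "0 < K2" "1 \<le> R"
    "\<And>x::complex. norm x \<ge> R \<Longrightarrow> K1 * norm x ^ degree p \<le> norm (poly p x)"
    "\<And>x::complex. norm x \<ge> R \<Longrightarrow> norm (poly p x) \<le> K2 * norm x ^ degree p"
proof (cases "p = 0")
  case True
  thus ?thesis by (intro that[of 0 1 1]) auto
next
  case False
  let ?n = "degree p" and ?a = "norm (lead_coeff p)"
  define B where "B = (\<Sum>i<?n. norm (coeff p i))"
  have B: "B \<ge> 0" unfolding B_def by (intro sum_nonneg) auto
  have a: "?a > 0" using False by simp
  define R where "R = max 1 (2 * B / ?a)"
  have eq: "poly p x = (\<Sum>i<?n. coeff p i * x ^ i) + lead_coeff p * x ^ ?n" for x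
    by (simp add: poly_altdef lessThan_Suc_atMost[symmetric])
  have small: "norm (\<Sum>i<?n. coeff p i * x ^ i) \<le> ?a / 2 * norm x ^ ?n" if x: "norm x \<ge> R" for x
  proof (cases "?n = 0")
    case False
    have x1: "norm x \<ge> 1" and x2: "2 * B / ?a \<le> norm x" using x by (auto simp: R_def)
    have "norm (\<Sum>i<?n. coeff p i * x ^ i) \<le> (\<Sum>i<?n. norm (coeff p i) * norm x ^ (?n - 1))"
    proof (rule sum_norm_le)
      fix i assume "i \<in> {..<?n}"
      hence "norm x ^ i \<le> norm x ^ (?n - 1)" using x1 by (intro power_increasing) auto
      thus "norm (coeff p i * x ^ i) \<le> norm (coeff p i) * norm x ^ (?n - 1)"
        by (simp add: norm_mult norm_power mult_left_mono)
    qed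
    also have "\<dots> = B * norm x ^ (?n - 1)" by (simp add: B_def sum_distrib_right)
    also have "\<dots> \<le> (?a / 2 * norm x) * norm x ^ (?n - 1)"
      using x2 a by (intro mult_right_mono) (auto simp: field_simps)
    also have "\<dots> = ?a / 2 * norm x ^ ?n" using False by (cases ?n) auto
    finally show ?thesis .
  qed simp
  have big: "norm (lead_coeff p * x ^ ?n) = ?a * norm x ^ ?n" for x by (simp add: norm_mult norm_power)
  show ?thesis
  proof (rule that[of "?a / 2" "2 * ?a" R])
    show "R \<ge> 1" by (simp add: R_def)
    fix x :: complex assume x: "norm x \<ge> R"
    show "?a / 2 * norm x ^ ?n \<le> norm (poly p x)"
      unfolding eq using norm_diff_ineq[of "lead_coeff p * x ^ ?n" "\<Sum>i<?n. coeff p i * x ^ i"] small[OF x] big[of x]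
      by (simp add: add.commute)
    have "norm (poly p x) \<le> ?a / 2 * norm x ^ ?n + ?a * norm x ^ ?n"
      unfolding eq using norm_triangle_ineq[of "\<Sum>i<?n. coeff p i * x ^ i" "lead_coeff p * x ^ ?n"] small[OF x] big[of x] by linarith
    also have "\<dots> \<le> 2 * ?a * norm x ^ ?n" using mult_nonneg_nonneg[of ?a "norm x ^ ?n"] by (simp add: algebra_simps)
    finally show "norm (poly p x) \<le> 2 * ?a * norm x ^ ?n" .
  qed (use a in auto)
qed

lemma expanding_tri:
  assumes "a \<noteq> 0" "c \<noteq> 0" and n: "degree p \<ge> 2"
  shows "expanding (degree p) (prod.swap \<circ> tri a b c p)"
proof -
  let ?n = "degree p"
  have "p \<noteq> 0" using n by auto
  obtain R K1 K2 where K: "0 < K1" "0 < K2" "1 \<le> R"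
    "\<And>x. norm x \<ge> R \<Longrightarrow> K1 * norm x ^ ?n \<le> norm (poly p x)"
    "\<And>x::complex. norm x \<ge> R \<Longrightarrow> norm (poly p x) \<le> K2 * norm x ^ ?n"
    using poly_growth[of p] \<open>p \<noteq> 0\<close> by metis
  define M where "M = norm a + norm b + norm c + 2"
  have M: "M \<ge> 2" by (simp add: M_def)
  \<comment> \<open>Beyond this radius \<open>K1 / 2 * norm x ^ degree p\<close> is at least \<open>M * norm x\<close>, which bounds the linear terms of the map and \<open>2 * norm x\<close>.\<close>
  define R' where "R' = max R (2 * M / K1)"
  let ?C = "\<bar>ln (K1 / 2)\<bar> + \<bar>ln (K2 + M)\<bar> + (real ?n + 1) * ln 2"
  show ?thesis unfolding expanding_def
  proof (rule exI[of _ R'], rule exI[of _ ?C], intro conjI ballI)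
    show "1 \<le> R'" using K by (simp add: R'_def)
    fix z assume z: "z \<in> cone R'"
    obtain x y where xy: "z = (x, y)" by force
    let ?g = "(prod.swap \<circ> tri a b c p) z"
    have g: "fst ?g = c * y + poly p x" "snd ?g = a * x + b" by (auto simp: xy tri_def)
    have yx: "norm y \<le> norm x" and xR: "norm x \<ge> R" and xM: "2 * M / K1 \<le> norm x" and x1: "norm x \<ge> 1"
      using z K by (auto simp: cone_def xy R'_def)
    have MM: "M * norm x \<le> K1 / 2 * norm x ^ ?n"
    proof -
      have "M * norm x \<le> (K1 / 2 * norm x) * norm x" using xM K(1) by (intro mult_right_mono) (auto simp: field_simps)
      also have "\<dots> = K1 / 2 * norm x ^ 2" by (simp add: power2_eq_square)
      also have "\<dots> \<le> K1 / 2 * norm x ^ ?n" using K x1 n by (intro mult_left_mono power_increasing) auto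
      finally show ?thesis .
    qed
    have cy: "norm (c * y) \<le> norm c * norm x" unfolding norm_mult by (intro mult_left_mono yx) auto
    have cM: "norm c * norm x \<le> M * norm x" by (intro mult_right_mono) (auto simp: M_def)
    have lo: "K1 / 2 * norm x ^ ?n \<le> norm (fst ?g)"
      using norm_diff_ineq[of "poly p x" "c * y"] K(4)[OF xR] cy cM MM unfolding g by (simp add: add.commute)
    have "norm x ^ 1 \<le> norm x ^ ?n" using x1 n by (intro power_increasing) auto
    hence "M * norm x \<le> M * norm x ^ ?n" using M by (intro mult_left_mono) auto
    hence hi: "norm (fst ?g) \<le> (K2 + M) * norm x ^ ?n"
      using norm_triangle_ineq[of "c * y" "poly p x"] K(5)[OF xR] cy cM unfolding g by (simp add: algebra_simps)
    have "norm (snd ?g) \<le> norm a * norm x + norm b" unfolding g using norm_triangle_ineq[of "a * x" b] by (simp add: norm_mult)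
    also have "\<dots> \<le> norm a * norm x + norm b * norm x" using x1 by (simp add: mult_le_cancel_left1)
    also have "\<dots> \<le> M * norm x" using x1 unfolding M_def by (simp add: algebra_simps)
    finally have sg: "norm (snd ?g) \<le> M * norm x" .
    show 1: "norm (snd ?g) \<le> norm (fst ?g)" using sg MM lo by linarith
    have "2 * norm x \<le> M * norm x" using M by (intro mult_right_mono) auto
    thus 2: "2 * norm (fst z) \<le> norm (fst ?g)" using MM lo by (simp add: xy)
    have w: "z \<in> cone 1" "?g \<in> cone 1" using 1 2 x1 yx by (auto simp: cone_def xy)
    show "\<bar>log_norm ?g - real ?n * log_norm z\<bar> \<le> ?C"
      by (rule log_norm_power_bounds[OF w]) (use K lo hi in \<open>auto simp: xy\<close>)
  qed
qed

lemma poly_fun_bound: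
  assumes "poly_fun_deg_le n p" obtains K where "K \<ge> 0" "\<And>z. norm (p z) \<le> K * max 1 (norm z) ^ n"
proof -
  obtain a where a: "\<And>z w. p (z, w) = (\<Sum>i\<le>n. \<Sum>j\<le>n - i. a i j * z ^ i * w ^ j)"
    using assms by (auto simp: poly_fun_deg_le_def)
  define K where "K = (\<Sum>i\<le>n. \<Sum>j\<le>n - i. norm (a i j))"
  have "norm (p x) \<le> K * max 1 (norm x) ^ n" for x
  proof -
    obtain z w where x: "x = (z, w)" by force
    let ?m = "max 1 (norm x)"
    have zw: "norm z \<le> ?m" "norm w \<le> ?m" using norm_fst_le[of z w] norm_snd_le[of w z] by (auto simp: x)
    have "norm (p x) \<le> (\<Sum>i\<le>n. \<Sum>j\<le>n - i. norm (a i j) * ?m ^ n)"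
      unfolding x a
    proof (intro sum_norm_le)
      fix i j assume ij: "i \<in> {..n}" "j \<in> {..n - i}"
      have "norm z ^ i * norm w ^ j \<le> ?m ^ i * ?m ^ j"
        using zw by (intro mult_mono power_mono) (auto simp: x)
      also have "\<dots> = ?m ^ (i + j)" by (simp add: power_add)
      also have "\<dots> \<le> ?m ^ n" using ij by (intro power_increasing) auto
      finally have "norm (a i j) * (norm z ^ i * norm w ^ j) \<le> norm (a i j) * ?m ^ n" by (intro mult_left_mono) auto
      thus "norm (a i j * z ^ i * w ^ j) \<le> norm (a i j) * max 1 (norm (z, w)) ^ n"
        by (simp add: norm_mult norm_power mult.assoc x)
    qed
    thus ?thesis by (simp add: K_def sum_distrib_right)
  qed
  moreover have "K \<ge> 0" unfolding K_def by (intro sum_nonneg) auto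
  ultimately show ?thesis using that by blast
qed

lemma poly_map_log_norm:
  assumes "poly_map_deg_le n g" obtains C where "C \<ge> 0" "\<And>z. log_norm (g z) \<le> real n * log_norm z + C"
proof -
  obtain K1 where K1: "K1 \<ge> 0" "\<And>z. norm (fst (g z)) \<le> K1 * max 1 (norm z) ^ n"
    using poly_fun_bound[of n "\<lambda>x. fst (g x)"] assms by (auto simp: poly_map_deg_le_def)
  obtain K2 where K2: "K2 \<ge> 0" "\<And>z. norm (snd (g z)) \<le> K2 * max 1 (norm z) ^ n"
    using poly_fun_bound[of n "\<lambda>x. snd (g x)"] assms by (auto simp: poly_map_deg_le_def)
  let ?K = "1 + K1 + K2"
  have "log_norm (g z) \<le> real n * log_norm z + ln ?K" for z
  proof -
    let ?m = "max 1 (norm z)"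
    have m: "1 \<le> ?m ^ n" by simp
    have "norm (g z) \<le> K1 * ?m ^ n + K2 * ?m ^ n"
      using norm_Pair_le[of "fst (g z)" "snd (g z)"] K1(2)[of z] K2(2)[of z] by simp
    moreover have "0 \<le> K1 * ?m ^ n" "0 \<le> K2 * ?m ^ n" using m K1 K2 by auto
    ultimately have "max 1 (norm (g z)) \<le> ?m ^ n + K1 * ?m ^ n + K2 * ?m ^ n" using m by linarith
    hence "max 1 (norm (g z)) \<le> ?K * ?m ^ n" by (simp only: distrib_right mult_1)
    hence "log_norm (g z) \<le> ln (?K * ?m ^ n)" unfolding log_norm_def using K1 K2 by (subst ln_le_cancel_iff) auto
    also have "\<dots> = ln ?K + n * ln ?m" using K1 K2 by (subst ln_mult) (auto simp: ln_realpow)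
    finally show ?thesis by (simp add: log_norm_def)
  qed
  moreover have "ln ?K \<ge> 0" using K1 K2 by simp
  ultimately show ?thesis using that by blast
qed

section \<open>Growth of iterates and the dynamical degree\<close>

text \<open>The properties of compositions of generalized Henon maps used below. The last one is expansion of
the inverse on the cone \<open>\<bar>x\<bar> \<le> \<bar>y\<bar>\<close>, written with the coordinates
swapped.\<close>

definition henon_type :: "nat \<Rightarrow> (C2 \<Rightarrow> C2) \<Rightarrow> bool" where
  "henon_type D g \<longleftrightarrow> polynomial_diffeo g \<and> poly_map_deg_le D g \<and> expanding (real D) g \<and>
     (\<exists>D'. expanding D' (prod.swap \<circ> inv g \<circ> prod.swap))"

lemma expanding_Nonlin: "T \<in> Nonlin \<Longrightarrow> \<exists>n\<ge>2. expanding (real n) (prod.swap \<circ> T) \<and> poly_map_deg_le n T"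
proof -
  assume "T \<in> Nonlin"
  then obtain a b c p where T: "T = tri a b c p" "a \<noteq> 0" "c \<noteq> 0" "2 \<le> degree p" unfolding Nonlin_def by blast
  have "poly_map_deg_le (degree p) T" unfolding T(1)
    by (rule poly_map_mono[OF poly_map_tri]) (use T in simp)
  with T expanding_tri[OF T(2-4), of b] show ?thesis by blast
qed

lemma polynomial_diffeo_bij: "polynomial_diffeo g \<Longrightarrow> bij g" by (simp add: polynomial_diffeo_def)

lemma henon_type_Nonlin:
  assumes "T \<in> Nonlin" shows "\<exists>D. henon_type D (prod.swap \<circ> T)"
proof -
  obtain n where n: "expanding (real n) (prod.swap \<circ> T)" "poly_map_deg_le n T" using expanding_Nonlin[OF assms] by blast
  obtain m where m: "expanding (real m) (prod.swap \<circ> inv T)" using expanding_Nonlin[OF Nonlin_inv[OF assms]] by blast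
  have T: "T \<in> Triang" using assms Nonlin_Triang by auto
  have "inv (prod.swap \<circ> T) = inv T \<circ> prod.swap"
    using o_inv_distrib[OF polynomial_diffeo_bij[OF polynomial_diffeo_swap] Triang_bij[OF T]] by (simp only: inv_swap)
  hence "prod.swap \<circ> inv (prod.swap \<circ> T) \<circ> prod.swap = prod.swap \<circ> inv T \<circ> (prod.swap \<circ> prod.swap)"
    by (simp only: o_assoc)
  hence "prod.swap \<circ> inv (prod.swap \<circ> T) \<circ> prod.swap = prod.swap \<circ> inv T"
    by (simp only: swap_swap comp_id)
  hence "expanding (real m) (prod.swap \<circ> inv (prod.swap \<circ> T) \<circ> prod.swap)" using m by (simp only:)
  moreover have "poly_map_deg_le n (prod.swap \<circ> T)" using poly_map_comp[OF poly_map_swap n(2)] by (simp only: mult_1)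
  ultimately show ?thesis unfolding henon_type_def
    using n(1) polynomial_diffeo_comp[OF polynomial_diffeo_swap polynomial_diffeo_Triang[OF T]] by blast
qed

lemma henon_type_comp:
  assumes "henon_type D g" "henon_type D' g'" shows "henon_type (D * D') (g \<circ> g')"
proof -
  obtain E E' where E: "expanding E (prod.swap \<circ> inv g \<circ> prod.swap)" "expanding E' (prod.swap \<circ> inv g' \<circ> prod.swap)"
    using assms unfolding henon_type_def by blast
  have pd: "polynomial_diffeo g" "polynomial_diffeo g'" using assms by (auto simp: henon_type_def)
  have "inv (g \<circ> g') = inv g' \<circ> inv g" by (intro o_inv_distrib polynomial_diffeo_bij pd)
  hence "prod.swap \<circ> inv (g \<circ> g') \<circ> prod.swap = prod.swap \<circ> inv g' \<circ> id \<circ> inv g \<circ> prod.swap"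
    by (simp only: o_assoc comp_id)
  also have "\<dots> = (prod.swap \<circ> inv g' \<circ> prod.swap) \<circ> (prod.swap \<circ> inv g \<circ> prod.swap)"
    by (simp only: swap_swap[symmetric] o_assoc)
  finally have "expanding (E' * E) (prod.swap \<circ> inv (g \<circ> g') \<circ> prod.swap)"
    using expanding_comp[OF E(2,1)] by (simp only:)
  moreover have "expanding (real (D * D')) (g \<circ> g')" using expanding_comp assms unfolding henon_type_def of_nat_mult by blast
  ultimately show ?thesis unfolding henon_type_def
    using assms polynomial_diffeo_comp[OF pd] poly_map_comp[of D g D' g'] unfolding henon_type_def by blast
qed

lemma henon_type_henon_word: "Ts \<noteq> [] \<Longrightarrow> set Ts \<subseteq> Nonlin \<Longrightarrow> \<exists>D. henon_type D (henon_word Ts)"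
proof (induction Ts rule: list_nonempty_induct)
  case (single T)
  hence "T \<in> Nonlin" by simp
  thus ?case using henon_type_Nonlin[of T] by (simp only: henon_word.simps comp_id)
next
  case (cons T Ts)
  then obtain D D' where "henon_type D (prod.swap \<circ> T)" "henon_type D' (henon_word Ts)" using henon_type_Nonlin[of T] by auto
  from henon_type_comp[OF this] show ?case unfolding henon_word.simps by blast
qed

text \<open>On the cone near infinity \<open>g\<close> multiplies \<open>L\<close> by \<open>e\<close> up to a
bounded error; unlike for \<open>expanding\<close>, the image need not lie in the cone.\<close>

definition growing :: "real \<Rightarrow> (C2 \<Rightarrow> C2) \<Rightarrow> bool" where
  "growing e g \<longleftrightarrow> (\<exists>R C. R \<ge> 1 \<and> (\<forall>z\<in>cone R. \<bar>log_norm (g z) - e * log_norm z\<bar> \<le> C))"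

lemma expanding_growing: "expanding D g \<Longrightarrow> growing D g"
  unfolding growing_def expanding_def by blast

lemma growing_expanding_comp:
  assumes "growing e g" "expanding D h" shows "growing (e * D) (g \<circ> h)"
proof -
  obtain R C where R: "R \<ge> 1" "\<And>z. z \<in> cone R \<Longrightarrow> \<bar>log_norm (g z) - e * log_norm z\<bar> \<le> C"
    using assms(1) unfolding growing_def by blast
  obtain R' C' where R': "R' \<ge> 1" "\<And>z. z \<in> cone R' \<Longrightarrow> norm (snd (h z)) \<le> norm (fst (h z)) \<and>
      2 * norm (fst z) \<le> norm (fst (h z)) \<and> \<bar>log_norm (h z) - D * log_norm z\<bar> \<le> C'"
    using assms(2) unfolding expanding_def by blast
  have "\<bar>log_norm ((g \<circ> h) z) - e * D * log_norm z\<bar> \<le> C + \<bar>e\<bar> * C'" if z: "z \<in> cone (max R R')" for z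
  proof -
    have z': "z \<in> cone R'" using z by (auto simp: cone_def)
    note h = R'(2)[OF z']
    have "h z \<in> cone R" using h z R by (auto simp: cone_def)
    note g = R(2)[OF this]
    have "e * log_norm (h z) - e * D * log_norm z = e * (log_norm (h z) - D * log_norm z)" by (simp add: algebra_simps)
    moreover have "\<bar>e * (log_norm (h z) - D * log_norm z)\<bar> \<le> \<bar>e\<bar> * C'" unfolding abs_mult using h by (intro mult_left_mono) auto
    ultimately show ?thesis using g by (simp only: comp_apply)
  qed
  thus ?thesis unfolding growing_def using R(1) by (meson max.cobounded1 order_trans)
qed

lemma growing_Triang:
  assumes "T \<in> Triang" shows "\<exists>e\<ge>1. growing e T"
proof (cases "T \<in> Nonlin")
  case True
  then obtain n where n: "n \<ge> 2" "expanding (real n) (prod.swap \<circ> T)" using expanding_Nonlin by blast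
  have "log_norm ((prod.swap \<circ> T) z) = log_norm (T z)" for z by (simp only: comp_apply log_norm_swap)
  hence "growing (real n) T" using expanding_growing[OF n(2)] unfolding growing_def by (simp only:)
  thus ?thesis using n(1) by (intro exI[of _ "real n"]) auto
next
  case False
  hence "T \<in> Affin" using assms Triang_split by auto
  then obtain a b c p where T: "T = tri a b c p" "a \<noteq> 0" "c \<noteq> 0" "degree p \<le> 1" unfolding Affin_def by blast
  have 1: "poly_map_deg_le 1 T" unfolding T(1) by (rule poly_map_mono[OF poly_map_tri]) (use T in simp)
  have 2: "poly_map_deg_le 1 (inv T)" unfolding T(1) inv_tri(2)[OF T(2,3)]
    by (rule poly_map_mono[OF poly_map_tri]) (use T tri_inverse(3)[OF T(2,3), of p b] in simp)
  obtain C1 where C1: "\<And>z. log_norm (T z) \<le> real 1 * log_norm z + C1" using poly_map_log_norm[OF 1] by blast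
  obtain C2 where C2: "\<And>z. log_norm (inv T z) \<le> real 1 * log_norm z + C2" using poly_map_log_norm[OF 2] by blast
  have "\<bar>log_norm (T z) - 1 * log_norm z\<bar> \<le> max C1 C2" for z
    using C1[of z] C2[of "T z"] Triang_bij[OF assms] by (simp add: bij_is_inj)
  hence "growing 1 T" unfolding growing_def by (meson order_refl)
  thus ?thesis by blast
qed

lemma growing_reduced:
  assumes "T \<in> Triang" "set Qs \<subseteq> Nonlin" shows "\<exists>e\<ge>1. growing e (T \<circ> henon_word Qs)"
proof (cases "Qs = []")
  case True
  thus ?thesis using growing_Triang[OF assms(1)] by (simp only: henon_word.simps comp_id)
next
  case False
  obtain e where e: "e \<ge> 1" "growing e T" using growing_Triang[OF assms(1)] by blast
  have "Qs \<noteq> [] \<Longrightarrow> set Qs \<subseteq> Nonlin \<Longrightarrow> \<exists>n\<ge>1. expanding n (henon_word Qs)"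
  proof (induction Qs rule: list_nonempty_induct)
    case (single T)
    then obtain n where "n \<ge> 2" "expanding (real n) (prod.swap \<circ> T)" using expanding_Nonlin[of T] by auto
    thus ?case by (intro exI[of _ "real n"]) (simp only: henon_word.simps comp_id, simp)
  next
    case (cons T Ts)
    then obtain n where n: "n \<ge> 2" "expanding (real n) (prod.swap \<circ> T)" using expanding_Nonlin[of T] by auto
    obtain m where m: "m \<ge> 1" "expanding m (henon_word Ts)" using cons by auto
    have "1 * 1 \<le> real n * m" using n m by (intro mult_mono) auto
    thus ?case using expanding_comp[OF n(2) m(2)] by (intro exI[of _ "real n * m"]) (simp only: henon_word.simps, simp)
  qed
  then obtain m where m: "m \<ge> 1" "expanding m (henon_word Qs)" using False assms(2) by blast
  have "1 * 1 \<le> e * m" using e m by (intro mult_mono) auto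
  thus ?thesis using growing_expanding_comp[OF e(2) m(2)] by auto
qed

lemma expanding_escape:
  assumes "R \<ge> 1" "\<And>z. z \<in> cone R \<Longrightarrow> norm (snd (g z)) \<le> norm (fst (g z)) \<and> 2 * norm (fst z) \<le> norm (fst (g z))"
    "z \<in> cone R"
  shows "(g ^^ n) z \<in> cone R \<and> 2 ^ n \<le> norm (fst ((g ^^ n) z))"
proof (induction n)
  case 0
  show ?case using assms(1,3) by (auto simp: cone_def)
next
  case (Suc n)
  hence w: "(g ^^ n) z \<in> cone R" and b: "2 ^ n \<le> norm (fst ((g ^^ n) z))" by auto
  have "(g ^^ Suc n) z \<in> cone R" using assms(2)[OF w] w assms(1) by (auto simp: cone_def)
  moreover have "2 ^ Suc n \<le> norm (fst ((g ^^ Suc n) z))" using assms(2)[OF w] b by simp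
  ultimately show ?case by blast
qed

text \<open>On the cone \<open>\<bar>x\<bar> \<le> \<bar>y\<bar>\<close> near infinity backward orbits escape,
so this region does not meet \<open>K\<^sup>-\<close>.\<close>

lemma K_minus_not_tall:
  assumes "henon_type D h"
  obtains R where "R \<ge> 1" "\<And>z. z \<in> K_minus h \<Longrightarrow> prod.swap z \<notin> cone R"
proof -
  let ?k = "prod.swap \<circ> inv h \<circ> prod.swap"
  obtain D' where "expanding D' ?k" using assms by (auto simp: henon_type_def)
  then obtain R where R: "R \<ge> 1" "\<And>z. z \<in> cone R \<Longrightarrow> norm (snd (?k z)) \<le> norm (fst (?k z)) \<and> 2 * norm (fst z) \<le> norm (fst (?k z))"
    unfolding expanding_def by blast
  have kn: "(?k ^^ n) (prod.swap z) = prod.swap ((inv h ^^ n) z)" for n z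
    by (induction n) auto
  have "prod.swap z \<notin> cone R" if "z \<in> K_minus h" for z
  proof
    assume w: "prod.swap z \<in> cone R"
    have "bounded (range (\<lambda>n. (inv h ^^ n) z))" using that by (simp add: K_minus_def K_plus_def)
    then obtain B where B: "\<And>n. norm ((inv h ^^ n) z) \<le> B" unfolding bounded_iff by auto
    obtain n :: nat where n: "B < 2 ^ n" using real_arch_pow[of 2 B] by auto
    have "2 ^ n \<le> norm (fst ((?k ^^ n) (prod.swap z)))" using expanding_escape[OF R w, of n] by blast
    also have "\<dots> = norm (snd ((inv h ^^ n) z))" unfolding kn by simp
    also have "\<dots> \<le> norm ((inv h ^^ n) z)" by (metis norm_snd_le prod.collapse)
    also have "\<dots> \<le> B" by (rule B)
    finally show False using n by simp
  qed
  thus ?thesis using that R(1) by blast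
qed

text \<open>By the previous lemma a point of \<open>K\<^sup>-\<close> is in the cone \<open>\<bar>y\<bar>
\<le> \<bar>x\<bar>\<close> near infinity or in a bounded set.\<close>

lemma growing_on_K_minus:
  assumes h: "henon_type D h" and g: "growing e g" "poly_map_deg_le N g"
  obtains C where "C \<ge> 0" "\<And>z. z \<in> K_minus h \<Longrightarrow> \<bar>log_norm (g z) - e * log_norm z\<bar> \<le> C"
proof -
  obtain R where R: "R \<ge> 1" "\<And>z. z \<in> K_minus h \<Longrightarrow> prod.swap z \<notin> cone R" using K_minus_not_tall[OF h] by blast
  obtain R' C where R': "R' \<ge> 1" "\<And>z. z \<in> cone R' \<Longrightarrow> \<bar>log_norm (g z) - e * log_norm z\<bar> \<le> C" using g(1) unfolding growing_def by blast
  obtain C' where C': "C' \<ge> 0" "\<And>z. log_norm (g z) \<le> real N * log_norm z + C'" using poly_map_log_norm[OF g(2)] by blast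
  define M where "M = ln (2 * max R R')"
  define B where "B = \<bar>C\<bar> + C' + (real N + \<bar>e\<bar>) * M"
  have M: "M \<ge> 0" using R by (simp add: M_def)
  hence NM: "(real N + \<bar>e\<bar>) * M \<ge> 0" by simp
  have "\<bar>log_norm (g z) - e * log_norm z\<bar> \<le> B" if z: "z \<in> K_minus h" for z
  proof (cases "z \<in> cone R'")
    case True
    from R'(2)[OF this] NM C'(1) show ?thesis unfolding B_def by linarith
  next
    case False
    have "norm (fst z) \<le> max R R' \<and> norm (snd z) \<le> max R R'"
      using False R(2)[OF z] unfolding cone_def by (cases "norm (snd z) \<le> norm (fst z)") auto
    hence "norm z \<le> 2 * max R R'" using norm_Pair_le[of "fst z" "snd z"] by simp
    hence "log_norm z \<le> M" unfolding log_norm_def M_def using R by (intro ln_mono) auto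
    hence le: "real N * log_norm z \<le> real N * M" "\<bar>e\<bar> * log_norm z \<le> \<bar>e\<bar> * M" by (auto intro!: mult_left_mono)
    have "\<bar>e * log_norm z\<bar> \<le> \<bar>e\<bar> * M" using le(2) by (simp add: abs_mult log_norm_nonneg)
    thus ?thesis using C'(2)[of z] log_norm_nonneg[of "g z"] le(1) M unfolding B_def by (simp add: algebra_simps) 
  qed
  moreover have "B \<ge> 0" using NM C'(1) unfolding B_def by linarith
  ultimately show ?thesis using that by blast
qed

lemma K_minus_invariant:
  assumes "bij h" "z \<in> K_minus h" shows "h z \<in> K_minus h"
proof -
  have "range (\<lambda>n. (inv h ^^ n) (h z)) \<subseteq> insert (h z) (range (\<lambda>n. (inv h ^^ n) z))"
  proof (rule image_subsetI)
    fix n show "(inv h ^^ n) (h z) \<in> insert (h z) (range (\<lambda>n. (inv h ^^ n) z))"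
      using assms(1) by (cases n) (auto simp: funpow_swap1 bij_is_inj)
  qed
  moreover have "bounded (insert (h z) (range (\<lambda>n. (inv h ^^ n) z)))"
    using assms(2) by (simp add: K_minus_def K_plus_def)
  ultimately show ?thesis unfolding K_minus_def K_plus_def mem_Collect_eq by (rule bounded_subset[rotated])
qed

lemma K_minus_conj:
  assumes "f \<circ> \<phi> = \<phi> \<circ> h" "polynomial_diffeo \<phi>" "bij f" "bij h" "x \<in> K_minus f"
  shows "inv \<phi> x \<in> K_minus h"
proof -
  have b: "bij \<phi>" using assms(2) by (rule polynomial_diffeo_bij)
  have f\<phi>: "f (\<phi> y) = \<phi> (h y)" for y using assms(1) by (metis comp_apply)
  have "inv h (inv \<phi> y) = inv \<phi> (inv f y)" for y
  proof -
    have "\<phi> (h (inv \<phi> (inv f y))) = y"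
      unfolding f\<phi>[symmetric] using b assms(3) by (simp add: bij_is_surj surj_f_inv_f)
    thus ?thesis using b assms(4) by (metis bij_inv_eq_iff)
  qed
  hence n: "(inv h ^^ n) (inv \<phi> x) = inv \<phi> ((inv f ^^ n) x)" for n by (induction n) auto
  have "bounded (range (\<lambda>n. (inv f ^^ n) x))" using assms(5) by (simp add: K_minus_def K_plus_def)
  hence "compact (closure (range (\<lambda>n. (inv f ^^ n) x)))" by (simp add: compact_closure)
  moreover have "continuous_on (closure (range (\<lambda>n. (inv f ^^ n) x))) (inv \<phi>)"
    using assms(2) by (intro continuous_on_polynomial_map) (simp add: polynomial_diffeo_def)
  ultimately have "compact (inv \<phi> ` closure (range (\<lambda>n. (inv f ^^ n) x)))" by (rule compact_continuous_image[rotated])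
  hence "bounded (inv \<phi> ` closure (range (\<lambda>n. (inv f ^^ n) x)))" by (rule compact_imp_bounded)
  moreover have "range (\<lambda>n. (inv h ^^ n) (inv \<phi> x)) \<subseteq> inv \<phi> ` closure (range (\<lambda>n. (inv f ^^ n) x))"
    unfolding n using closure_subset by fast
  ultimately show ?thesis unfolding K_minus_def K_plus_def by (auto intro: bounded_subset)
qed

lemma map_degree_le: "poly_map_deg_le n f \<Longrightarrow> map_degree f \<le> n"
  unfolding map_degree_def by (rule Least_le)

lemma map_degree_poly: "polynomial_map f \<Longrightarrow> poly_map_deg_le (map_degree f) f"
  unfolding map_degree_def polynomial_map_def by (auto intro: LeastI_ex)

lemma dynamical_degree_upper:
  assumes "has_dynamical_degree f d" "\<And>n. map_degree (f ^^ n) \<le> K * D ^ n" "K > 0"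
  shows "d \<le> real D"
proof -
  have "(\<lambda>n. root n (real K) * real D) \<longlonglongrightarrow> 1 * real D"
    by (intro tendsto_mult LIMSEQ_root_const tendsto_const) (use assms(3) in simp)
  moreover have "(\<lambda>n. root n (real (map_degree (f ^^ n)))) \<longlonglongrightarrow> d" using assms(1) by (simp add: has_dynamical_degree_def)
  moreover have "root n (real (map_degree (f ^^ n))) \<le> root n (real K) * real D" if "n \<ge> 1" for n
  proof -
    have "real (map_degree (f ^^ n)) \<le> real K * real D ^ n"
      using assms(2)[of n] by (metis of_nat_le_iff of_nat_mult of_nat_power)
    hence "root n (real (map_degree (f ^^ n))) \<le> root n (real K * real D ^ n)" using that by simp
    also have "\<dots> = root n (real K) * real D" using that by (simp add: real_root_mult real_root_power_cancel)
    finally show ?thesis .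
  qed
  ultimately show ?thesis by (auto intro: LIMSEQ_le)
qed

lemma expanding_funpow: "expanding D g \<Longrightarrow> n \<ge> 1 \<Longrightarrow> expanding (D ^ n) (g ^^ n)"
proof (induction n)
  case (Suc n)
  show ?case
  proof (cases "n = 0")
    case False
    hence "expanding (D * D ^ n) (g \<circ> g ^^ n)" using Suc by (intro expanding_comp) auto
    thus ?thesis by (simp only: power_Suc funpow.simps)
  qed (use Suc in simp)
qed simp

text \<open>Compare the growth of \<open>f\<^sup>n\<close> along the image under \<open>\<phi>\<close> of the
positive \<open>x\<close>-axis with the growth allowed by its degree.\<close>

lemma degree_lower_bound:
  assumes conj: "f \<circ> \<phi> = \<phi> \<circ> h" and \<phi>: "growing e \<phi>" "e \<ge> 1" and h: "expanding (real D) h"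
    and N: "poly_map_deg_le N (f ^^ n)" and n: "n \<ge> 1"
  shows "D ^ n \<le> N"
proof -
  have "growing (e * real D ^ n) (\<phi> \<circ> (h ^^ n))" by (rule growing_expanding_comp[OF \<phi>(1) expanding_funpow[OF h n]])
  then obtain R1 C1 where 1: "R1 \<ge> 1" "\<And>z. z \<in> cone R1 \<Longrightarrow> \<bar>log_norm (\<phi> ((h ^^ n) z)) - e * real D ^ n * log_norm z\<bar> \<le> C1"
    unfolding growing_def by auto
  obtain R2 C2 where 2: "R2 \<ge> 1" "\<And>z. z \<in> cone R2 \<Longrightarrow> \<bar>log_norm (\<phi> z) - e * log_norm z\<bar> \<le> C2"
    using \<phi>(1) unfolding growing_def by auto
  obtain C3 where 3: "\<And>z. log_norm ((f ^^ n) z) \<le> real N * log_norm z + C3" using poly_map_log_norm[OF N] by blast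
  have eq: "(f ^^ n) (\<phi> z) = \<phi> ((h ^^ n) z)" for z using conj_funpow[OF conj, of n] by (metis comp_apply)
  define C where "C = C1 + C3 + real N * C2"
  have key: "(e * (real D ^ n - real N)) * ln r \<le> C" if r: "r \<ge> max R1 R2" for r
  proof -
    let ?z = "(complex_of_real r, 0 :: complex)"
    have r1: "r \<ge> 1" using r 1(1) by simp
    have w: "?z \<in> cone R1" "?z \<in> cone R2" using r r1 by (auto simp: cone_def)
    have lz: "log_norm ?z = ln r" using r1 by (simp add: log_norm_def norm_Pair)
    have "real N * log_norm (\<phi> ?z) \<le> real N * (e * ln r + C2)" using 2(2)[OF w(2)] lz by (intro mult_left_mono) auto
    moreover have "log_norm (\<phi> ((h ^^ n) ?z)) \<le> real N * log_norm (\<phi> ?z) + C3" using 3[of "\<phi> ?z"] eq by simp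
    ultimately show ?thesis using 1(2)[OF w(1)] unfolding lz C_def by (simp add: algebra_simps abs_le_iff)
  qed
  show ?thesis
  proof (rule ccontr)
    assume "\<not> ?thesis"
    hence "real N + 1 \<le> real (D ^ n)" by linarith
    hence ge: "real D ^ n - real N \<ge> 1" by simp
    define r where "r = max (max R1 R2) (exp (\<bar>C\<bar> + 1))"
    have "ln (exp (\<bar>C\<bar> + 1)) \<le> ln r" unfolding r_def by (intro ln_mono) auto
    hence lr: "\<bar>C\<bar> + 1 \<le> ln r" by simp
    have "1 * 1 \<le> e * (real D ^ n - real N)" using \<phi>(2) ge by (intro mult_mono) auto
    hence "1 * ln r \<le> e * (real D ^ n - real N) * ln r" using lr by (intro mult_right_mono) auto
    also have "\<dots> \<le> C" by (rule key) (simp add: r_def)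
    finally show False using lr by simp
  qed
qed

text \<open>On \<open>K\<^sup>-\<close> the map \<open>f\<close> multiplies \<open>log\<^sup>+
\<parallel>x\<parallel>\<close> by \<open>d\<close> up to a bounded error; the estimate passes to the closure
by continuity.\<close>

theorem log_norm_forward_estimate:
  assumes f: "polynomial_diffeo f" and dd: "has_dynamical_degree f d" and d: "d > 1"
  obtains C where "C \<ge> 0" "\<And>x. x \<in> closure (K_minus f) \<Longrightarrow> \<bar>log_norm (f x) - d * log_norm x\<bar> \<le> C"
proof -
  obtain T Ts where T: "f = T \<circ> henon_word Ts" "T \<in> Triang" "set Ts \<subseteq> Triang" "set (butlast Ts) \<subseteq> Nonlin"
    using reduced_word[OF f] .
  have nb: "\<not> bounded_degree f"
  proof
    assume "bounded_degree f"
    then obtain N where "\<And>n. poly_map_deg_le N (f ^^ n)" unfolding bounded_degree_def by blast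
    hence "map_degree (f ^^ n) \<le> (N + 1) * 1 ^ n" for n using map_degree_le[of N "f ^^ n"] by simp
    from dynamical_degree_upper[OF dd this] d show False by simp
  qed
  obtain Qs Rs where Q: "set Qs \<subseteq> Nonlin" and R: "set Rs \<subseteq> Nonlin" "Rs \<noteq> []"
    and conj: "f \<circ> (T \<circ> henon_word Qs) = (T \<circ> henon_word Qs) \<circ> henon_word Rs"
    using conjugate_to_reduced[OF T(2-4,1)] nb by blast
  define \<phi> where "\<phi> = T \<circ> henon_word Qs"
  define h where "h = henon_word Rs"
  have conj: "f \<circ> \<phi> = \<phi> \<circ> h" using conj by (simp only: \<phi>_def h_def)
  have \<phi>: "polynomial_diffeo \<phi>" unfolding \<phi>_def
    by (intro polynomial_diffeo_comp[OF polynomial_diffeo_Triang polynomial_diffeo_henon_word] T) (use Q Nonlin_Triang in auto)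
  obtain e where e: "e \<ge> 1" "growing e \<phi>" using growing_reduced[OF T(2) Q] unfolding \<phi>_def by blast
  obtain D where D: "henon_type D h" using henon_type_henon_word[OF R(2,1)] unfolding h_def by blast
  have h: "polynomial_diffeo h" "expanding (real D) h" "poly_map_deg_le D h" using D by (auto simp: henon_type_def)
  have bf: "bij f" and bh: "bij h" and b\<phi>: "bij \<phi>" using f h(1) \<phi> by (auto simp: polynomial_diffeo_def)
  have dD: "d = real D"
  proof (rule antisym)
    obtain K where K: "K > 0" "\<And>n N. poly_map_deg_le N (h ^^ n) \<Longrightarrow> poly_map_deg_le (K * N) (f ^^ n)"
      using poly_map_deg_le_conj[OF conj \<phi>] by blast
    have "poly_map_deg_le (D ^ n) (h ^^ n)" for n
    proof (induction n)
      case 0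
      show ?case using poly_fun_fst poly_fun_snd by (simp add: poly_map_deg_le_def)
    next
      case (Suc n)
      show ?case using poly_map_comp[OF h(3) Suc] by (simp only: funpow.simps power_Suc)
    qed
    hence "map_degree (f ^^ n) \<le> K * D ^ n" for n by (intro map_degree_le K(2))
    from dynamical_degree_upper[OF dd this K(1)] show "d \<le> real D" .
  next
    have pf: "polynomial_map (f ^^ n)" for n
    proof (induction n)
      case 0
      show ?case using polynomial_diffeo_id by (simp add: polynomial_diffeo_def id_def)
    next
      case (Suc n)
      thus ?case using f polynomial_map_comp by (simp only: funpow.simps polynomial_diffeo_def)
    qed
    have lower: "D ^ n \<le> map_degree (f ^^ n)" if "n \<ge> 1" for n
      by (rule degree_lower_bound[OF conj e(2,1) h(2) map_degree_poly[OF pf] that])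
    have "(\<lambda>n. root n (real (map_degree (f ^^ n)))) \<longlonglongrightarrow> d" using dd by (simp add: has_dynamical_degree_def)
    moreover have "real D \<le> root n (real (map_degree (f ^^ n)))" if "n \<ge> 1" for n
    proof -
      have "real D ^ n \<le> real (map_degree (f ^^ n))"
        using lower[OF that] by (metis of_nat_le_iff of_nat_power)
      hence "root n (real D ^ n) \<le> root n (real (map_degree (f ^^ n)))" using that by simp
      thus ?thesis using that by (simp add: real_root_power_cancel)
    qed
    ultimately show "real D \<le> d" by (intro LIMSEQ_le_const) auto
  qed
  obtain N where N: "poly_map_deg_le N \<phi>" using \<phi> by (auto simp: polynomial_diffeo_def polynomial_map_def)
  obtain C1 where C1: "C1 \<ge> 0" "\<And>z. z \<in> K_minus h \<Longrightarrow> \<bar>log_norm (\<phi> z) - e * log_norm z\<bar> \<le> C1"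
    using growing_on_K_minus[OF D e(2) N] by blast
  obtain C2 where C2: "C2 \<ge> 0" "\<And>z. z \<in> K_minus h \<Longrightarrow> \<bar>log_norm (h z) - real D * log_norm z\<bar> \<le> C2"
    using growing_on_K_minus[OF D expanding_growing[OF h(2)] h(3)] by blast
  define C where "C = C1 + e * C2 + d * C1"
  have est: "\<bar>log_norm (f x) - d * log_norm x\<bar> \<le> C" if x: "x \<in> K_minus f" for x
  proof -
    define z where "z = inv \<phi> x"
    have z: "z \<in> K_minus h" unfolding z_def by (rule K_minus_conj[OF conj \<phi> bf bh x])
    have xz: "x = \<phi> z" unfolding z_def using b\<phi> by (simp add: bij_is_surj surj_f_inv_f)
    have fx: "f x = \<phi> (h z)" unfolding xz using conj by (metis comp_apply)
    have "\<bar>e * (log_norm (h z) - d * log_norm z)\<bar> \<le> e * C2" unfolding abs_mult dD using C2(2)[OF z] e(1) by (simp add: mult_left_mono)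
    moreover have "\<bar>d * (log_norm (\<phi> z) - e * log_norm z)\<bar> \<le> d * C1" unfolding abs_mult using C1(2)[OF z] d by (simp add: mult_left_mono)
    moreover note C1(2)[OF K_minus_invariant[OF bh z]]
    ultimately have "\<bar>(log_norm (\<phi> (h z)) - e * log_norm (h z)) + e * (log_norm (h z) - d * log_norm z) - d * (log_norm (\<phi> z) - e * log_norm z)\<bar> \<le> C"
      unfolding C_def by linarith
    thus ?thesis unfolding fx by (simp add: xz algebra_simps)
  qed
  have contl: "continuous_on UNIV log_norm" unfolding log_norm_def[abs_def] by (intro continuous_intros) auto
  have contf: "continuous_on UNIV f" using f by (intro continuous_on_polynomial_map) (simp add: polynomial_diffeo_def)
  have "continuous_on UNIV (\<lambda>x. log_norm (f x))" by (rule continuous_on_compose2[OF contl contf]) auto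
  hence "closed {x. \<bar>log_norm (f x) - d * log_norm x\<bar> \<le> C}"
    by (intro closed_Collect_le continuous_intros contl) auto
  hence "closure (K_minus f) \<subseteq> {x. \<bar>log_norm (f x) - d * log_norm x\<bar> \<le> C}"
    by (intro closure_minimal) (use est in auto)
  moreover have "C \<ge> 0" using C1(1) C2(1) e(1) d by (simp add: C_def)
  ultimately show ?thesis using that by blast
qed

section \<open>Injective parametrizations with the same image\<close>

lemma islimpt_Int_open:
  fixes z :: complex
  assumes "z islimpt T" "open U" "z \<in> U" shows "z islimpt (T \<inter> U)"
  using assms unfolding islimpt_def by (metis IntI open_Int Int_iff)

text \<open>Near \<open>B (h z0)\<close> one coordinate \<open>\<pi>\<close> parametrizes the local piece of
the image of \<open>B\<close>, with inverse \<open>k\<close>. If there are points \<open>z\<close>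
accumulating at \<open>z0\<close> whose images \<open>A z = B (h z)\<close> lie on this piece, then by the
identity theorem \<open>A z = B (k (\<pi> (A z)))\<close> for all \<open>z\<close> near \<open>z0\<close>, and
\<open>h = k \<circ> \<pi> \<circ> A\<close> there.\<close>

lemma holomorphic_at_limit_point:
  fixes h :: "complex \<Rightarrow> complex" and \<pi> :: "C2 \<Rightarrow> complex"
  assumes A: "(\<lambda>z. fst (A z)) holomorphic_on UNIV" "(\<lambda>z. snd (A z)) holomorphic_on UNIV"
    and B: "(\<lambda>z. fst (B z)) holomorphic_on UNIV" "(\<lambda>z. snd (B z)) holomorphic_on UNIV"
    and injB: "inj B"
    and h: "\<And>z. B (h z) = A z"
    and \<pi>: "\<pi> = fst \<or> \<pi> = snd"
    and dB: "deriv (\<lambda>z. \<pi> (B z)) (h z0) \<noteq> 0"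
    and lim: "\<And>r. r > 0 \<Longrightarrow> z0 islimpt {z. h z \<in> ball (h z0) r}"
  shows "\<exists>\<epsilon>>0. h holomorphic_on ball z0 \<epsilon>"
proof -
  let ?w = "h z0"
  have \<pi>A: "(\<lambda>z. \<pi> (A z)) holomorphic_on UNIV" and \<pi>B: "(\<lambda>z. \<pi> (B z)) holomorphic_on UNIV"
    using \<pi> A B by auto
  obtain r where r: "r > 0" "open ((\<lambda>z. \<pi> (B z)) ` ball ?w r)" "inj_on (\<lambda>z. \<pi> (B z)) (ball ?w r)"
    using has_complex_derivative_locally_invertible[OF \<pi>B _ open_UNIV dB] by auto
  obtain k where k: "k holomorphic_on ((\<lambda>z. \<pi> (B z)) ` ball ?w r)"
      "\<And>w. w \<in> ball ?w r \<Longrightarrow> deriv (\<lambda>z. \<pi> (B z)) w * deriv k (\<pi> (B w)) = 1"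
      "\<And>w. w \<in> ball ?w r \<Longrightarrow> k (\<pi> (B w)) = w"
    by (rule holomorphic_has_inverse[OF holomorphic_on_subset[OF \<pi>B subset_UNIV] open_ball r(3)], rule that, assumption+)
  let ?V = "(\<lambda>z. \<pi> (B z)) ` ball ?w r"
  have contA: "continuous_on UNIV (\<lambda>z. \<pi> (A z))" using \<pi>A by (rule holomorphic_on_imp_continuous_on)
  have "open ((\<lambda>z. \<pi> (A z)) -` ?V)" using contA r(2) by (simp add: continuous_on_open_vimage)
  moreover have "z0 \<in> (\<lambda>z. \<pi> (A z)) -` ?V" using r(1) h[of z0] by (auto intro!: image_eqI[of _ _ ?w])
  ultimately obtain \<epsilon> where \<epsilon>: "\<epsilon> > 0" "ball z0 \<epsilon> \<subseteq> (\<lambda>z. \<pi> (A z)) -` ?V" by (metis open_contains_ball)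
  have hk: "(\<lambda>z. k (\<pi> (A z))) holomorphic_on ball z0 \<epsilon>"
    using holomorphic_on_compose_gen[OF holomorphic_on_subset[OF \<pi>A, of "ball z0 \<epsilon>"] k(1)] \<epsilon>(2)
    by (auto simp: o_def)
  have eq: "\<rho> (A z) - \<rho> (B (k (\<pi> (A z)))) = 0" if z: "z \<in> ball z0 \<epsilon>" and \<rho>: "\<rho> = fst \<or> \<rho> = snd" for z and \<rho> :: "C2 \<Rightarrow> complex"
  proof (rule analytic_continuation[of "\<lambda>z. \<rho> (A z) - \<rho> (B (k (\<pi> (A z))))" "ball z0 \<epsilon>" "{z. h z \<in> ball ?w r} \<inter> ball z0 \<epsilon>" z0])
    have \<rho>A: "(\<lambda>z. \<rho> (A z)) holomorphic_on UNIV" and \<rho>B: "(\<lambda>z. \<rho> (B z)) holomorphic_on UNIV"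
      using \<rho> A B by auto
    have "(\<lambda>z. \<rho> (B (k (\<pi> (A z))))) holomorphic_on ball z0 \<epsilon>"
      using holomorphic_on_compose_gen[OF hk \<rho>B] by (auto simp: o_def)
    thus "(\<lambda>z. \<rho> (A z) - \<rho> (B (k (\<pi> (A z))))) holomorphic_on ball z0 \<epsilon>"
      by (intro holomorphic_on_diff holomorphic_on_subset[OF \<rho>A]) auto
    show "z0 islimpt {z. h z \<in> ball ?w r} \<inter> ball z0 \<epsilon>"
      using lim[OF r(1)] \<epsilon>(1) by (intro islimpt_Int_open) auto
    fix z assume "z \<in> {z. h z \<in> ball ?w r} \<inter> ball z0 \<epsilon>"
    hence "k (\<pi> (B (h z))) = h z" using k(3) by blast
    thus "\<rho> (A z) - \<rho> (B (k (\<pi> (A z)))) = 0" using h[of z] by simp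
  qed (use \<epsilon> z in auto)
  have "h z = k (\<pi> (A z))" if z: "z \<in> ball z0 \<epsilon>" for z
  proof -
    have "A z = B (k (\<pi> (A z)))" using eq[OF z, of fst] eq[OF z, of snd] by (auto simp: prod_eq_iff)
    thus ?thesis using h[of z] injB by (metis injD)
  qed
  hence "h holomorphic_on ball z0 \<epsilon>" by (intro holomorphic_transform[OF hk]) simp
  thus ?thesis using \<epsilon>(1) by blast
qed

lemma continuous_on_C2:
  assumes "(\<lambda>z. fst (A z)) holomorphic_on S" "(\<lambda>z. snd (A z)) holomorphic_on S"
  shows "continuous_on S (A :: complex \<Rightarrow> C2)"
proof -
  have "continuous_on S (\<lambda>z. (fst (A z), snd (A z)))"
    by (intro continuous_on_Pair holomorphic_on_imp_continuous_on assms)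
  thus ?thesis by simp
qed

text \<open>On a set where \<open>h\<close> is bounded it is continuous, since \<open>B\<close> is a
homeomorphism from a compact disk onto its image.\<close>

lemma holomorphic_at_bounded_limit_point:
  fixes h :: "complex \<Rightarrow> complex"
  assumes A: "(\<lambda>z. fst (A z)) holomorphic_on UNIV" "(\<lambda>z. snd (A z)) holomorphic_on UNIV"
    and B: "injective_holomorphic_immersion B"
    and h: "\<And>z. B (h z) = A z"
    and lim: "z0 islimpt {z. norm (h z) \<le> M}"
  shows "\<exists>\<epsilon>>0. h holomorphic_on ball z0 \<epsilon>"
proof -
  have B': "(\<lambda>z. fst (B z)) holomorphic_on UNIV" "(\<lambda>z. snd (B z)) holomorphic_on UNIV" "inj B"
    and dB: "(deriv (\<lambda>z. fst (B z)) (h z0), deriv (\<lambda>z. snd (B z)) (h z0)) \<noteq> (0, 0)"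
    using B by (auto simp: injective_holomorphic_immersion_def)
  define N where "N = max M (norm (h z0))"
  let ?S = "{z. norm (h z) \<le> N}"
  have lim': "z0 islimpt ?S" using lim by (rule islimpt_subset) (auto simp: N_def)
  have contA: "continuous_on UNIV A" and contB: "continuous_on UNIV B"
    using A B' by (auto intro: continuous_on_C2)
  have g: "continuous_on (B ` cball 0 N) (inv B)"
    using B'(3) contB by (intro continuous_on_inv continuous_on_subset[OF contB]) auto
  have "continuous_on ?S (\<lambda>z. inv B (A z))"
  proof (rule continuous_on_compose2[OF g continuous_on_subset[OF contA]])
    show "A ` ?S \<subseteq> B ` cball 0 N" by (auto simp: h[symmetric])
  qed auto
  hence contS: "continuous_on ?S h" by (simp add: h[symmetric] B'(3))
  have "z0 islimpt {z. h z \<in> ball (h z0) r}" if r: "r > 0" for r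
  proof -
    have "z0 \<in> ?S" by (simp add: N_def)
    then obtain \<delta> where \<delta>: "\<delta> > 0" "\<And>z. z \<in> ?S \<Longrightarrow> dist z z0 < \<delta> \<Longrightarrow> dist (h z) (h z0) < r"
      using contS r unfolding continuous_on_iff by blast
    have "z0 islimpt ?S \<inter> ball z0 \<delta>" using lim' \<delta>(1) by (intro islimpt_Int_open) auto
    thus ?thesis by (rule islimpt_subset) (use \<delta>(2) in \<open>auto simp: dist_commute\<close>)
  qed
  moreover have "deriv (\<lambda>z. fst (B z)) (h z0) \<noteq> 0 \<or> deriv (\<lambda>z. snd (B z)) (h z0) \<noteq> 0" using dB by auto
  ultimately show ?thesis
    using holomorphic_at_limit_point[OF A B'(1,2,3) h, of fst z0] holomorphic_at_limit_point[OF A B'(1,2,3) h, of snd z0]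
    by blast
qed

text \<open>At an isolated point where \<open>h\<close> is not holomorphic, \<open>h\<close> would have a
pole. Then \<open>h\<close> would take all large values near \<open>z0\<close>, where \<open>B \<circ> h =
A\<close> is bounded, so \<open>B\<close> would be bounded, contradicting Liouville's theorem.\<close>

lemma not_isolated_singularity:
  fixes h :: "complex \<Rightarrow> complex"
  assumes A: "(\<lambda>z. fst (A z)) holomorphic_on UNIV" "(\<lambda>z. snd (A z)) holomorphic_on UNIV"
    and B: "injective_holomorphic_immersion B"
    and h: "\<And>z. B (h z) = A z"
    and \<delta>: "\<delta> > 0" "h holomorphic_on (ball z0 \<delta> - {z0})"
  shows "\<exists>\<epsilon>>0. h holomorphic_on ball z0 \<epsilon>"
proof (rule ccontr)
  assume neg: "\<not> ?thesis"
  have B': "(\<lambda>z. fst (B z)) holomorphic_on UNIV" "(\<lambda>z. snd (B z)) holomorphic_on UNIV" "inj B"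
    using B by (auto simp: injective_holomorphic_immersion_def)
  have nl: "\<not> z0 islimpt {z. norm (h z) \<le> M}" for M
    using holomorphic_at_bounded_limit_point[OF A B h] neg by blast
  have ev: "eventually (\<lambda>z. norm (h z) > M) (at z0)" for M
    using nl[of M] unfolding islimpt_iff_eventually by (simp add: not_le)
  hence pole: "is_pole h z0"
    unfolding is_pole_def filterlim_at_infinity[OF order_refl] by (auto intro: eventually_mono less_imp_le)
  obtain \<delta>' where \<delta>': "\<delta>' > 0" "\<And>z. z \<noteq> z0 \<Longrightarrow> dist z z0 < \<delta>' \<Longrightarrow> norm (h z) > 0"
    using ev[of 0] unfolding eventually_at by blast
  define e where "e = min \<delta> \<delta>'"
  have e: "e > 0" using \<delta> \<delta>' by (simp add: e_def)
  define g where "g = (\<lambda>x. if x = z0 then 0 else inverse (h x))"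
  have g: "g holomorphic_on ball z0 e" unfolding g_def
  proof (rule is_pole_inverse_holomorphic[OF open_ball _ pole])
    show "h holomorphic_on ball z0 e - {z0}" by (rule holomorphic_on_subset[OF \<delta>(2)]) (auto simp: e_def)
    show "\<forall>x\<in>ball z0 e - {z0}. h x \<noteq> 0" using \<delta>'(2) by (fastforce simp: e_def dist_commute)
  qed
  have gz: "g x \<noteq> 0" if "x \<in> ball z0 e - {z0}" for x
    using \<delta>'(2)[of x] that by (auto simp: g_def e_def dist_commute)
  have "z0 + of_real (e / 2) \<in> ball z0 e - {z0}" using e by (auto simp: dist_norm)
  from gz[OF this] have "\<not> g constant_on ball z0 e"
    using \<open>z0 + of_real (e / 2) \<in> ball z0 e - {z0}\<close> e unfolding constant_on_def
    by (metis DiffD1 centre_in_ball g_def)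
  hence "open (g ` ball z0 e)" using g by (intro open_mapping_thm[of g "ball z0 e"]) auto
  moreover have "0 \<in> g ` ball z0 e" using e by (intro image_eqI[of _ _ z0]) (auto simp: g_def)
  ultimately obtain \<eta> where \<eta>: "\<eta> > 0" "ball 0 \<eta> \<subseteq> g ` ball z0 e" by (metis open_contains_ball)
  have cov: "B w \<in> A ` cball z0 e" if "norm w > 1 / \<eta>" for w
  proof -
    have "norm w > 0" using that \<eta>(1) by (meson divide_pos_pos less_trans zero_less_one)
    hence w0: "w \<noteq> 0" by auto
    have "inverse (norm w) < \<eta>" using that \<eta>(1) \<open>norm w > 0\<close> by (simp add: field_simps)
    hence "inverse w \<in> g ` ball z0 e" using \<eta>(2) by (auto simp: norm_inverse)
    then obtain z where z: "z \<in> ball z0 e" "g z = inverse w" by (metis imageE)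
    hence "h z = w" using w0 by (auto simp: g_def split: if_splits)
    thus ?thesis using h[of z] z(1) by (intro image_eqI[of _ _ z]) auto
  qed
  have contA: "continuous_on UNIV A" and contB: "continuous_on UNIV B"
    using A B' by (auto intro: continuous_on_C2)
  have "compact (A ` cball z0 e)" "compact (B ` cball 0 (1 / \<eta>))"
    by (auto intro!: compact_continuous_image continuous_on_subset[OF contA] continuous_on_subset[OF contB])
  hence "bounded (A ` cball z0 e \<union> B ` cball 0 (1 / \<eta>))" by (auto intro: compact_imp_bounded)
  moreover have "range B \<subseteq> A ` cball z0 e \<union> B ` cball 0 (1 / \<eta>)"
  proof (rule image_subsetI)
    fix w show "B w \<in> A ` cball z0 e \<union> B ` cball 0 (1 / \<eta>)"
      using cov[of w] by (cases "norm w > 1 / \<eta>") auto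
  qed
  ultimately have "bounded (range B)" by (rule bounded_subset)
  hence "bounded (fst ` range B)" "bounded (snd ` range B)" by (auto intro: bounded_fst bounded_snd)
  hence "bounded (range (\<lambda>z. fst (B z)))" "bounded (range (\<lambda>z. snd (B z)))" by (auto simp: image_image)
  from Liouville_theorem[OF B'(1) this(1)] Liouville_theorem[OF B'(2) this(2)]
  have "B 0 = B 1" unfolding constant_on_def by (metis UNIV_I prod_eq_iff)
  thus False using B'(3) by (metis injD zero_neq_one)
qed

text \<open>Baire's theorem gives a point of the set of bad points near which \<open>h\<close> is bounded on
that set; it is either a limit of bad points or isolated, and both cases have been excluded.\<close>

theorem reparametrization_holomorphic:
  fixes h :: "complex \<Rightarrow> complex"
  assumes A: "(\<lambda>z. fst (A z)) holomorphic_on UNIV" "(\<lambda>z. snd (A z)) holomorphic_on UNIV"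
    and B: "injective_holomorphic_immersion B"
    and h: "\<And>z. B (h z) = A z"
  shows "h holomorphic_on UNIV"
proof -
  have B': "(\<lambda>z. fst (B z)) holomorphic_on UNIV" "(\<lambda>z. snd (B z)) holomorphic_on UNIV" "inj B"
    using B by (auto simp: injective_holomorphic_immersion_def)
  have contA: "continuous_on UNIV A" and contB: "continuous_on UNIV B"
    using A B' by (auto intro: continuous_on_C2)
  define G where "G = {z. \<exists>\<epsilon>>0. h holomorphic_on ball z \<epsilon>}"
  have balls: "ball z \<epsilon> \<subseteq> G" if "h holomorphic_on ball z \<epsilon>" for z \<epsilon>
  proof
    fix w assume "w \<in> ball z \<epsilon>"
    then obtain d where "d > 0" "ball w d \<subseteq> ball z \<epsilon>" by (metis open_ball open_contains_ball)
    thus "w \<in> G" using that unfolding G_def by (auto intro: holomorphic_on_subset)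
  qed
  have openG: "open G" unfolding open_contains_ball
  proof
    fix z assume "z \<in> G"
    then obtain \<epsilon> where "\<epsilon> > 0" "h holomorphic_on ball z \<epsilon>" unfolding G_def by blast
    thus "\<exists>e>0. ball z e \<subseteq> G" using balls by blast
  qed
  have holG: "h holomorphic_on S" if "open S" "S \<subseteq> G" for S
  proof -
    have "h field_differentiable at z" if zS: "z \<in> S" for z
    proof -
      obtain \<epsilon> where "\<epsilon> > 0" "h holomorphic_on ball z \<epsilon>" using zS \<open>S \<subseteq> G\<close> unfolding G_def by blast
      thus ?thesis by (intro holomorphic_on_imp_differentiable_at[of h "ball z \<epsilon>"]) auto
    qed
    thus ?thesis unfolding holomorphic_on_def by (auto intro: field_differentiable_at_within)
  qed
  define E where "E = - G"
  have closedE: "closed E" using openG by (simp add: E_def closed_open)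
  have "E = {}"
  proof (rule ccontr)
    assume ne: "E \<noteq> {}"
    \<comment> \<open>The closed sets \<open>F n\<close> cover the plane, so by Baire's theorem one of them contains a relatively open part of \<open>E\<close>.\<close>
    define F where "F = (\<lambda>n::nat. {z. norm (h z) \<le> n})"
    have closedF: "closed (F n)" for n
    proof -
      have "F n = A -` (B ` cball 0 (real n))"
      proof (rule set_eqI)
        fix z show "z \<in> F n \<longleftrightarrow> z \<in> A -` (B ` cball 0 (real n))"
          using B'(3) by (auto simp: F_def h[symmetric] inj_image_mem_iff)
      qed
      moreover have "compact (B ` cball 0 (real n))"
        by (auto intro!: compact_continuous_image continuous_on_subset[OF contB])
      ultimately show ?thesis using contA by (simp add: continuous_on_closed_vimage compact_imp_closed)
    qed
    have "\<exists>n. \<not> E \<subseteq> closure (E - F n)"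
    proof (rule ccontr)
      assume "\<not> ?thesis"
      hence dense: "E \<subseteq> closure (E - F n)" for n by blast
      have "E \<subseteq> closure (\<Inter> (range (\<lambda>n. E - F n)))"
      proof (rule Baire[OF closedE])
        fix T assume "T \<in> range (\<lambda>n. E - F n)"
        then obtain n where T: "T = E - F n" by blast
        have "openin (top_of_set E) (E \<inter> - F n)" using closedF[of n] by (intro openin_open_Int) (simp add: open_Compl)
        thus "openin (top_of_set E) T \<and> E \<subseteq> closure T" using dense[of n] by (simp add: T Diff_eq)
      qed simp
      moreover have "\<Inter> (range (\<lambda>n. E - F n)) = {}"
      proof -
        have "z \<notin> \<Inter> (range (\<lambda>n. E - F n))" for z
        proof -
          obtain n :: nat where "norm (h z) \<le> n" using real_arch_simple by blast
          thus ?thesis by (auto simp: F_def)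
        qed
        thus ?thesis by blast
      qed
      ultimately show False using ne by (metis closure_empty subset_empty)
    qed
    then obtain n z0 where z0: "z0 \<in> E" "z0 \<notin> closure (E - F n)" by blast
    hence "open (- closure (E - F n))" "z0 \<in> - closure (E - F n)" by auto
    then obtain \<delta> where \<delta>: "\<delta> > 0" "ball z0 \<delta> \<subseteq> - closure (E - F n)" by (metis open_contains_ball)
    hence sub: "E \<inter> ball z0 \<delta> \<subseteq> {z. norm (h z) \<le> n}"
      using closure_subset[of "E - F n"] by (auto simp: F_def)
    have "z0 \<in> G"
    proof (cases "z0 islimpt E")
      case True
      hence "z0 islimpt (E \<inter> ball z0 \<delta>)" using \<delta>(1) by (intro islimpt_Int_open) auto
      hence "z0 islimpt {z. norm (h z) \<le> n}" using sub by (rule islimpt_subset)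
      thus ?thesis unfolding G_def using holomorphic_at_bounded_limit_point[OF A B h] by blast
    next
      case False
      then obtain d where d: "d > 0" "\<And>z. z \<in> E \<Longrightarrow> z \<noteq> z0 \<Longrightarrow> d \<le> dist z z0"
        unfolding islimpt_approachable by (meson not_less)
      hence "ball z0 d - {z0} \<subseteq> G" unfolding E_def by (force simp: dist_commute)
      hence "h holomorphic_on (ball z0 d - {z0})" by (intro holG) auto
      thus ?thesis unfolding G_def using not_isolated_singularity[OF A B h d(1)] by blast
    qed
    thus False using z0(1) by (simp add: E_def)
  qed
  hence "G = UNIV" by (auto simp: E_def)
  thus ?thesis by (intro holG) auto
qed

text \<open>The inverse of \<open>h\<close> is continuous, so \<open>h\<close> tends to infinity at infinity
and is a polynomial; its derivative has no zero.\<close>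

lemma entire_bij_linear:
  fixes h :: "complex \<Rightarrow> complex"
  assumes h: "h holomorphic_on UNIV" "bij h" "h 0 = 0"
  shows "\<exists>c. \<forall>z. h z = c * z"
proof -
  have inj: "inj h" and sur: "range h = UNIV" using h(2) by (auto simp: bij_def)
  obtain k where "k holomorphic_on range h" "\<And>z. z \<in> UNIV \<Longrightarrow> deriv h z * deriv k (h z) = 1"
      "\<And>z. z \<in> UNIV \<Longrightarrow> k (h z) = z"
    by (rule holomorphic_has_inverse[OF h(1) open_UNIV inj], rule that, assumption+)
  hence k: "k holomorphic_on UNIV" "\<And>z. k (h z) = z" using sur by auto
  have contk: "continuous_on UNIV k" using k(1) by (rule holomorphic_on_imp_continuous_on)
  have "filterlim h at_infinity at_infinity"
    unfolding filterlim_at_infinity[OF order_refl]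
  proof (intro allI impI)
    fix r :: real assume "0 < r"
    have "compact (k ` cball 0 r)" by (intro compact_continuous_image continuous_on_subset[OF contk]) auto
    hence "bounded (k ` cball 0 r)" by (rule compact_imp_bounded)
    then obtain b where b: "\<And>w. w \<in> cball 0 r \<Longrightarrow> norm (k w) \<le> b"
      unfolding bounded_iff by blast
    have "r \<le> norm (h z)" if "norm z \<ge> b + 1" for z
      using b[of "h z"] k(2)[of z] that by (cases "norm (h z) \<le> r") auto
    thus "eventually (\<lambda>z. r \<le> norm (h z)) at_infinity" unfolding eventually_at_infinity by blast
  qed
  hence "((inverse \<circ> h) \<longlongrightarrow> 0) at_infinity"
    using filterlim_compose[OF tendsto_inverse_0] by (auto simp: o_def)
  then obtain a n where an: "\<And>z. h z = (\<Sum>i\<le>n. a i * z ^ i)" using pole_at_infinity[OF h(1)] by blast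
  define p where "p = (\<Sum>i\<le>n. monom (a i) i)"
  have hp: "h = poly p" by (auto simp: fun_eq_iff an p_def poly_sum poly_monom)
  have "poly (pderiv p) z \<noteq> 0" for z
  proof -
    have "deriv h z \<noteq> 0" by (rule holomorphic_injective_imp_regular[OF h(1) open_UNIV inj]) auto
    thus ?thesis unfolding hp using DERIV_imp_deriv[OF poly_DERIV] by metis
  qed
  then obtain a where "pderiv p = [:a:]" using fundamental_theorem_of_algebra_alt[of "pderiv p"] by blast
  hence "degree (pderiv p) = 0" by simp
  hence "degree p \<le> 1" by (simp add: degree_pderiv)
  hence "p = [:coeff p 0, coeff p 1:]"
    by (intro poly_eqI) (auto simp: coeff_pCons coeff_eq_0 split: nat.splits)
  moreover have "coeff p 0 = 0" using h(3) by (simp add: hp poly_0_coeff_0)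
  ultimately have "h z = coeff p 1 * z" for z unfolding hp
    by (metis add_0 mult.commute mult_zero_right add.right_neutral poly_pCons poly_0)
  thus ?thesis by blast
qed

theorem leaf_maps_linear:
  assumes A: "(\<lambda>z. fst (A z)) holomorphic_on UNIV" "(\<lambda>z. snd (A z)) holomorphic_on UNIV" "inj A"
    and B: "injective_holomorphic_immersion B"
    and rng: "range A = range B" and base: "A 0 = B 0"
  shows "\<exists>c. \<forall>z. A z = B (c * z)"
proof -
  have injB: "inj B" using B by (simp add: injective_holomorphic_immersion_def)
  define h where "h = (\<lambda>z. inv B (A z))"
  have h: "B (h z) = A z" for z unfolding h_def using rng by (metis f_inv_into_f rangeI)
  have "h holomorphic_on UNIV" by (rule reparametrization_holomorphic[OF A(1,2) B h])
  moreover have "bij h"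
  proof (rule bijI)
    show "inj h" by (rule injI) (metis h A(3) injD)
    show "surj h" unfolding surj_def by (metis h injB injD rangeE rangeI rng)
  qed
  moreover have "h 0 = 0" using h[of 0] base injB by (metis injD)
  ultimately obtain c where "\<And>z. h z = c * z" using entire_bij_linear by blast
  thus ?thesis using h by metis
qed

section \<open>Growth of the Green function along the leaves\<close>

lemma frontier_annulus:
  "frontier {z :: complex. 1 \<le> norm z \<and> norm z \<le> r} \<subseteq> {z. norm z = 1} \<union> {z. norm z = r}"
proof -
  let ?S = "{z :: complex. 1 \<le> norm z \<and> norm z \<le> r}"
  have "closed ?S" by (intro closed_Collect_conj closed_Collect_le continuous_intros)
  moreover have "{z :: complex. 1 < norm z \<and> norm z < r} \<subseteq> interior ?S"
    by (rule interior_maximal) (auto intro!: open_Collect_conj open_Collect_less continuous_intros)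
  ultimately have sub: "closed ?S" "{z :: complex. 1 < norm z \<and> norm z < r} \<subseteq> interior ?S" by auto
  show ?thesis
  proof
    fix z assume "z \<in> frontier ?S"
    hence z: "z \<in> ?S" "z \<notin> interior ?S" using sub(1) by (auto simp: frontier_def)
    hence "\<not> (1 < norm z \<and> norm z < r)" using sub(2) by blast
    thus "z \<in> {z. norm z = 1} \<union> {z. norm z = r}" using z(1) by auto
  qed
qed

text \<open>A form of Hadamard's three circles theorem, with an additional term \<open>ln
\<bar>z\<bar>\<close> from rounding the exponent up to an integer. The term is harmless, because the theorem
is applied to iterates and the result is divided by \<open>d\<^sup>n\<close>.\<close>

lemma three_circles:
  fixes F :: "complex \<Rightarrow> complex"
  assumes F: "F holomorphic_on UNIV" and r: "r > 1" and M: "0 \<le> L1" "L1 \<le> L2"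
    and 1: "\<And>z. norm z = 1 \<Longrightarrow> norm (F z) \<le> exp L1" and 2: "\<And>z. norm z = r \<Longrightarrow> norm (F z) \<le> exp L2"
    and z: "1 \<le> norm z" "norm z \<le> r"
  shows "norm (F z) \<le> exp (L1 + ((L2 - L1) / ln r + 1) * ln (norm z))"
proof -
  define \<alpha> where "\<alpha> = (L2 - L1) / ln r"
  have lr: "ln r > 0" using r by simp
  have \<alpha>: "\<alpha> \<ge> 0" using M lr by (simp add: \<alpha>_def)
  \<comment> \<open>With the exponent \<open>\<alpha>\<close> the bounds on the two boundary circles would agree; an integer exponent makes \<open>F z / z ^ k\<close> holomorphic.\<close>
  define k where "k = nat \<lceil>\<alpha>\<rceil>"
  have k: "\<alpha> \<le> real k" "real k \<le> \<alpha> + 1" using \<alpha> unfolding k_def by linarith+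
  let ?S = "{z :: complex. 1 \<le> norm z \<and> norm z \<le> r}"
  have closedS: "closed ?S" by (intro closed_Collect_conj closed_Collect_le continuous_intros)
  have hol: "(\<lambda>z. F z / z ^ k) holomorphic_on - {0}"
    by (intro holomorphic_intros holomorphic_on_subset[OF F]) auto
  have ex: "exp (real k * ln (norm w)) = norm w ^ k" if "w \<noteq> 0" for w :: complex
    using that by (simp add: exp_of_nat_mult)
  have "norm (F z / z ^ k) \<le> exp L1"
  proof (rule maximum_modulus_frontier[of "\<lambda>z. F z / z ^ k" ?S])
    show "(\<lambda>z. F z / z ^ k) holomorphic_on interior ?S"
      by (rule holomorphic_on_subset[OF hol]) (use interior_subset in fastforce)
    show "continuous_on (closure ?S) (\<lambda>z. F z / z ^ k)"
      unfolding closure_closed[OF closedS]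
      by (rule continuous_on_subset[OF holomorphic_on_imp_continuous_on[OF hol]]) auto
    show "bounded ?S" by (rule bounded_subset[OF bounded_cball[of 0 r]]) auto
    show "z \<in> ?S" using z by simp
    fix w assume "w \<in> frontier ?S"
    hence "norm w = 1 \<or> norm w = r" using frontier_annulus[of r] by auto
    thus "norm (F w / w ^ k) \<le> exp L1"
    proof
      assume "norm w = 1"
      thus ?thesis using 1[of w] by (simp add: norm_divide norm_power)
    next
      assume w: "norm w = r"
      hence w0: "w \<noteq> 0" using r by auto
      have "L2 = L1 + \<alpha> * ln r" using lr by (simp add: \<alpha>_def)
      also have "\<dots> \<le> L1 + real k * ln r" using k lr by (intro add_left_mono mult_right_mono) auto
      finally have "norm (F w) \<le> exp (L1 + real k * ln r)" using 2[OF w] by (meson exp_le_cancel_iff order_trans)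
      also have "\<dots> = exp L1 * norm w ^ k" using ex[OF w0] w by (simp add: exp_add)
      finally show ?thesis using w0 by (simp add: norm_divide norm_power divide_le_eq)
    qed
  qed
  moreover have z0: "z \<noteq> 0" using z by auto
  ultimately have "norm (F z) \<le> exp L1 * norm z ^ k" by (simp add: norm_divide norm_power divide_le_eq)
  also have "\<dots> = exp (L1 + real k * ln (norm z))" using ex[OF z0] by (simp add: exp_add)
  also have "\<dots> \<le> exp (L1 + (\<alpha> + 1) * ln (norm z))"
    using k z by (simp add: mult_right_mono)
  finally show ?thesis by (simp add: \<alpha>_def)
qed

lemma norm_le_exp_log_norm: "norm z \<le> exp (log_norm z)"
proof -
  have "exp (log_norm z) = max 1 (norm z)" unfolding log_norm_def by (rule exp_ln) simp
  thus ?thesis by simp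
qed

lemma log_norm_le_exp:
  assumes "norm (fst z) \<le> exp L" "norm (snd z) \<le> exp L" "L \<ge> 0" shows "log_norm z \<le> L + ln 2"
proof -
  have "norm z \<le> 2 * exp L" using norm_Pair_le[of "fst z" "snd z"] assms by simp
  moreover have "1 \<le> exp L" using assms(3) by simp
  ultimately have "max 1 (norm z) \<le> 2 * exp L" by linarith
  hence "log_norm z \<le> ln (2 * exp L)" unfolding log_norm_def by (intro ln_mono) auto
  thus ?thesis by (simp add: ln_mult)
qed

lemma le_if_le_vanishing:
  fixes a b c d :: real
  assumes "d > 1" "\<And>n. a \<le> b + c / d ^ n" shows "a \<le> b"
proof -
  have "(\<lambda>n. b + c * (1 / d) ^ n) \<longlonglongrightarrow> b + c * 0"
    by (intro tendsto_intros LIMSEQ_realpow_zero) (use assms(1) in auto)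
  thus ?thesis by (intro LIMSEQ_le_const[of _ b a]) (use assms(2) in \<open>auto simp: power_divide\<close>)
qed

lemma holomorphic_poly_fun:
  assumes "poly_fun_deg_le n p" "(\<lambda>z. fst (g z)) holomorphic_on U" "(\<lambda>z. snd (g z)) holomorphic_on U"
  shows "(\<lambda>z. p (g z)) holomorphic_on U"
proof -
  obtain a where a: "\<And>z w. p (z, w) = (\<Sum>i\<le>n. \<Sum>j\<le>n - i. a i j * z ^ i * w ^ j)"
    using assms(1) by (auto simp: poly_fun_deg_le_def)
  have "(\<lambda>z. p (g z)) = (\<lambda>z. \<Sum>i\<le>n. \<Sum>j\<le>n - i. a i j * fst (g z) ^ i * snd (g z) ^ j)"
  proof
    fix z show "p (g z) = (\<Sum>i\<le>n. \<Sum>j\<le>n - i. a i j * fst (g z) ^ i * snd (g z) ^ j)"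
      using a[of "fst (g z)" "snd (g z)"] by simp
  qed
  thus ?thesis using assms(2,3) by (auto intro!: holomorphic_intros)
qed

lemma uniform_limit_Pair:
  assumes "uniform_limit K a a' F" "uniform_limit K b b' F"
  shows "uniform_limit K (\<lambda>n z. (a n z, b n z)) (\<lambda>z. (a' z, b' z)) F"
proof (rule uniform_limitI)
  fix e :: real assume "e > 0"
  hence e: "e / 2 > 0" by simp
  from uniform_limitD[OF assms(1) e] uniform_limitD[OF assms(2) e]
  show "\<forall>\<^sub>F n in F. \<forall>z\<in>K. dist (a n z, b n z) (a' z, b' z) < e"
  proof eventually_elim
    case (elim n)
    show ?case
    proof
      fix z assume "z \<in> K"
      hence "dist (a n z) (a' z) + dist (b n z) (b' z) < e" using elim by fastforce
      thus "dist (a n z, b n z) (a' z, b' z) < e"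
        unfolding dist_Pair_Pair by (rule order_le_less_trans[OF sqrt_sum_squares_le_sum[OF zero_le_dist zero_le_dist]])
    qed
  qed
qed

text \<open>A normalized invariant family together with the estimate on the closure of \<open>K\<^sup>-\<close>. Below, \<open>G\<close> is the
Green function, \<open>m x r\<close> stands for \<open>m\<^sub>x(r)\<close>, and \<open>lam x\<close> for \<open>\<lambda>\<^sub>x\<close>.\<close>

locale leaf_family =
  fixes f :: "C2 \<Rightarrow> C2" and d :: real and S :: "C2 set" and \<psi> :: "C2 \<Rightarrow> complex \<Rightarrow> C2" and C :: real
  assumes f: "polynomial_diffeo f" and d: "d > 1" and C: "C \<ge> 0"
    and key: "\<And>x. x \<in> closure (K_minus f) \<Longrightarrow> \<bar>log_norm (f x) - d * log_norm x\<bar> \<le> C"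
    and fam: "normalized_invariant_family f d S \<psi>"
begin

abbreviation "X \<equiv> closure (K_minus f)"
abbreviation "G \<equiv> G_plus f d"
abbreviation "m \<equiv> growth f d \<psi>"
text \<open>The resulting bound for \<open>\<bar>G\<^sup>+ - L\<bar>\<close>.\<close>

definition "C' = C / (d - 1)"

lemma C'_nonneg: "C' \<ge> 0" using C d by (simp add: C'_def)

lemma X_f: assumes "x \<in> X" shows "f x \<in> X"
proof -
  have "f ` X \<subseteq> X"
  proof (rule image_closure_subset)
    show "continuous_on X f" using f by (intro continuous_on_polynomial_map) (simp add: polynomial_diffeo_def)
    show "f ` K_minus f \<subseteq> X"
      using K_minus_invariant[of f] f closure_subset[of "K_minus f"] by (auto simp: polynomial_diffeo_def)
  qed auto
  thus ?thesis using assms by blast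
qed

lemma X_funpow: "x \<in> X \<Longrightarrow> (f ^^ n) x \<in> X"
  by (induction n) (auto intro: X_f)

text \<open>The sequence defining \<open>G\<^sup>+\<close> converges by comparison with a geometric
series.\<close>

lemma G_convergence:
  assumes x: "x \<in> X"
  shows "(\<lambda>n. log_norm ((f ^^ n) x) / d ^ n) \<longlonglongrightarrow> G x" "\<bar>G x - log_norm x\<bar> \<le> C'"
proof -
  let ?u = "\<lambda>n. log_norm ((f ^^ n) x) / d ^ n"
  define a where "a = (\<lambda>n. ?u (Suc n) - ?u n)"
  have dp: "d ^ n > 0" for n using d by simp
  have a: "norm (a n) \<le> C / d * (1 / d) ^ n" for n
  proof -
    have "a n = (log_norm (f ((f ^^ n) x)) - d * log_norm ((f ^^ n) x)) / d ^ Suc n"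
      using d by (simp add: a_def field_simps)
    hence "\<bar>a n\<bar> = \<bar>log_norm (f ((f ^^ n) x)) - d * log_norm ((f ^^ n) x)\<bar> / d ^ Suc n"
      using dp[of "Suc n"] by (simp only: abs_divide abs_of_pos)
    also have "\<dots> \<le> C / d ^ Suc n" using dp[of "Suc n"] by (intro divide_right_mono key X_funpow x) auto
    finally show ?thesis by (simp add: power_one_over)
  qed
  have geo: "(\<lambda>n. C / d * (1 / d) ^ n) sums (C / d * (1 / (1 - 1 / d)))"
    by (intro sums_mult geometric_sums) (use d in auto)
  have C'eq: "C / d * (1 / (1 - 1 / d)) = C'" using d by (simp add: C'_def field_simps)
  have sn: "summable (\<lambda>n. norm (a n))"
  proof (rule summable_comparison_test'[OF sums_summable[OF geo]])
    fix n show "norm (norm (a n)) \<le> C / d * (1 / d) ^ n" using a[of n] by (simp only: real_norm_def abs_abs)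
  qed
  hence "(\<lambda>n. \<Sum>i<n. a i) \<longlonglongrightarrow> suminf a" by (rule summable_LIMSEQ[OF summable_norm_cancel])
  moreover have "(\<Sum>i<n. a i) = ?u n - log_norm x" for n unfolding a_def by (subst sum_lessThan_telescope) simp
  ultimately have "(\<lambda>n. (?u n - log_norm x) + log_norm x) \<longlonglongrightarrow> suminf a + log_norm x" by (intro tendsto_add) auto
  hence lim: "?u \<longlonglongrightarrow> suminf a + log_norm x" by simp
  hence "G x = suminf a + log_norm x" unfolding G_plus_def log_norm_def[symmetric] by (rule limI)
  moreover have "norm (suminf a) \<le> C'"
  proof -
    have "norm (suminf a) \<le> (\<Sum>n. norm (a n))" using sn by (rule summable_norm)
    also have "\<dots> \<le> (\<Sum>n. C / d * (1 / d) ^ n)" using a sn sums_summable[OF geo] by (intro suminf_le)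
    also have "\<dots> = C'" using sums_unique[OF geo] C'eq by simp
    finally show ?thesis .
  qed
  ultimately show "?u \<longlonglongrightarrow> G x" "\<bar>G x - log_norm x\<bar> \<le> C'" using lim by auto
qed

lemma G_f: assumes x: "x \<in> X" shows "G (f x) = d * G x"
proof -
  have "(\<lambda>n. log_norm ((f ^^ Suc n) x) / d ^ Suc n) \<longlonglongrightarrow> G x" using G_convergence(1)[OF x] by (rule LIMSEQ_Suc)
  hence "(\<lambda>n. d * (log_norm ((f ^^ Suc n) x) / d ^ Suc n)) \<longlonglongrightarrow> d * G x" by (intro tendsto_intros)
  moreover have "d * (log_norm ((f ^^ Suc n) x) / d ^ Suc n) = log_norm ((f ^^ n) (f x)) / d ^ n" for n
    using d by (simp add: funpow_swap1)
  ultimately have "(\<lambda>n. log_norm ((f ^^ n) (f x)) / d ^ n) \<longlonglongrightarrow> d * G x" by simp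
  thus ?thesis using G_convergence(1)[OF X_f[OF x]] by (rule LIMSEQ_unique[rotated])
qed

lemma G_funpow: "x \<in> X \<Longrightarrow> G ((f ^^ n) x) = d ^ n * G x"
  by (induction n) (auto simp: G_f X_funpow)

lemma log_norm_funpow:
  assumes "x \<in> X" shows "\<bar>d ^ n * G x - log_norm ((f ^^ n) x)\<bar> \<le> C'"
  using G_convergence(2)[OF X_funpow[OF assms, of n]] G_funpow[OF assms, of n] by simp

lemma fam_facts:
  assumes "x \<in> S"
  shows "f x \<in> S" "injective_holomorphic_immersion (\<psi> x)" "\<psi> x z \<in> X"
    "f ` range (\<psi> x) = range (\<psi> (f x))" "\<psi> x 0 = x" "m x 1 = 1"
proof -
  show "f x \<in> S" "injective_holomorphic_immersion (\<psi> x)" "f ` range (\<psi> x) = range (\<psi> (f x))" "\<psi> x 0 = x" "m x 1 = 1"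
    using fam assms unfolding normalized_invariant_family_def by blast+
  have "range (\<psi> x) \<subseteq> J_minus f" using fam assms unfolding normalized_invariant_family_def by blast
  thus "\<psi> x z \<in> X" unfolding J_minus_def frontier_def by auto
qed

lemma \<psi>_holomorphic:
  assumes "x \<in> S" shows "(\<lambda>z. fst (\<psi> x z)) holomorphic_on UNIV" "(\<lambda>z. snd (\<psi> x z)) holomorphic_on UNIV" "inj (\<psi> x)"
  using fam_facts(2)[OF assms] unfolding injective_holomorphic_immersion_def by auto

lemma continuous_log_norm: "continuous_on A log_norm"
  unfolding log_norm_def[abs_def] by (intro continuous_intros) auto

lemma m_bdd:
  assumes x: "x \<in> S" shows "bdd_above ((\<lambda>z. G (\<psi> x z)) ` cball 0 r)"
proof -
  have "continuous_on (cball 0 r) (\<psi> x)"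
    using continuous_on_C2[OF \<psi>_holomorphic(1,2)[OF x]] by (rule continuous_on_subset) auto
  hence "compact ((\<lambda>z. log_norm (\<psi> x z)) ` cball 0 r)"
    by (intro compact_continuous_image continuous_on_compose2[OF continuous_log_norm[of UNIV]]) auto
  hence "bounded ((\<lambda>z. log_norm (\<psi> x z)) ` cball 0 r)" by (rule compact_imp_bounded)
  then obtain B where B: "\<And>z. z \<in> cball 0 r \<Longrightarrow> norm (log_norm (\<psi> x z)) \<le> B" unfolding bounded_iff by blast
  show ?thesis
  proof (rule bdd_aboveI2)
    fix z :: complex assume "z \<in> cball 0 r"
    thus "G (\<psi> x z) \<le> B + C'" using B[of z] G_convergence(2)[OF fam_facts(3)[OF x, of z]] by simp
  qed
qed

lemma m_ge: "x \<in> S \<Longrightarrow> norm z \<le> r \<Longrightarrow> G (\<psi> x z) \<le> m x r"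
  unfolding growth_def by (rule cSUP_upper[OF _ m_bdd]) auto

lemma m_le: "r \<ge> 0 \<Longrightarrow> (\<And>z. norm z \<le> r \<Longrightarrow> G (\<psi> x z) \<le> b) \<Longrightarrow> m x r \<le> b"
  unfolding growth_def by (rule cSUP_least) auto

lemma m_mono: "x \<in> S \<Longrightarrow> 0 \<le> r \<Longrightarrow> r \<le> s \<Longrightarrow> m x r \<le> m x s"
  by (rule m_le) (auto intro: m_ge)

abbreviation "lam \<equiv> leaf_multiplier f \<psi>"

lemma leaf_multiplier:
  assumes x: "x \<in> S" shows "f (\<psi> x z) = \<psi> (f x) (lam x * z)"
proof -
  have pf: "\<exists>n. poly_map_deg_le n f" "bij f" using f by (auto simp: polynomial_diffeo_def polynomial_map_def)
  then obtain n where n: "poly_fun_deg_le n (\<lambda>x. fst (f x))" "poly_fun_deg_le n (\<lambda>x. snd (f x))"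
    by (auto simp: poly_map_deg_le_def)
  have "\<exists>c. \<forall>z. f (\<psi> x z) = \<psi> (f x) (c * z)"
  proof (rule leaf_maps_linear)
    show "(\<lambda>z. fst (f (\<psi> x z))) holomorphic_on UNIV" "(\<lambda>z. snd (f (\<psi> x z))) holomorphic_on UNIV"
      using holomorphic_poly_fun[OF n(1) \<psi>_holomorphic(1,2)[OF x]] holomorphic_poly_fun[OF n(2) \<psi>_holomorphic(1,2)[OF x]] by auto
    show "inj (\<lambda>z. f (\<psi> x z))" using \<psi>_holomorphic(3)[OF x] pf(2) by (meson bij_is_inj injD injI)
    show "injective_holomorphic_immersion (\<psi> (f x))" by (intro fam_facts x)
    show "range (\<lambda>z. f (\<psi> x z)) = range (\<psi> (f x))" using fam_facts(4)[OF x] by (simp add: image_image)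
    show "f (\<psi> x 0) = \<psi> (f x) 0" using fam_facts(5)[OF x] fam_facts(5)[OF fam_facts(1)[OF x]] by simp
  qed
  then obtain c where c: "\<forall>z. f (\<psi> x z) = \<psi> (f x) (c * z)" by blast
  have "lam x = c" unfolding leaf_multiplier_def
  proof (rule the_equality)
    show "\<forall>z. f (\<psi> x z) = \<psi> (f x) (c * z)" by (rule c)
  next
    fix c' assume "\<forall>z. f (\<psi> x z) = \<psi> (f x) (c' * z)"
    hence "\<psi> (f x) (c' * 1) = \<psi> (f x) (c * 1)" using c by metis
    thus "c' = c" using \<psi>_holomorphic(3)[OF fam_facts(1)[OF x]] by (metis injD mult.right_neutral)
  qed
  thus ?thesis using c by blast
qed

lemma lam_nonzero: assumes x: "x \<in> S" shows "lam x \<noteq> 0"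
proof
  assume "lam x = 0"
  hence "f (\<psi> x 0) = f (\<psi> x 1)" using leaf_multiplier[OF x, of 0] leaf_multiplier[OF x, of 1] by simp
  hence "\<psi> x 0 = \<psi> x 1" using f by (metis polynomial_diffeo_def bij_is_inj injD)
  thus False using \<psi>_holomorphic(3)[OF x] by (metis injD zero_neq_one)
qed

lemma m_scale:
  assumes x: "x \<in> S" and r: "r \<ge> 0" shows "m (f x) (norm (lam x) * r) = d * m x r"
proof (rule antisym)
  have eq: "G (\<psi> (f x) (lam x * z)) = d * G (\<psi> x z)" for z
    unfolding leaf_multiplier[OF x, symmetric] by (rule G_f[OF fam_facts(3)[OF x]])
  show "m (f x) (norm (lam x) * r) \<le> d * m x r"
  proof (rule m_le)
    fix z :: complex assume z: "norm z \<le> norm (lam x) * r"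
    have "norm (z / lam x) \<le> r" using z lam_nonzero[OF x] by (simp add: norm_divide divide_le_eq mult.commute)
    from m_ge[OF x this] have "d * G (\<psi> x (z / lam x)) \<le> d * m x r" using d by simp
    thus "G (\<psi> (f x) z) \<le> d * m x r" using eq[of "z / lam x"] lam_nonzero[OF x] by simp
  qed (use r in simp)
  have "m x r \<le> m (f x) (norm (lam x) * r) / d"
  proof (rule m_le[OF r])
    fix z :: complex assume "norm z \<le> r"
    hence "norm (lam x * z) \<le> norm (lam x) * r" by (simp add: norm_mult mult_left_mono)
    from m_ge[OF fam_facts(1)[OF x] this] show "G (\<psi> x z) \<le> m (f x) (norm (lam x) * r) / d"
      using d eq[of z] by (simp add: le_divide_eq mult.commute)
  qed
  thus "d * m x r \<le> m (f x) (norm (lam x) * r)" using d by (simp add: le_divide_eq mult.commute)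
qed

lemma lam_gt_1: assumes x: "x \<in> S" shows "norm (lam x) > 1"
proof (rule ccontr)
  assume "\<not> ?thesis"
  hence "m (f x) (norm (lam x)) \<le> m (f x) 1" by (intro m_mono fam_facts x) auto
  moreover have "m (f x) (norm (lam x)) = d" using m_scale[OF x, of 1] fam_facts(6)[OF x] by simp
  ultimately show False using d fam_facts(6)[OF fam_facts(1)[OF x]] by simp
qed

lemma funpow_holomorphic:
  assumes x: "x \<in> S"
  shows "(\<lambda>z. fst ((f ^^ n) (\<psi> x z))) holomorphic_on UNIV \<and> (\<lambda>z. snd ((f ^^ n) (\<psi> x z))) holomorphic_on UNIV"
proof (induction n)
  case 0
  thus ?case using \<psi>_holomorphic[OF x] by simp
next
  case (Suc n)
  obtain N where N: "poly_fun_deg_le N (\<lambda>x. fst (f x))" "poly_fun_deg_le N (\<lambda>x. snd (f x))"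
    using f by (auto simp: polynomial_diffeo_def polynomial_map_def poly_map_deg_le_def)
  show ?case using holomorphic_poly_fun[OF N(1)] holomorphic_poly_fun[OF N(2)] Suc by auto
qed

text \<open>The three circles theorem for \<open>f\<^sup>n \<circ> \<psi>\<^sub>x\<close>, divided by
\<open>d\<^sup>n\<close>; the error terms vanish in the limit.\<close>

lemma G_convexity:
  assumes x: "x \<in> S" and r: "r > 1" and z: "1 \<le> norm z" "norm z \<le> r"
  shows "G (\<psi> x z) \<le> 1 + (m x r - 1) / ln r * ln (norm z)"
proof (rule le_if_le_vanishing[OF d])
  fix n
  have m1: "m x 1 = 1" using fam_facts(6)[OF x] .
  have mr: "m x r \<ge> 1" using m_mono[OF x, of 1 r] r m1 by simp
  define F where "F = (\<lambda>w. (f ^^ n) (\<psi> x w))"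
  define L1 where "L1 = d ^ n + C'"
  define L2 where "L2 = d ^ n * m x r + C'"
  have dn: "d ^ n > 0" using d by simp
  have L: "0 \<le> L1" "L1 \<le> L2" using dn mr C'_nonneg by (auto simp: L1_def L2_def)
  have bound: "norm (F w) \<le> exp (d ^ n * m x s + C')" if "norm w \<le> s" for w s
  proof -
    have "log_norm (F w) \<le> d ^ n * G (\<psi> x w) + C'"
      using log_norm_funpow[OF fam_facts(3)[OF x], of n w] unfolding F_def by linarith
    also have "\<dots> \<le> d ^ n * m x s + C'" using m_ge[OF x that] dn by simp
    finally show ?thesis using norm_le_exp_log_norm[of "F w"] by (meson exp_le_cancel_iff order_trans)
  qed
  have b1: "norm (F w) \<le> exp L1" if "norm w = 1" for w using bound[of w 1] that m1 by (simp add: L1_def)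
  have b2: "norm (F w) \<le> exp L2" if "norm w = r" for w using bound[of w r] that by (simp add: L2_def)
  have nf: "norm (fst p) \<le> norm p" "norm (snd p) \<le> norm p" for p :: C2
    by (metis norm_fst_le norm_snd_le prod.collapse)+
  define L3 where "L3 = L1 + ((L2 - L1) / ln r + 1) * ln (norm z)"
  have hol: "(\<lambda>w. fst (F w)) holomorphic_on UNIV" "(\<lambda>w. snd (F w)) holomorphic_on UNIV"
    using funpow_holomorphic[OF x, of n] by (auto simp: F_def)
  have "norm (fst (F z)) \<le> exp L3" unfolding L3_def
    by (rule three_circles[OF hol(1) r L _ _ z]) (use b1 b2 nf(1) order_trans in blast)+
  moreover have "norm (snd (F z)) \<le> exp L3" unfolding L3_def
    by (rule three_circles[OF hol(2) r L _ _ z]) (use b1 b2 nf(2) order_trans in blast)+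
  moreover have "L3 \<ge> 0" unfolding L3_def using L r z by (intro add_nonneg_nonneg mult_nonneg_nonneg divide_nonneg_pos) auto
  ultimately have "log_norm (F z) \<le> L3 + ln 2" by (rule log_norm_le_exp)
  hence "d ^ n * G (\<psi> x z) \<le> L3 + ln 2 + C'"
    using log_norm_funpow[OF fam_facts(3)[OF x], of n z] unfolding F_def by linarith
  also have "\<dots> = d ^ n * (1 + (m x r - 1) / ln r * ln (norm z)) + (2 * C' + ln 2 + ln (norm z))"
  proof -
    have "L2 - L1 = d ^ n * (m x r - 1)" by (simp add: L1_def L2_def algebra_simps)
    thus ?thesis by (simp add: L3_def L1_def algebra_simps)
  qed
  finally show "G (\<psi> x z) \<le> 1 + (m x r - 1) / ln r * ln (norm z) + (2 * C' + ln 2 + ln (norm z)) / d ^ n"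
    using dn d by (simp add: pos_le_divide_eq[symmetric] mult.commute[of "d ^ n" "G (\<psi> x z)"] add_divide_distrib)
qed

lemma m_convexity:
  assumes x: "x \<in> S" and r: "r > 1" and \<rho>: "1 \<le> \<rho>" "\<rho> \<le> r"
  shows "m x \<rho> \<le> 1 + (m x r - 1) / ln r * ln \<rho>"
proof (rule m_le)
  have m1: "m x 1 = 1" using fam_facts(6)[OF x] .
  have mr: "m x r \<ge> 1" using m_mono[OF x, of 1 r] r m1 by simp
  hence q: "(m x r - 1) / ln r \<ge> 0" using r by simp
  fix z :: complex assume z: "norm z \<le> \<rho>"
  show "G (\<psi> x z) \<le> 1 + (m x r - 1) / ln r * ln \<rho>"
  proof (cases "norm z \<le> 1")
    case True
    hence "G (\<psi> x z) \<le> 1" using m_ge[OF x True] m1 by simp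
    moreover have "(m x r - 1) / ln r * ln \<rho> \<ge> 0" using q \<rho> by (intro mult_nonneg_nonneg) auto
    ultimately show ?thesis by linarith
  next
    case False
    hence "G (\<psi> x z) \<le> 1 + (m x r - 1) / ln r * ln (norm z)" using z \<rho> by (intro G_convexity[OF x r]) auto
    also have "\<dots> \<le> 1 + (m x r - 1) / ln r * ln \<rho>"
      using q z False by (intro add_left_mono mult_left_mono ln_mono) auto
    finally show ?thesis .
  qed
qed (use \<rho> in simp)

text \<open>The five conditions of the theorem for the family.\<close>

definition "normality \<longleftrightarrow> normal_family (\<psi> ` S)"
definition "finite_growth \<longleftrightarrow> (\<exists>r0>1. sup_growth f d S \<psi> r0 < \<infinity>)"
definition "growth_ratio \<longleftrightarrow> (\<forall>r1 r2. 0 < r1 \<and> r1 < r2 \<longrightarrow> (\<exists>k. \<forall>x\<in>S. m x r1 > 0 \<and> m x r2 / m x r1 \<le> k))"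
definition "uniform_expansion \<longleftrightarrow> (\<exists>\<kappa>>1. \<forall>x\<in>S. norm (lam x) \<ge> \<kappa>)"
definition "power_growth \<longleftrightarrow> (\<exists>C \<beta>. \<forall>x\<in>S. \<forall>r\<ge>1. m x r \<le> C * r powr \<beta>)"

lemma finite_growth_I: assumes "r0 > 1" "\<And>x. x \<in> S \<Longrightarrow> m x r0 \<le> k" shows finite_growth
proof -
  have "sup_growth f d S \<psi> r0 \<le> ereal k" unfolding sup_growth_def using assms(2) by (intro SUP_least) simp
  hence "sup_growth f d S \<psi> r0 < \<infinity>" by (rule order_le_less_trans) simp
  thus ?thesis unfolding finite_growth_def using assms(1) by blast
qed

text \<open>Here \<open>1 = m\<^bsub>fx\<^esub>(1) < m\<^bsub>fx\<^esub>(\<bar>\<lambda>\<^sub>x\<bar>) =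
d\<close>, so by convexity \<open>\<bar>\<lambda>\<^sub>x\<bar>\<close> cannot be close to 1.\<close>

lemma finite_growth_uniform_expansion: assumes finite_growth shows uniform_expansion
proof -
  obtain r0 where r0: "r0 > 1" "sup_growth f d S \<psi> r0 < \<infinity>" using assms unfolding finite_growth_def by blast
  have le: "ereal (m x r0) \<le> sup_growth f d S \<psi> r0" if "x \<in> S" for x
    unfolding sup_growth_def using that by (rule SUP_upper)
  obtain k where k: "\<And>x. x \<in> S \<Longrightarrow> m x r0 \<le> k"
  proof (cases "sup_growth f d S \<psi> r0")
    case (real k)
    have "m x r0 \<le> k" if "x \<in> S" for x using le[OF that] real by simp
    thus ?thesis by (rule that)
  next
    case PInf
    thus ?thesis using r0(2) by simp
  next
    case MInf
    have "m x r0 \<le> 0" if "x \<in> S" for x using le[OF that] MInf by simp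
    thus ?thesis by (rule that)
  qed
  define M where "M = max 2 k"
  have M: "M \<ge> 2" and mM: "\<And>x. x \<in> S \<Longrightarrow> m x r0 \<le> M" using k by (fastforce simp: M_def)+
  have lr: "ln r0 > 0" using r0(1) by simp
  \<comment> \<open>The second term is where the convexity bound for \<open>m\<^sub>y\<close> reaches the value \<open>d\<close>.\<close>
  define \<kappa> where "\<kappa> = min r0 (exp ((d - 1) * ln r0 / (M - 1)))"
  have "(d - 1) * ln r0 / (M - 1) > 0" using d lr M by simp
  hence \<kappa>: "\<kappa> > 1" using r0(1) by (simp add: \<kappa>_def)
  have "norm (lam x) \<ge> \<kappa>" if x: "x \<in> S" for x
  proof (cases "norm (lam x) \<ge> r0")
    case True
    thus ?thesis by (simp add: \<kappa>_def)
  next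
    case False
    have l1: "norm (lam x) > 1" by (rule lam_gt_1[OF x])
    have "d = m (f x) (norm (lam x))" using m_scale[OF x, of 1] fam_facts(6)[OF x] by simp
    also have "\<dots> \<le> 1 + (m (f x) r0 - 1) / ln r0 * ln (norm (lam x))"
      using False l1 by (intro m_convexity fam_facts x r0) auto
    also have "\<dots> \<le> 1 + (M - 1) / ln r0 * ln (norm (lam x))"
      using mM[OF fam_facts(1)[OF x]] lr l1 by (intro add_left_mono mult_right_mono divide_right_mono) auto
    finally have "(d - 1) * ln r0 / (M - 1) \<le> ln (norm (lam x))" using lr M by (simp add: field_simps)
    hence "exp ((d - 1) * ln r0 / (M - 1)) \<le> norm (lam x)" using l1 by (subst ln_ge_iff[symmetric]) auto
    thus ?thesis by (simp add: \<kappa>_def)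
  qed
  thus ?thesis unfolding uniform_expansion_def using \<kappa> by blast
qed

lemma uniform_expansion_upper:
  assumes \<kappa>: "\<kappa> > 1" "\<And>x. x \<in> S \<Longrightarrow> norm (lam x) \<ge> \<kappa>"
  shows "x \<in> S \<Longrightarrow> m x (\<kappa> ^ n) \<le> d ^ n"
proof (induction n arbitrary: x)
  case 0
  thus ?case using fam_facts(6) by simp
next
  case (Suc n)
  have "f ` S = S" using fam unfolding normalized_invariant_family_def by blast
  then obtain y where y: "y \<in> S" "x = f y" using Suc.prems by (metis imageE)
  have p: "\<kappa> ^ n \<ge> 0" using \<kappa>(1) by simp
  have "m x (\<kappa> ^ Suc n) \<le> m x (norm (lam y) * \<kappa> ^ n)"
    using \<kappa>(2)[OF y(1)] \<kappa>(1) p by (intro m_mono Suc.prems) (auto intro: mult_right_mono)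
  also have "\<dots> = d * m y (\<kappa> ^ n)" unfolding y(2) by (rule m_scale[OF y(1) p])
  also have "\<dots> \<le> d * d ^ n" using Suc.IH[OF y(1)] d by simp
  finally show ?case by simp
qed

lemma uniform_expansion_lower:
  assumes \<kappa>: "\<kappa> > 1" "\<And>x. x \<in> S \<Longrightarrow> norm (lam x) \<ge> \<kappa>"
  shows "x \<in> S \<Longrightarrow> 1 / d ^ n \<le> m x (1 / \<kappa> ^ n)"
proof (induction n arbitrary: x)
  case 0
  thus ?case using fam_facts(6) by simp
next
  case (Suc n)
  note x = Suc.prems
  have p: "1 / \<kappa> ^ Suc n \<ge> 0" using \<kappa>(1) by simp
  have "1 / d ^ n \<le> m (f x) (1 / \<kappa> ^ n)" by (rule Suc.IH[OF fam_facts(1)[OF x]])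
  also have "1 / \<kappa> ^ n = \<kappa> * (1 / \<kappa> ^ Suc n)" using \<kappa>(1) by simp
  also have "m (f x) (\<kappa> * (1 / \<kappa> ^ Suc n)) \<le> m (f x) (norm (lam x) * (1 / \<kappa> ^ Suc n))"
    using \<kappa>(2)[OF x] \<kappa>(1) p by (intro m_mono fam_facts x mult_nonneg_nonneg mult_right_mono) auto
  also have "\<dots> = d * m x (1 / \<kappa> ^ Suc n)" by (rule m_scale[OF x p])
  finally show ?case using d by (simp add: field_simps)
qed

lemma uniform_expansion_power_growth: assumes uniform_expansion shows power_growth
proof -
  obtain \<kappa> where \<kappa>: "\<kappa> > 1" "\<And>x. x \<in> S \<Longrightarrow> norm (lam x) \<ge> \<kappa>" using assms unfolding uniform_expansion_def by blast
  define \<beta> where "\<beta> = ln d / ln \<kappa>"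
  have lk: "ln \<kappa> > 0" using \<kappa>(1) by simp
  have "m x r \<le> d * r powr \<beta>" if x: "x \<in> S" and r: "r \<ge> 1" for x r
  proof -
    \<comment> \<open>The least \<open>n\<close> with \<open>r \<le> \<kappa> ^ n\<close>.\<close>
    define n where "n = nat \<lceil>ln r / ln \<kappa>\<rceil>"
    have "ln r / ln \<kappa> \<ge> 0" using r lk by simp
    hence n: "ln r / ln \<kappa> \<le> n" "n \<le> ln r / ln \<kappa> + 1" unfolding n_def by linarith+
    have "ln r \<le> n * ln \<kappa>" using n(1) lk by (simp add: divide_le_eq)
    also have "\<dots> = ln (\<kappa> ^ n)" using \<kappa>(1) by (simp add: ln_realpow)
    finally have "r \<le> \<kappa> ^ n" using r \<kappa>(1) by (subst (asm) ln_le_cancel_iff) auto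
    hence "m x r \<le> m x (\<kappa> ^ n)" using r by (intro m_mono x) auto
    also have "\<dots> \<le> d ^ n" by (rule uniform_expansion_upper[OF \<kappa> x])
    also have "d ^ n = exp (n * ln d)" using d by (simp add: exp_of_nat_mult)
    also have "\<dots> \<le> exp ((ln r / ln \<kappa> + 1) * ln d)" using n(2) d by (simp add: mult_right_mono)
    also have "\<dots> = d * r powr \<beta>" using d r by (simp add: powr_def \<beta>_def exp_add algebra_simps)
    finally show ?thesis .
  qed
  thus ?thesis unfolding power_growth_def by blast
qed

lemma uniform_expansion_growth_ratio: assumes uniform_expansion shows growth_ratio
  unfolding growth_ratio_def
proof (intro allI impI)
  fix r1 r2 :: real assume r: "0 < r1 \<and> r1 < r2"
  obtain \<kappa> where \<kappa>: "\<kappa> > 1" "\<And>x. x \<in> S \<Longrightarrow> norm (lam x) \<ge> \<kappa>" using assms unfolding uniform_expansion_def by blast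
  obtain n where n: "1 / r1 < \<kappa> ^ n" using real_arch_pow[OF \<kappa>(1)] by blast
  obtain N where N: "r2 < \<kappa> ^ N" using real_arch_pow[OF \<kappa>(1)] by blast
  have kn: "\<kappa> ^ n > 0" using \<kappa>(1) by simp
  have dp: "d ^ n > 0" "d ^ N > 0" using d by auto
  show "\<exists>k. \<forall>x\<in>S. m x r1 > 0 \<and> m x r2 / m x r1 \<le> k"
  proof (intro exI[of _ "d ^ N * d ^ n"] ballI)
    fix x assume x: "x \<in> S"
    have "1 / \<kappa> ^ n \<le> r1" using n r kn by (simp add: field_simps)
    hence "m x (1 / \<kappa> ^ n) \<le> m x r1" using kn by (intro m_mono x) auto
    hence 1: "1 / d ^ n \<le> m x r1" using uniform_expansion_lower[OF \<kappa> x, of n] by simp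
    moreover have "1 / d ^ n > 0" using dp by simp
    ultimately have pos: "m x r1 > 0" by linarith
    have "m x r2 \<le> m x (\<kappa> ^ N)" using r N by (intro m_mono x) auto
    hence 2: "m x r2 \<le> d ^ N" using uniform_expansion_upper[OF \<kappa> x, of N] by simp
    have "1 \<le> d ^ n * m x r1" using 1 dp by (simp add: divide_le_eq mult.commute)
    hence "d ^ N * 1 \<le> d ^ N * (d ^ n * m x r1)" using dp by (intro mult_left_mono) auto
    hence "m x r2 \<le> d ^ N * d ^ n * m x r1" using 2 by (simp add: mult.assoc)
    thus "m x r1 > 0 \<and> m x r2 / m x r1 \<le> d ^ N * d ^ n" using pos by (simp add: divide_le_eq)
  qed
qed

lemma growth_ratio_finite_growth: assumes growth_ratio shows finite_growth
proof -
  obtain k where k: "\<forall>x\<in>S. m x 1 > 0 \<and> m x 2 / m x 1 \<le> k" using assms unfolding growth_ratio_def by (metis one_less_numeral_iff semiring_norm(76) zero_less_one)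
  show ?thesis by (rule finite_growth_I[of 2 k]) (use k fam_facts(6) in auto)
qed

lemma power_growth_normality: assumes power_growth shows normality
  unfolding normality_def normal_family_def
proof (intro allI impI)
  fix s :: "nat \<Rightarrow> complex \<Rightarrow> C2" assume s: "range s \<subseteq> \<psi> ` S"
  obtain C0 \<beta> where gr: "\<And>x r. x \<in> S \<Longrightarrow> r \<ge> 1 \<Longrightarrow> m x r \<le> C0 * r powr \<beta>" using assms unfolding power_growth_def by blast
  have bound: "\<exists>B. \<forall>x\<in>S. \<forall>z\<in>K. norm (\<psi> x z) \<le> B" if K: "compact K" for K
  proof -
    obtain r where r: "\<And>z. z \<in> K \<Longrightarrow> norm z \<le> r" using compact_imp_bounded[OF K] unfolding bounded_iff by blast
    let ?r = "max 1 r"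
    have "norm (\<psi> x z) \<le> exp (C0 * ?r powr \<beta> + C')" if x: "x \<in> S" and z: "z \<in> K" for x z
    proof -
      have "G (\<psi> x z) \<le> m x ?r" using r[OF z] by (intro m_ge x) auto
      also have "\<dots> \<le> C0 * ?r powr \<beta>" by (intro gr x) auto
      finally have "log_norm (\<psi> x z) \<le> C0 * ?r powr \<beta> + C'" using G_convergence(2)[OF fam_facts(3)[OF x, of z]] by simp
      thus ?thesis using norm_le_exp_log_norm[of "\<psi> x z"] by (meson exp_le_cancel_iff order_trans)
    qed
    thus ?thesis by blast
  qed
  have nf: "norm (fst p) \<le> norm p" "norm (snd p) \<le> norm p" for p :: C2
    by (metis norm_fst_le norm_snd_le prod.collapse)+
  have sn: "\<exists>x\<in>S. s n = \<psi> x" for n using s by auto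
  define \<H>1 where "\<H>1 = (\<lambda>x z. fst (\<psi> x z)) ` S"
  define \<H>2 where "\<H>2 = (\<lambda>x z. snd (\<psi> x z)) ` S"
  obtain g1 r1 where 1: "g1 holomorphic_on UNIV" "strict_mono (r1 :: nat \<Rightarrow> nat)"
      "\<And>x. x \<in> UNIV \<Longrightarrow> ((\<lambda>n. (\<lambda>n z. fst (s n z)) (r1 n) x) \<longlongrightarrow> g1 x) sequentially"
      "\<And>K. compact K \<Longrightarrow> K \<subseteq> UNIV \<Longrightarrow> uniform_limit K ((\<lambda>n z. fst (s n z)) \<circ> r1) g1 sequentially"
  proof (rule Montel[of UNIV \<H>1 "\<lambda>n z. fst (s n z)"])
    show "\<And>h. h \<in> \<H>1 \<Longrightarrow> h holomorphic_on UNIV" unfolding \<H>1_def using \<psi>_holomorphic(1) by auto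
    show "\<exists>B. \<forall>h\<in>\<H>1. \<forall>z\<in>K. norm (h z) \<le> B" if K: "compact K" for K
      using bound[OF K] nf(1) order_trans unfolding \<H>1_def by blast
    show "range (\<lambda>n z. fst (s n z)) \<subseteq> \<H>1"
    proof (rule image_subsetI)
      fix n obtain x where "x \<in> S" "s n = \<psi> x" using sn by blast
      thus "(\<lambda>z. fst (s n z)) \<in> \<H>1" unfolding \<H>1_def by auto
    qed
  qed (rule open_UNIV, rule that, assumption+)
  obtain g2 r2 where 2: "g2 holomorphic_on UNIV" "strict_mono (r2 :: nat \<Rightarrow> nat)"
      "\<And>x. x \<in> UNIV \<Longrightarrow> ((\<lambda>n. (\<lambda>n z. snd (s (r1 n) z)) (r2 n) x) \<longlongrightarrow> g2 x) sequentially"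
      "\<And>K. compact K \<Longrightarrow> K \<subseteq> UNIV \<Longrightarrow> uniform_limit K ((\<lambda>n z. snd (s (r1 n) z)) \<circ> r2) g2 sequentially"
  proof (rule Montel[of UNIV \<H>2 "\<lambda>n z. snd (s (r1 n) z)"])
    show "\<And>h. h \<in> \<H>2 \<Longrightarrow> h holomorphic_on UNIV" unfolding \<H>2_def using \<psi>_holomorphic(2) by auto
    show "\<exists>B. \<forall>h\<in>\<H>2. \<forall>z\<in>K. norm (h z) \<le> B" if K: "compact K" for K
      using bound[OF K] nf(2) order_trans unfolding \<H>2_def by blast
    show "range (\<lambda>n z. snd (s (r1 n) z)) \<subseteq> \<H>2"
    proof (rule image_subsetI)
      fix n obtain x where "x \<in> S" "s (r1 n) = \<psi> x" using sn by blast
      thus "(\<lambda>z. snd (s (r1 n) z)) \<in> \<H>2" unfolding \<H>2_def by auto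
    qed
  qed (rule open_UNIV, rule that, assumption+)
  define \<rho> where "\<rho> = r1 \<circ> r2"
  have "uniform_limit K (\<lambda>n. s (\<rho> n)) (\<lambda>z. (g1 z, g2 z)) sequentially" if K: "compact K" for K
  proof -
    have "uniform_limit K (\<lambda>n z. fst (s (\<rho> n) z)) g1 sequentially"
      using filterlim_compose[OF 1(4)[OF K subset_UNIV, unfolded o_def] filterlim_subseq[OF 2(2)]]
      by (simp add: \<rho>_def)
    moreover have "uniform_limit K (\<lambda>n z. snd (s (\<rho> n) z)) g2 sequentially"
      using 2(4)[OF K subset_UNIV] by (simp add: \<rho>_def o_def)
    ultimately have "uniform_limit K (\<lambda>n z. (fst (s (\<rho> n) z), snd (s (\<rho> n) z))) (\<lambda>z. (g1 z, g2 z)) sequentially"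
      by (rule uniform_limit_Pair)
    thus ?thesis by simp
  qed
  moreover have "strict_mono \<rho>" unfolding \<rho>_def using 1(2) 2(2) by (rule strict_mono_o)
  ultimately show "\<exists>g r. strict_mono r \<and> (\<forall>K. compact K \<longrightarrow> uniform_limit K (\<lambda>n. s (r n)) g sequentially)"
    by blast
qed

lemma normality_finite_growth: assumes normality shows finite_growth
proof (rule ccontr)
  assume neg: "\<not> finite_growth"
  have "\<exists>x\<in>S. m x 2 > real n" for n
    using neg finite_growth_I[of 2 "real n"] by (meson not_less one_less_numeral_iff semiring_norm(76))
  then obtain x where x: "\<And>n. x n \<in> S" "\<And>n. m (x n) 2 > real n" by metis
  have "range (\<lambda>n. \<psi> (x n)) \<subseteq> \<psi> ` S" using x(1) by auto
  then obtain g r where r: "strict_mono (r :: nat \<Rightarrow> nat)" "\<And>K. compact K \<Longrightarrow> uniform_limit K (\<lambda>n. \<psi> (x (r n))) g sequentially"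
    using assms unfolding normality_def normal_family_def by meson
  have "eventually (\<lambda>n. \<forall>z\<in>cball 0 2. dist (\<psi> (x (r n)) z) (g z) < 1) sequentially"
    using r(2)[OF compact_cball] by (rule uniform_limitD) simp
  then obtain N where N: "\<And>n z. n \<ge> N \<Longrightarrow> z \<in> cball 0 2 \<Longrightarrow> dist (\<psi> (x (r n)) z) (g z) < 1"
    unfolding eventually_sequentially by blast
  have "continuous_on (cball 0 2) (\<psi> (x (r N)))"
    using continuous_on_C2[OF \<psi>_holomorphic(1,2)[OF x(1)]] by (rule continuous_on_subset) auto
  hence "bounded (\<psi> (x (r N)) ` cball 0 2)" by (intro compact_imp_bounded compact_continuous_image compact_cball)
  then obtain B where B: "\<And>z. z \<in> cball 0 2 \<Longrightarrow> norm (\<psi> (x (r N)) z) \<le> B" unfolding bounded_iff by blast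
  have B0: "B \<ge> 0" using order_trans[OF norm_ge_zero B[of 0]] by simp
  have le: "m (x (r n)) 2 \<le> ln (B + 2) + C'" if n: "n \<ge> N" for n
  proof (rule m_le)
    fix z :: complex assume "norm z \<le> 2"
    hence z: "z \<in> cball 0 2" by simp
    have "dist (\<psi> (x (r n)) z) (\<psi> (x (r N)) z) < 2"
      using N[OF n z] N[OF order_refl z] dist_triangle2[of "\<psi> (x (r n)) z" "\<psi> (x (r N)) z" "g z"] by linarith
    hence "norm (\<psi> (x (r n)) z) \<le> B + 2"
      using B[OF z] norm_triangle_sub[of "\<psi> (x (r n)) z" "\<psi> (x (r N)) z"] by (simp add: dist_norm)
    hence "log_norm (\<psi> (x (r n)) z) \<le> ln (B + 2)" unfolding log_norm_def using B0 by (intro ln_mono) auto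
    thus "G (\<psi> (x (r n)) z) \<le> ln (B + 2) + C'" using G_convergence(2)[OF fam_facts(3)[OF x(1), of "r n" z]] by simp
  qed simp
  obtain n :: nat where n: "ln (B + 2) + C' < n" using reals_Archimedean2 by blast
  have "real n \<le> real (r (max n N))" using seq_suble[OF r(1), of "max n N"] by simp
  also have "\<dots> < m (x (r (max n N))) 2" by (rule x(2))
  also have "\<dots> \<le> ln (B + 2) + C'" by (rule le) simp
  finally show False using n by simp
qed

theorem equivalences: "(normality \<longleftrightarrow> finite_growth) \<and> (normality \<longleftrightarrow> growth_ratio) \<and> (normality \<longleftrightarrow> uniform_expansion) \<and> (normality \<longleftrightarrow> power_growth)"
  using normality_finite_growth finite_growth_uniform_expansion uniform_expansion_power_growth power_growth_normality uniform_expansion_growth_ratio growth_ratio_finite_growth by blast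

end

theorem theorem1p2:
  fixes f :: "complex \<times> complex \<Rightarrow> complex \<times> complex"
    and d :: real
    and S :: "(complex \<times> complex) set"
    and \<psi> :: "complex \<times> complex \<Rightarrow> complex \<Rightarrow> complex \<times> complex"
  assumes "polynomial_diffeo f"
    and "has_dynamical_degree f d"
    and "d > 1"
    and "normalized_invariant_family f d S \<psi>"
  shows "(normal_family (\<psi> ` S) \<longleftrightarrow>
            (\<exists>r0>1. sup_growth f d S \<psi> r0 < \<infinity>)) \<and>
         (normal_family (\<psi> ` S) \<longleftrightarrow>
            (\<forall>r1 r2. 0 < r1 \<and> r1 < r2 \<longrightarrow>
               (\<exists>k. \<forall>x\<in>S. growth f d \<psi> x r1 > 0 \<and> growth f d \<psi> x r2 / growth f d \<psi> x r1 \<le> k))) \<and>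
         (normal_family (\<psi> ` S) \<longleftrightarrow>
            (\<exists>\<kappa>>1. \<forall>x\<in>S. norm (leaf_multiplier f \<psi> x) \<ge> \<kappa>)) \<and>
         (normal_family (\<psi> ` S) \<longleftrightarrow>
            (\<exists>C \<beta>. \<forall>x\<in>S. \<forall>r\<ge>1. growth f d \<psi> x r \<le> C * r powr \<beta>))"
proof -
  obtain C where C: "C \<ge> 0" "\<And>x. x \<in> closure (K_minus f) \<Longrightarrow> \<bar>log_norm (f x) - d * log_norm x\<bar> \<le> C"
    using log_norm_forward_estimate[OF assms(1-3)] by blast
  interpret leaf_family f d S \<psi> C by unfold_locales (use assms C in auto)
  show ?thesis using equivalences unfolding normality_def finite_growth_def growth_ratio_def uniform_expansion_def power_growth_def .
qed

end
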